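(* Let $m\ge 1$ and let $\{\boldsymbol{\Omega}_n\}_{n\ge 1}$ be a sequence of $m$-dimensional real random vectors. Let $\tau>0$, and suppose that the moment generating function satisfies the asymptotic expression $$M_n(\mathbf{s}):=\mathbb{E}\bigl(e^{\langle \boldsymbol{\Omega}_n,\mathbf{s}\rangle}\bigr)=e^{W_n(\mathbf{s})}\bigl(1+O(\kappa_n^{-1})\bigr),$$ the $O$-term being uniform for $\mathbf{s}\in\mathbb{C}^m$ with $\|\mathbf{s}\|\le\tau$, where (1) $W_n(\mathbf{s})=u(\mathbf{s})\phi_n+v(\mathbf{s})$, with $u(\mathbf{s})$ and $v(\mathbf{s})$ analytic for $\|\mathbf{s}\|\le\tau$ and independent of $n$; (2) $\lim_{n\to\infty}\phi_n=\infty$; (3) $\lim_{n\to\infty}\kappa_n=\infty$. Let $H_u(\mathbf{0})$ denote the Hessian of $u$ at the origin. (a) If $H_u(\mathbf{0})$ is non-singular, then the distribution of $\boldsymbol{\Omega}_n$ is asymptotically normal with speed of convergence $O(\phi_n^{-1/2})$, i.e., $$\sup_{\mathbf{x}\in\mathbb{R}^m}\left|\mathbb{P}\left(\frac{\boldsymbol{\Omega}_n-\operatorname{grad}u(\mathbf{0})\,\phi_n}{\sqrt{\phi_n}}\le\mathbf{x}\right)-\Phi_{H_u(\mathbf{0})}(\mathbf{x})\right|=O\left(\frac{1}{\sqrt{\phi_n}}\right),$$ where $\Phi_\Sigma$ denotes the distribution function of the non-degenerate $m$-dimensional normal distribution with mean $\mathbf{0}$ and variance-covariance matrix $\Sigma$,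 i.e., $$\Phi_\Sigma(\mathbf{x})=\frac{1}{(2\pi)^{m/2}\sqrt{\det\Sigma}}\int_{\mathbf{y}\le\mathbf{x}}\exp\left(-\frac12\mathbf{y}^\top\Sigma^{-1}\mathbf{y}\right)d\mathbf{y}.$$ (b) If $H_u(\mathbf{0})$ is singular (all other assumptions being unchanged), then the random variables $$\frac{\boldsymbol{\Omega}_n-\operatorname{grad}u(\mathbf{0})\,\phi_n}{\sqrt{\phi_n}}$$ converge in distribution to a degenerate normal distribution with mean $\mathbf{0}$ and variance-covariance matrix $H_u(\mathbf{0})$.
   Context: Here $(\phi_n)$ and $(\kappa_n)$ are sequences of real numbers. For a vector $\mathbf{s}=(s_1,\dots,s_m)$, $\|\mathbf{s}\|=\max_j|s_j|$ is the maximum norm, and $\langle\boldsymbol{\Omega}_n,\mathbf{s}\rangle=\sum_{j=1}^m\Omega_{n,j}s_j$ (bilinear, no complex conjugation). For $\mathbf{x},\mathbf{y}\in\mathbb{R}^m$, $\mathbf{y}\le\mathbf{x}$ means $y_\ell\le x_\ell$ for all $1\le\ell\le m$. "Analytic for $\|\mathbf{s}\|\le\tau$" means analytic on a neighbourhood of this closed polydisc. $O$-terms are understood for $n\to\infty$ with implicit constants independent of $n$; they may depend on $m$, on $\tau$, and on the given fixed data (the sequence, $u$, $v$, and the implicit constant in the hypothesis). A "degenerate normal distribution" with covariance matrix $\Sigma$ is the distribution on $\mathbb{R}^m$ with characteristic function $\mathbf{t}\mapsto\exp(-\frac12\mathbf{t}^\top\Sigma\mathbf{t})$ for a singular positive semidefinite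 $\Sigma$ (possibly $\Sigma=0$, a point mass). *)

theory Defs
  imports "HOL-Probability.Probability" "HOL-Library.Landau_Symbols"
begin

text \<open>The library's \<^const>\<open>infnorm\<close> is not the maximum norm on complex vectors: it takes the
  maximum over real and imaginary parts separately.\<close>

definition max_norm :: "complex^'m \<Rightarrow> real" where
  "max_norm s = (MAX j. cmod (s $ j))"

definition bilin :: "real^'m \<Rightarrow> complex^'m \<Rightarrow> complex" where
  "bilin x s = (\<Sum>j\<in>UNIV. complex_of_real (x $ j) * s $ j)"

definition mgf :: "'a measure \<Rightarrow> ('a \<Rightarrow> real^'m) \<Rightarrow> complex^'m \<Rightarrow> complex" where
  "mgf M X s = (CLINT \<omega>|M. exp (bilin (X \<omega>) s))"

text \<open>Analyticity in several complex variables, as local expansion into a power series indexed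
  by multi-indices \<open>\<alpha> :: 'm \<Rightarrow> nat\<close>.  Like \<^const>\<open>analytic_on\<close> in one variable, analyticity
  on a set means analyticity in a neighbourhood of each of its points.\<close>

definition multi_analytic_at :: "(complex^'m \<Rightarrow> complex) \<Rightarrow> complex^'m \<Rightarrow> bool" where
  "multi_analytic_at f a \<longleftrightarrow>
    (\<exists>r>0. \<exists>c :: ('m \<Rightarrow> nat) \<Rightarrow> complex. \<forall>z. max_norm (z - a) < r \<longrightarrow>
      ((\<lambda>\<alpha>. c \<alpha> * (\<Prod>j\<in>UNIV. (z $ j - a $ j) ^ \<alpha> j)) has_sum f z) UNIV)"

definition multi_analytic_on :: "(complex^'m \<Rightarrow> complex) \<Rightarrow> (complex^'m) set \<Rightarrow> bool" where
  "multi_analytic_on f S \<longleftrightarrow> (\<forall>a\<in>S. multi_analytic_at f a)"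

definition partial :: "'m \<Rightarrow> (complex^'m \<Rightarrow> complex) \<Rightarrow> complex^'m \<Rightarrow> complex" where
  "partial j f a = deriv (\<lambda>z. f (a + axis j z)) 0"

definition grad :: "(complex^'m \<Rightarrow> complex) \<Rightarrow> complex^'m \<Rightarrow> complex^'m" where
  "grad f a = (\<chi> j. partial j f a)"

definition hessian :: "(complex^'m \<Rightarrow> complex) \<Rightarrow> complex^'m \<Rightarrow> complex^'m^'m" where
  "hessian f a = (\<chi> j k. partial j (partial k f) a)"

definition pos_semidef :: "real^'m^'m \<Rightarrow> bool" where
  "pos_semidef A \<longleftrightarrow> transpose A = A \<and> (\<forall>x. 0 \<le> x \<bullet> (A *v x))"

definition pos_def :: "real^'m^'m \<Rightarrow> bool" where
  "pos_def A \<longleftrightarrow> transpose A = A \<and> (\<forall>x. x \<noteq> 0 \<longrightarrow> 0 < x \<bullet> (A *v x))"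

text \<open>The order on \<^typ>\<open>real^'m\<close> is the componentwise one, so \<open>{..x}\<close> is an orthant.\<close>

definition normal_cdf :: "real^'m^'m \<Rightarrow> real^'m \<Rightarrow> real" where
  "normal_cdf \<Sigma> x =
    1 / ((2 * pi) powr (real CARD('m) / 2) * sqrt (det \<Sigma>)) *
    (LINT y:{..x}|lborel. exp (- (1 / 2) * (y \<bullet> (matrix_inv \<Sigma> *v y))))"

definition degenerate_normal :: "real^'m^'m \<Rightarrow> (real^'m) measure \<Rightarrow> bool" where
  "degenerate_normal \<Sigma> N \<longleftrightarrow>
    pos_semidef \<Sigma> \<and> \<not> invertible \<Sigma> \<and> prob_space N \<and> sets N = sets borel \<and>
    (\<forall>t. (CLINT y|N. iexp (t \<bullet> y)) = complex_of_real (exp (- (1 / 2) * (t \<bullet> (\<Sigma> *v t)))))"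

text \<open>The library's weak convergence covers only measures on the real line.  The random
  variables \<open>X n\<close> may live on different probability spaces.\<close>

definition conv_in_distribution ::
  "(nat \<Rightarrow> 'a measure) \<Rightarrow> (nat \<Rightarrow> 'a \<Rightarrow> real^'m) \<Rightarrow> (real^'m) measure \<Rightarrow> bool" where
  "conv_in_distribution P X N \<longleftrightarrow>
    (\<forall>f :: real^'m \<Rightarrow> real. continuous_on UNIV f \<and> bounded (range f) \<longrightarrow>
      (\<lambda>n. LINT \<omega>|P n. f (X n \<omega>)) \<longlonglongrightarrow> (LINT y|N. f y))"

end

theory Submission
  imports Defs "HOL-Complex_Analysis.Conformal_Mappings"
begin

text \<open>The function \<open>exp (- W\<^sub>n s) * M\<^sub>n s\<close> is holomorphic along complex lines through the origin and stays within
\<open>O (1 / \<kappa>\<^sub>n)\<close> of 1. By Schwarz's lemma it therefore differs from its value at the origin by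
\<open>O (\<parallel>s\<parallel>)\<close>, and since \<open>M\<^sub>n 0 = 1\<close> and \<open>u\<close>, \<open>v\<close> have Taylor expansions,
\<open>M\<^sub>n s = exp (\<phi>\<^sub>n (L s + H s / 2) + O (\<phi>\<^sub>n \<parallel>s\<parallel>^3 + \<parallel>s\<parallel>)) (1 + O (\<parallel>s\<parallel>))\<close>, where \<open>L\<close> is the linear form of the
gradient and \<open>H\<close> the quadratic form of the Hessian. All error terms vanish at \<open>s = 0\<close>; this is why
\<open>\<kappa>\<^sub>n\<close> does not enter the rate of convergence. This expansion is \<open>quasi_power_expansion\<close>.

Limits of \<open>M\<^sub>n\<close> along real rays are limits of nonnegative numbers, and \<open>exp (t w)\<close> is nonnegative
for all \<open>t \<ge> 0\<close> only if \<open>w\<close> is real; hence gradient and Hessian are real. On imaginary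
arguments \<open>M\<^sub>n\<close> is bounded by 1, so the Hessian is positive semidefinite. The standardised
variables have transforms converging to \<open>exp (H s / 2)\<close>, which is the transform of the image of a
standard Gaussian vector under a matrix \<open>A\<close> with \<open>A A\<^sup>T = \<Sigma>\<close>. If \<open>\<Sigma>\<close> is singular, the continuity
theorem for characteristic functions (\<open>Levy_continuity_vec\<close>) finishes the proof.

If \<open>\<Sigma>\<close> is non-singular, the speed of convergence comes from the Berry--Esseen inequality
\<open>multivariate_Berry_Esseen\<close>. A distribution function \<open>F\<close> in several variables is not integrable, and the
Fourier transform of a difference of two of them has singularities along the coordinate
hyperplanes. Both obstacles disappear after an exponential tilt: \<open>exp (- (x\<^sub>1 + \<dots> + x\<^sub>m)) F x\<close> is
integrable, and its transform is the moment generating function on the line \<open>Re s\<^sub>j = -1\<close> times a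
bounded factor. As the moment generating functions exist near the origin, they can be compared
on such lines just as on the imaginary axis, with an error \<open>O (1 / sqrt \<phi>\<^sub>n)\<close> times an integrable
function (\<open>quasi_power_tilted_estimate\<close>), and Esseen's smoothing argument bounds the difference of the
tilted distribution functions uniformly. Undoing the tilt is harmless only where \<open>x \<le> 0\<close>; for this
reason the same is done for all \<open>2^m\<close> types of orthants, each with the tilt that decays in its own
direction, and the orthant \<open>{..x}\<close> is reduced to orthants of good position by complementing one
coordinate at a time (\<open>orthant_diff_bound\<close>).\<close>

section \<open>Second-order Taylor expansion of analytic functions of several variables\<close>

definition qform :: "complex^'m^'m \<Rightarrow> complex^'m \<Rightarrow> complex" where
  "qform H s = (\<Sum>j\<in>UNIV. \<Sum>k\<in>UNIV. H $ j $ k * s $ j * s $ k)"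

definition lform :: "complex^'m \<Rightarrow> complex^'m \<Rightarrow> complex" where
  "lform L s = (\<Sum>j\<in>UNIV. L $ j * s $ j)"

lemma max_norm_le_iff: "max_norm s \<le> c \<longleftrightarrow> (\<forall>j. cmod (s $ j) \<le> c)"
  unfolding max_norm_def by (subst Max_le_iff) auto

lemma max_norm_less_iff: "max_norm s < c \<longleftrightarrow> (\<forall>j. cmod (s $ j) < c)"
  unfolding max_norm_def by (subst Max_less_iff) auto

lemma cmod_le_max_norm: "cmod (s $ j) \<le> max_norm s"
  using max_norm_le_iff[of s "max_norm s"] by simp

lemma max_norm_nonneg[simp]: "0 \<le> max_norm s"
  using order_trans[OF norm_ge_zero cmod_le_max_norm[of s undefined]] .

lemma max_norm_0[simp]: "max_norm 0 = 0"
  by (intro antisym) (simp_all add: max_norm_le_iff)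

lemma max_norm_triangle: "max_norm (a + b) \<le> max_norm a + max_norm b"
proof -
  have "cmod (a $ j + b $ j) \<le> max_norm a + max_norm b" for j
    using norm_triangle_ineq[of "a $ j" "b $ j"] cmod_le_max_norm[of a j] cmod_le_max_norm[of b j] by linarith
  then show ?thesis by (simp add: max_norm_le_iff)
qed

lemma max_norm_smult: "max_norm (c *s a) \<le> cmod c * max_norm a"
  by (simp add: max_norm_le_iff norm_mult mult_left_mono cmod_le_max_norm)

lemma max_norm_axis: "max_norm (axis j z) = cmod z"
proof (rule antisym)
  show "max_norm (axis j z) \<le> cmod z" by (simp add: max_norm_le_iff axis_def)
  show "cmod z \<le> max_norm (axis j z)" using cmod_le_max_norm[of "axis j z" j] by (simp add: axis_def)
qed

text \<open>Peeling off one variable at a time classifies the monomials of degree at most two by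
induction instead of by an enumeration of multi-indices.\<close>

lemma monomial_Suc:
  fixes \<alpha> :: "'m::finite \<Rightarrow> nat"
  assumes "sum \<alpha> UNIV = Suc n"
  obtains j \<beta> where "sum \<beta> UNIV = n"
    "\<And>z :: complex^'m. (\<Prod>i\<in>UNIV. (z $ i) ^ \<alpha> i) = z $ j * (\<Prod>i\<in>UNIV. (z $ i) ^ \<beta> i)"
proof -
  have "\<exists>j. \<alpha> j > 0"
  proof (rule ccontr)
    assume "\<not> ?thesis"
    then show False using assms by simp
  qed
  then obtain j where j: "\<alpha> j > 0" ..
  let ?\<beta> = "\<alpha>(j := \<alpha> j - 1)"
  have "sum \<alpha> UNIV = \<alpha> j + sum \<alpha> (UNIV - {j})" by (simp add: sum.remove[of UNIV j])
  moreover have "sum ?\<beta> UNIV = (\<alpha> j - 1) + sum \<alpha> (UNIV - {j})" by (simp add: sum.remove[of UNIV j])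
  ultimately have 1: "sum ?\<beta> UNIV = n" using assms j by linarith
  have "(\<Prod>i\<in>UNIV. (z $ i) ^ \<alpha> i) = z $ j * (\<Prod>i\<in>UNIV. (z $ i) ^ ?\<beta> i)" for z :: "complex^'m"
  proof -
    have "(\<Prod>i\<in>UNIV. (z $ i) ^ \<alpha> i) = (z $ j) ^ \<alpha> j * (\<Prod>i\<in>UNIV - {j}. (z $ i) ^ \<alpha> i)"
      by (subst prod.remove[of UNIV j]) auto
    moreover have "(\<Prod>i\<in>UNIV. (z $ i) ^ ?\<beta> i) = (z $ j) ^ (\<alpha> j - 1) * (\<Prod>i\<in>UNIV - {j}. (z $ i) ^ \<alpha> i)"
      by (subst prod.remove[of UNIV j]) (auto intro!: prod.cong)
    moreover have "(z $ j) ^ \<alpha> j = z $ j * (z $ j) ^ (\<alpha> j - 1)"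
      using j by (simp flip: power_Suc)
    ultimately show ?thesis by simp
  qed
  with 1 show ?thesis by (rule that)
qed

text \<open>Symmetry of \<open>H\<close> and the factor \<open>1 / 2\<close> make \<open>L\<close> and \<open>H\<close> unique: they are the gradient and the
Hessian at the origin.\<close>

definition quadratic_poly :: "(complex^'m \<Rightarrow> complex) \<Rightarrow> bool" where
  "quadratic_poly p \<longleftrightarrow> (\<exists>a L H. transpose H = H \<and> (\<forall>z. p z = a + lform L z + qform H z / 2))"

lemma quadratic_poly_0: "quadratic_poly (\<lambda>z. 0)"
  unfolding quadratic_poly_def
  by (intro exI[of _ 0]) (auto simp: lform_def qform_def transpose_def vec_eq_iff)

lemma quadratic_poly_add:
  assumes "quadratic_poly p" "quadratic_poly q" shows "quadratic_poly (\<lambda>z. p z + q z)"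
proof -
  obtain a L H where 1: "transpose H = H" "\<And>z. p z = a + lform L z + qform H z / 2"
    using assms(1) unfolding quadratic_poly_def by blast
  obtain a' L' H' where 2: "transpose H' = H'" "\<And>z. q z = a' + lform L' z + qform H' z / 2"
    using assms(2) unfolding quadratic_poly_def by blast
  have "transpose (H + H') = H + H'" using 1(1) 2(1) by (simp add: transpose_def vec_eq_iff)
  moreover have "p z + q z = (a + a') + lform (L + L') z + qform (H + H') z / 2" for z
    by (simp add: 1 2 lform_def qform_def sum.distrib algebra_simps add_divide_distrib)
  ultimately show ?thesis unfolding quadratic_poly_def by blast
qed

lemma quadratic_poly_cmult:
  assumes "quadratic_poly p" shows "quadratic_poly (\<lambda>z. c * p z)"
proof -
  obtain a L H where 1: "transpose H = H" "\<And>z. p z = a + lform L z + qform H z / 2"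
    using assms(1) unfolding quadratic_poly_def by blast
  let ?H = "\<chi> i j. c * H $ i $ j"
  have "transpose ?H = ?H" using 1(1) by (simp add: transpose_def vec_eq_iff)
  moreover have "c * p z = c * a + lform (\<chi> j. c * L $ j) z + qform ?H z / 2" for z
    by (simp add: 1 lform_def qform_def sum_distrib_left algebra_simps)
  ultimately show ?thesis unfolding quadratic_poly_def by blast
qed

lemma quadratic_poly_sum:
  assumes "finite F" "\<And>\<alpha>. \<alpha> \<in> F \<Longrightarrow> quadratic_poly (p \<alpha>)" shows "quadratic_poly (\<lambda>z. \<Sum>\<alpha>\<in>F. p \<alpha> z)"
  using assms by (induction F rule: finite_induct) (auto simp: quadratic_poly_0 quadratic_poly_add)

lemma lform_axis: "lform (axis j a) z = a * z $ j"
  by (simp add: lform_def axis_def if_distrib if_distribR cong: if_cong)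

lemma sum_sum_delta:
  fixes g :: "'m::finite \<Rightarrow> 'm \<Rightarrow> 'b::comm_monoid_add"
  assumes "\<And>a b. a \<noteq> j \<or> b \<noteq> k \<Longrightarrow> g a b = 0"
  shows "(\<Sum>a\<in>UNIV. \<Sum>b\<in>UNIV. g a b) = g j k"
proof -
  have "(\<Sum>b\<in>UNIV. g a b) = (if a = j then g j k else 0)" for a
  proof -
    have "(\<Sum>b\<in>UNIV. g a b) = (\<Sum>b\<in>UNIV. if b = k then g a k else 0)"
      by (rule sum.cong) (auto simp: assms)
    then show ?thesis by (auto simp: assms)
  qed
  then show ?thesis by simp
qed

lemma quadratic_poly_monomial:
  fixes \<alpha> :: "'m::finite \<Rightarrow> nat"
  assumes "sum \<alpha> UNIV \<le> 2"
  shows "quadratic_poly (\<lambda>z. \<Prod>i\<in>UNIV. (z $ i) ^ \<alpha> i)"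
proof -
  have z: "lform 0 z = 0" "qform 0 z = 0" "transpose 0 = (0 :: complex^'m^'m)" for z :: "complex^'m"
    by (auto simp: lform_def qform_def transpose_def vec_eq_iff)
  consider "sum \<alpha> UNIV = 0" | "sum \<alpha> UNIV = Suc 0" | "sum \<alpha> UNIV = Suc (Suc 0)" using assms by linarith
  then show ?thesis
  proof cases
    case 1
    then have "(\<Prod>i\<in>UNIV. (z $ i) ^ \<alpha> i) = 1 + lform 0 z + qform 0 z / 2" for z :: "complex^'m"
      by (simp add: z)
    then show ?thesis unfolding quadratic_poly_def using z by blast
  next
    case 2
    then obtain j \<beta> where b: "sum \<beta> UNIV = 0"
      "\<And>z :: complex^'m. (\<Prod>i\<in>UNIV. (z $ i) ^ \<alpha> i) = z $ j * (\<Prod>i\<in>UNIV. (z $ i) ^ \<beta> i)"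
      by (rule monomial_Suc) auto
    have "(\<Prod>i\<in>UNIV. (z $ i) ^ \<alpha> i) = 0 + lform (axis j 1) z + qform 0 z / 2" for z :: "complex^'m"
      using b by (simp add: z lform_axis)
    then show ?thesis unfolding quadratic_poly_def using z by blast
  next
    case 3
    then obtain j \<beta> where b: "sum \<beta> UNIV = Suc 0"
      "\<And>z :: complex^'m. (\<Prod>i\<in>UNIV. (z $ i) ^ \<alpha> i) = z $ j * (\<Prod>i\<in>UNIV. (z $ i) ^ \<beta> i)"
      by (rule monomial_Suc) auto
    from b(1) obtain k \<gamma> where c: "sum \<gamma> UNIV = 0"
      "\<And>z :: complex^'m. (\<Prod>i\<in>UNIV. (z $ i) ^ \<beta> i) = z $ k * (\<Prod>i\<in>UNIV. (z $ i) ^ \<gamma> i)"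
      by (rule monomial_Suc) auto
    let ?H = "(\<chi> a b. of_bool (a = j \<and> b = k) + of_bool (a = k \<and> b = j)) :: complex^'m^'m"
    have "transpose ?H = ?H" unfolding transpose_def vec_eq_iff
      by (simp only: vec_lambda_beta conj_commute[of "_ = k"] add.commute) simp
    moreover have "(\<Prod>i\<in>UNIV. (z $ i) ^ \<alpha> i) = 0 + lform 0 z + qform ?H z / 2" for z :: "complex^'m"
    proof -
      have s: "(\<Sum>a\<in>UNIV. \<Sum>b\<in>UNIV. of_bool (a = j \<and> b = k) * z $ a * z $ b) = z $ j * z $ k" for j k
        by (subst sum_sum_delta[of j k]) auto
      have "qform ?H z = 2 * (z $ j * z $ k)"
        using s[of j k] s[of k j] by (simp add: qform_def distrib_right sum.distrib)
      then show ?thesis using b c by (simp add: z)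
    qed
    ultimately show ?thesis unfolding quadratic_poly_def by blast
  qed
qed

lemma prod_power_le:
  fixes z :: "complex^'m"
  assumes "max_norm z \<le> t"
  shows "cmod (\<Prod>j\<in>UNIV. (z $ j) ^ \<alpha> j) \<le> t ^ sum \<alpha> UNIV"
proof -
  have "cmod (z $ j) \<le> t" for j using assms by (simp add: max_norm_le_iff)
  then have "(\<Prod>j\<in>UNIV. cmod (z $ j) ^ \<alpha> j) \<le> (\<Prod>j\<in>UNIV. t ^ \<alpha> j)"
    by (intro prod_mono conjI power_mono) auto
  then show ?thesis by (simp add: prod_norm[symmetric] norm_power power_sum)
qed

text \<open>The series converges absolutely at the point whose coordinates all equal \<open>r\<close>. This majorant
controls the series on the polydisc of radius \<open>r\<close>: beyond the finitely many multi-indices of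
degree at most two every term gains the factor \<open>(max_norm z / r)^3\<close>, and along complex lines
the partial sums converge uniformly, so the limit is holomorphic there.\<close>

lemma multi_analytic_Taylor2:
  fixes f :: "complex^'m \<Rightarrow> complex"
  assumes "multi_analytic_at f 0"
  obtains r B a L H where "r > 0" "B \<ge> 0" "transpose H = H"
    "\<And>z. max_norm z \<le> r \<Longrightarrow> cmod (f z - (a + lform L z + qform H z / 2)) \<le> B * max_norm z ^ 3"
    "\<And>w d. (\<lambda>l. f (w + l *s d)) holomorphic_on {l. max_norm (w + l *s d) < r}"
proof -
  obtain r0 c where r0: "r0 > 0"
    and c: "\<And>z. max_norm z < r0 \<Longrightarrow> ((\<lambda>\<alpha>. c \<alpha> * (\<Prod>j\<in>UNIV. (z $ j) ^ \<alpha> j)) has_sum f z) UNIV"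
    using assms unfolding multi_analytic_at_def by auto
  \<comment> \<open>strictly inside the polydisc of convergence, so that the closed polydisc of radius \<open>r\<close> is harmless\<close>
  define r where "r = r0 / 2"
  have r: "r > 0" "r < r0" using r0 by (auto simp: r_def)
  define M where "M \<alpha> = cmod (c \<alpha>) * r ^ sum \<alpha> UNIV" for \<alpha> :: "'m \<Rightarrow> nat"
  have "max_norm ((\<chi> j. complex_of_real r) :: complex^'m) < r0" using r by (simp add: max_norm_less_iff)
  from c[OF this] have "(\<lambda>\<alpha>. c \<alpha> * complex_of_real r ^ sum \<alpha> UNIV) summable_on UNIV"
    by (auto simp: power_sum has_sum_imp_summable)
  then have M: "M summable_on UNIV"
    unfolding M_def using r by (simp add: summable_on_iff_abs_summable_on_complex norm_mult norm_power)
  have M0: "M \<alpha> \<ge> 0" for \<alpha> using r by (simp add: M_def)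
  have term_le: "cmod (c \<alpha> * (\<Prod>j\<in>UNIV. (z $ j) ^ \<alpha> j)) \<le> M \<alpha>" if "max_norm z \<le> r" for z \<alpha>
    using prod_power_le[OF that, of \<alpha>] unfolding M_def norm_mult by (intro mult_left_mono) auto
  define F where "F = {\<alpha>::'m \<Rightarrow> nat. sum \<alpha> UNIV \<le> 2}"
  have finF: "finite F"
  proof (rule finite_subset)
    show "F \<subseteq> (UNIV \<rightarrow>\<^sub>E {..2})"
    proof
      fix \<alpha> assume "\<alpha> \<in> F"
      then have "\<alpha> j \<le> 2" for j
        using member_le_sum[of j UNIV \<alpha>] by (simp add: F_def)
      then show "\<alpha> \<in> UNIV \<rightarrow>\<^sub>E {..2}" by auto
    qed
  qed (intro finite_PiE; simp)
  define p where "p z = (\<Sum>\<alpha>\<in>F. c \<alpha> * (\<Prod>j\<in>UNIV. (z $ j) ^ \<alpha> j))" for z :: "complex^'m"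
  have "quadratic_poly p"
    unfolding p_def[abs_def]
    by (intro quadratic_poly_sum finF quadratic_poly_cmult quadratic_poly_monomial) (simp add: F_def)
  then obtain a L H where H: "transpose H = H" and p: "\<And>z. p z = a + lform L z + qform H z / 2"
    unfolding quadratic_poly_def by blast
  define B where "B = (\<Sum>\<^sub>\<infinity>\<alpha>\<in>UNIV - F. M \<alpha>) / r ^ 3"
  have Ms: "M summable_on (UNIV - F)" using M by (rule summable_on_subset_banach) auto
  have b0: "B \<ge> 0" unfolding B_def using r M0 by (intro divide_nonneg_nonneg infsum_nonneg) auto
  have tay: "cmod (f z - (a + lform L z + qform H z / 2)) \<le> B * max_norm z ^ 3" if z: "max_norm z \<le> r" for z
  proof -
    let ?t = "max_norm z"
    have "((\<lambda>\<alpha>. c \<alpha> * (\<Prod>j\<in>UNIV. (z $ j) ^ \<alpha> j)) has_sum (f z - p z)) (UNIV - F)"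
      unfolding p_def using z r by (intro has_sum_Diff c has_sum_finite finF) auto
    moreover have "((\<lambda>\<alpha>. (?t / r) ^ 3 * M \<alpha>) has_sum ((?t / r) ^ 3 * infsum M (UNIV - F))) (UNIV - F)"
      by (intro has_sum_cmult_right has_sum_infsum Ms)
    moreover have "cmod (c \<alpha> * (\<Prod>j\<in>UNIV. (z $ j) ^ \<alpha> j)) \<le> (?t / r) ^ 3 * M \<alpha>" if "\<alpha> \<in> UNIV - F" for \<alpha>
    proof -
      have s: "3 \<le> sum \<alpha> UNIV" using that by (simp add: F_def)
      have "cmod (c \<alpha> * (\<Prod>j\<in>UNIV. (z $ j) ^ \<alpha> j)) \<le> cmod (c \<alpha>) * ?t ^ sum \<alpha> UNIV"
        using prod_power_le[of z ?t \<alpha>] unfolding norm_mult by (intro mult_left_mono) auto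
      also have "?t ^ sum \<alpha> UNIV = (?t / r) ^ sum \<alpha> UNIV * r ^ sum \<alpha> UNIV" using r by (simp add: power_divide)
      also have "\<dots> \<le> (?t / r) ^ 3 * r ^ sum \<alpha> UNIV"
        using z r s by (intro mult_right_mono power_decreasing) auto
      finally have "cmod (c \<alpha> * (\<Prod>j\<in>UNIV. (z $ j) ^ \<alpha> j)) \<le> cmod (c \<alpha>) * ((?t / r) ^ 3 * r ^ sum \<alpha> UNIV)"
        by (simp add: mult_left_mono)
      then show ?thesis by (simp add: M_def mult_ac)
    qed
    ultimately have "cmod (f z - p z) \<le> (?t / r) ^ 3 * infsum M (UNIV - F)"
      by (rule norm_infsum_le)
    then show ?thesis by (simp add: p B_def power_divide mult_ac)
  qed
  have hl: "(\<lambda>l. f (w + l *s d)) holomorphic_on {l. max_norm (w + l *s d) < r}" (is "?g holomorphic_on ?S") for w d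
  proof -
    have op: "open ?S"
    proof -
      have "?S = (\<Inter>j. {l. cmod (w $ j + l * d $ j) < r})" by (auto simp: max_norm_less_iff)
      moreover have "open (\<Inter>j. {l. cmod (w $ j + l * d $ j) < r})"
        by (intro open_INT ballI open_Collect_less continuous_intros) auto
      ultimately show ?thesis by simp
    qed
    have "?g field_differentiable at l" if l: "l \<in> ?S" for l
    proof -
      obtain e where e: "e > 0" "cball l e \<subseteq> ?S" using op l by (meson open_contains_cball)
      have lim: "uniform_limit (cball l e) (\<lambda>X l. \<Sum>\<alpha>\<in>X. c \<alpha> * (\<Prod>j\<in>UNIV. ((w + l *s d) $ j) ^ \<alpha> j)) ?g (finite_subsets_at_top UNIV)"
      proof (rule Weierstrass_m_test_general'[OF _ _ M])
        fix \<alpha> y assume "y \<in> cball l e"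
        then have "max_norm (w + y *s d) < r" using e by blast
        then show "cmod (c \<alpha> * (\<Prod>j\<in>UNIV. ((w + y *s d) $ j) ^ \<alpha> j)) \<le> M \<alpha>" by (intro term_le) simp
      next
        fix y assume "y \<in> cball l e"
        then have "max_norm (w + y *s d) < r" using e by blast
        then show "((\<lambda>\<alpha>. c \<alpha> * (\<Prod>j\<in>UNIV. ((w + y *s d) $ j) ^ \<alpha> j)) has_sum f (w + y *s d)) UNIV"
          using r by (intro c) simp
      qed
      have "?g holomorphic_on ball l e"
      proof (rule holomorphic_uniform_limit[OF _ lim])
        show "\<forall>\<^sub>F X in finite_subsets_at_top UNIV.
          continuous_on (cball l e) (\<lambda>l. \<Sum>\<alpha>\<in>X. c \<alpha> * (\<Prod>j\<in>UNIV. (w + l *s d) $ j ^ \<alpha> j)) \<and>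
          (\<lambda>l. \<Sum>\<alpha>\<in>X. c \<alpha> * (\<Prod>j\<in>UNIV. (w + l *s d) $ j ^ \<alpha> j)) holomorphic_on ball l e"
          by (intro always_eventually allI conjI) (auto intro!: continuous_intros holomorphic_intros)
      qed auto
      then show ?thesis using e by (intro holomorphic_on_imp_differentiable_at[of _ "ball l e"]) auto
    qed
    then show ?thesis by (auto simp: holomorphic_on_def field_differentiable_at_within)
  qed
  show ?thesis by (rule that[OF r(1) b0 H tay hl])
qed

lemma has_field_derivative_quadratic_remainder:
  fixes g :: "complex \<Rightarrow> complex"
  assumes r: "r > 0" and b: "\<And>z. cmod z < r \<Longrightarrow> cmod (g z - g 0 - D * z) \<le> K * cmod z ^ 2"
  shows "(g has_field_derivative D) (at 0)"
proof -
  have K: "K \<ge> 0"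
  proof -
    have "0 \<le> K * (cmod (of_real (r/2)))\<^sup>2"
      by (rule order_trans[OF norm_ge_zero b]) (use r in simp)
    then show ?thesis using r by (simp add: zero_le_mult_iff)
  qed
  have "((\<lambda>h. (g (0 + h) - g 0) / h - D) \<longlongrightarrow> 0) (at 0)"
  proof (rule Lim_null_comparison)
    show "\<forall>\<^sub>F h in at 0. cmod ((g (0 + h) - g 0) / h - D) \<le> K * cmod h"
      unfolding eventually_at
    proof (intro exI[of _ r] conjI ballI impI r)
      fix h :: complex assume h: "h \<noteq> 0 \<and> dist h 0 < r"
      have "(g (0 + h) - g 0) / h - D = (g h - g 0 - D * h) / h" using h by (simp add: field_simps)
      also have "cmod \<dots> \<le> K * cmod h ^ 2 / cmod h"
        using b[of h] h by (simp add: norm_divide divide_right_mono)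
      also have "\<dots> = K * cmod h" using h by (simp add: power2_eq_square)
      finally show "cmod ((g (0 + h) - g 0) / h - D) \<le> K * cmod h" .
    qed
    have "((\<lambda>h. K * cmod h) \<longlongrightarrow> K * cmod 0) (at (0::complex))" by (intro tendsto_intros)
    then show "((\<lambda>h. K * cmod h) \<longlongrightarrow> 0) (at (0::complex))" by simp
  qed
  then have "((\<lambda>h. (g (0 + h) - g 0) / h) \<longlongrightarrow> D) (at 0)" by (simp add: LIM_zero_iff)
  then show ?thesis by (simp add: DERIV_def)
qed

lemma smult_axis: "z *s axis j (1::complex) = axis j z"
  by (simp add: axis_def vec_eq_iff)

lemma qform_axis_add:
  assumes H: "transpose H = H"
  shows "qform H (axis j h + axis k z) = H $ j $ j * h\<^sup>2 + 2 * (H $ j $ k * h * z) + H $ k $ k * z\<^sup>2"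
proof -
  have s: "(\<Sum>a\<in>UNIV. \<Sum>b\<in>UNIV. H $ a $ b * axis j h $ a * axis k z $ b) = H $ j $ k * h * z" for j k h z
    by (subst sum_sum_delta[of j k]) (auto simp: axis_def)
  have sym: "H $ k $ j = H $ j $ k" using arg_cong[OF H, of "\<lambda>M. M $ k $ j"] by (simp add: transpose_def)
  have "qform H (axis j h + axis k z) = (\<Sum>a\<in>UNIV. \<Sum>b\<in>UNIV. H $ a $ b * axis j h $ a * axis j h $ b + H $ a $ b * axis j h $ a * axis k z $ b
     + H $ a $ b * axis k z $ a * axis j h $ b + H $ a $ b * axis k z $ a * axis k z $ b)"
    unfolding qform_def by (intro sum.cong refl) (simp add: algebra_simps)
  also have "\<dots> = H $ j $ j * h\<^sup>2 + 2 * (H $ j $ k * h * z) + H $ k $ k * z\<^sup>2"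
    unfolding sum.distrib s by (simp add: sym power2_eq_square)
  finally show ?thesis .
qed

lemma lform_axis_add: "lform L (axis j h + axis k z) = L $ j * h + L $ k * z"
proof -
  have "L $ i * axis j h $ i = (if i = j then L $ j * h else 0)" for i j h by (simp add: axis_def)
  then show ?thesis by (simp add: lform_def distrib_left sum.distrib)
qed

text \<open>The gradient is read off from the expansion along a coordinate axis. For the second
derivatives, fix a point \<open>h e\<^sub>j\<close>. As a function of the \<open>k\<close>-th coordinate the Taylor remainder is
holomorphic and \<open>O (\<bar>h\<bar>^3)\<close> on the circle of radius \<open>\<bar>h\<bar>\<close>, so by Cauchy's inequality its derivative
is \<open>O (\<bar>h\<bar>^2)\<close>, which disappears on differentiating once more in \<open>h\<close> at 0.\<close>

lemma grad_hessian_Taylor2: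
  fixes f :: "complex^'m \<Rightarrow> complex"
  assumes r: "r > 0" and B: "B \<ge> 0" and H: "transpose H = H"
    and T: "\<And>z. max_norm z \<le> r \<Longrightarrow> cmod (f z - (a + lform L z + qform H z / 2)) \<le> B * max_norm z ^ 3"
    and hol: "\<And>w d. (\<lambda>l. f (w + l *s d)) holomorphic_on {l. max_norm (w + l *s d) < r}"
  shows "grad f 0 = L" "hessian f 0 = H"
proof -
  have f0: "f 0 = a" using T[of 0] r by (simp add: lform_def qform_def)
  have gr: "partial k f 0 = L $ k" for k
  proof -
    have "((\<lambda>z. f (0 + axis k z)) has_field_derivative L $ k) (at 0)"
    proof (rule has_field_derivative_quadratic_remainder[OF r])
      fix z assume z: "cmod z < r"
      have ax: "axis k 0 = (0 :: complex^'m)" by (simp add: axis_def vec_eq_iff)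
      have q: "lform L (axis k z) = L $ k * z" "qform H (axis k z) = H $ k $ k * z\<^sup>2"
        using lform_axis_add[of L k 0 k z] qform_axis_add[OF H, of k 0 k z] unfolding ax by simp_all
      have "cmod (f (axis k z) - (a + L $ k * z + H $ k $ k * z\<^sup>2 / 2)) \<le> B * cmod z ^ 3"
        using T[of "axis k z"] z by (simp add: max_norm_axis q)
      moreover have "B * cmod z ^ 3 \<le> B * r * cmod z ^ 2"
      proof -
        have "B * cmod z ^ 3 = B * cmod z ^ 2 * cmod z" by (simp add: power3_eq_cube power2_eq_square)
        also have "\<dots> \<le> B * cmod z ^ 2 * r" using z B by (intro mult_left_mono) auto
        finally show ?thesis by (simp add: mult_ac)
      qed
      moreover have "cmod (H $ k $ k * z\<^sup>2 / 2) = cmod (H $ k $ k) / 2 * cmod z ^ 2" by (simp add: norm_mult norm_divide norm_power)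
      moreover have "f (axis k z) - a - L $ k * z = (f (axis k z) - (a + L $ k * z + H $ k $ k * z\<^sup>2 / 2)) + H $ k $ k * z\<^sup>2 / 2" by simp
      ultimately have "cmod (f (axis k z) - a - L $ k * z) \<le> B * r * cmod z ^ 2 + cmod (H $ k $ k) / 2 * cmod z ^ 2"
        by (smt (verit) norm_triangle_ineq)
      then show "cmod (f (0 + axis k z) - f (0 + axis k 0) - L $ k * z) \<le> (B * r + cmod (H $ k $ k) / 2) * cmod z ^ 2"
        by (simp add: f0 ax algebra_simps)
    qed
    then show ?thesis unfolding partial_def by (rule DERIV_imp_deriv)
  qed
  then show "grad f 0 = L" by (simp add: grad_def vec_eq_iff)
  have "partial j (partial k f) 0 = H $ j $ k" for j k
  proof -
    have ax0: "axis j 0 = (0 :: complex^'m)" by (simp add: axis_def vec_eq_iff)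
    have "((\<lambda>h. partial k f (0 + axis j h)) has_field_derivative H $ j $ k) (at 0)"
    proof (rule has_field_derivative_quadratic_remainder[of "r / 2"])
      show "r / 2 > 0" using r by simp
      fix h assume h: "cmod h < r / 2"
      show "cmod (partial k f (0 + axis j h) - partial k f (0 + axis j 0) - H $ j $ k * h) \<le> 8 * B * cmod h ^ 2"
      proof (cases "h = 0")
        case True then show ?thesis by simp
      next
        case False
        define g where "g z = f (axis j h + axis k z)" for z
        define q where "q z = a + (L $ j * h + L $ k * z) + (H $ j $ j * h\<^sup>2 + 2 * (H $ j $ k * h * z) + H $ k $ k * z\<^sup>2) / 2" for z
        have mn: "max_norm (axis j h + axis k z :: complex^'m) \<le> cmod h + cmod z" for z
          using max_norm_triangle[of "axis j h" "axis k z :: complex^'m"] by (simp add: max_norm_axis)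
        have gh: "g holomorphic_on ball 0 (r / 2)"
        proof -
          have "ball 0 (r / 2) \<subseteq> {l. max_norm (axis j h + l *s axis k 1 :: complex^'m) < r}"
          proof
            fix l :: complex assume "l \<in> ball 0 (r / 2)"
            then show "l \<in> {l. max_norm (axis j h + l *s axis k 1 :: complex^'m) < r}" using mn[of l] h by (simp add: smult_axis)
          qed
          then show ?thesis using hol[of "axis j h" "axis k 1"] unfolding g_def
            by (simp only: smult_axis) (rule holomorphic_on_subset)
        qed
        have qh: "q holomorphic_on S" for S unfolding q_def by (intro holomorphic_intros) auto
        have R: "cmod (g z - q z) \<le> 8 * B * cmod h ^ 3" if "cmod z = cmod h" for z
        proof -
          have m: "max_norm (axis j h + axis k z :: complex^'m) \<le> 2 * cmod h" using mn[of z] that by simp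
          then have "cmod (g z - q z) \<le> B * max_norm (axis j h + axis k z :: complex^'m) ^ 3"
            using T[of "axis j h + axis k z"] h unfolding g_def q_def lform_axis_add qform_axis_add[OF H] by simp
          also have "\<dots> \<le> B * (2 * cmod h) ^ 3" using m B by (intro mult_left_mono power_mono) auto
          finally show ?thesis by (simp add: power_mult_distrib)
        qed
        have c: "continuous_on (cball 0 (cmod h)) (\<lambda>z. g z - q z)"
          using h by (intro holomorphic_on_imp_continuous_on holomorphic_on_diff qh holomorphic_on_subset[OF gh]) auto
        have d: "(\<lambda>z. g z - q z) holomorphic_on ball 0 (cmod h)"
          using h by (intro holomorphic_on_diff qh holomorphic_on_subset[OF gh]) auto
        have "cmod ((deriv ^^ 1) (\<lambda>z. g z - q z) 0) \<le> fact 1 * (8 * B * cmod h ^ 3) / cmod h ^ 1"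
          using False R by (intro Cauchy_inequality d c) auto
        then have 1: "cmod (deriv (\<lambda>z. g z - q z) 0) \<le> 8 * B * cmod h ^ 2"
          using False by (simp add: power3_eq_cube power2_eq_square)
        have "deriv (\<lambda>z. g z - q z) 0 = deriv g 0 - deriv q 0"
          using r by (intro deriv_diff holomorphic_on_imp_differentiable_at[OF gh] holomorphic_on_imp_differentiable_at[OF qh[of UNIV]]) auto
        moreover have "deriv q 0 = L $ k + H $ j $ k * h"
          unfolding q_def by (intro DERIV_imp_deriv) (auto intro!: derivative_eq_intros)
        moreover have "deriv g 0 = partial k f (0 + axis j h)" by (simp add: partial_def g_def[abs_def])
        ultimately have "partial k f (0 + axis j h) - partial k f (0 + axis j 0) - H $ j $ k * h = deriv (\<lambda>z. g z - q z) 0"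
          by (simp add: ax0 gr)
        then show ?thesis using 1 by simp
      qed
    qed
    then show ?thesis unfolding partial_def[of j] by (rule DERIV_imp_deriv)
  qed
  then show "hessian f 0 = H" by (simp add: hessian_def vec_eq_iff)
qed

section \<open>Integration over coordinate space\<close>

lemma basis_vec_sum:
  fixes g :: "real^'m \<Rightarrow> 'b::comm_monoid_add"
  shows "sum g Basis = (\<Sum>j\<in>UNIV. g (axis j 1))"
proof -
  have B: "(Basis :: (real^'m) set) = range (\<lambda>j. axis j 1)" by (auto simp: Basis_vec_def)
  have inj: "inj (\<lambda>j::'m. axis j (1::real))" by (auto simp: inj_def axis_eq_axis)
  show ?thesis unfolding B by (subst sum.reindex[OF inj]) (simp add: o_def)
qed

lemma basis_vec_prod:
  fixes g :: "real^'m \<Rightarrow> 'b::comm_monoid_mult"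
  shows "prod g Basis = (\<Prod>j\<in>UNIV. g (axis j 1))"
proof -
  have B: "(Basis :: (real^'m) set) = range (\<lambda>j. axis j 1)" by (auto simp: Basis_vec_def)
  have inj: "inj (\<lambda>j::'m. axis j (1::real))" by (auto simp: inj_def axis_eq_axis)
  show ?thesis unfolding B by (subst prod.reindex[OF inj]) (simp add: o_def)
qed

lemma sum_axis_nth: "(\<Sum>b\<in>Basis. h b *\<^sub>R b) $ j = h (axis j 1)" for h :: "real^'m \<Rightarrow> real"
proof -
  have "(\<Sum>b\<in>Basis. h b *\<^sub>R b) $ j = (\<Sum>i\<in>UNIV. if i = j then h (axis i 1) else 0)"
    unfolding basis_vec_sum by (simp add: axis_def if_distrib cong: if_cong)
  then show ?thesis by simp
qed

lemma
  fixes f :: "'m::finite \<Rightarrow> real \<Rightarrow> 'b::{real_normed_field,banach,second_countable_topology}"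
  assumes f: "\<And>j. integrable lborel (f j)"
  shows integrable_prod_vec: "integrable lborel (\<lambda>x::real^'m. \<Prod>j\<in>UNIV. f j (x $ j))"
    and integral_prod_vec:
      "(LINT x|lborel. (\<Prod>j\<in>UNIV. f j ((x::real^'m) $ j))) = (\<Prod>j\<in>UNIV. (LINT t|lborel. f j t))"
proof -
  interpret product_sigma_finite "\<lambda>b::real^'m. lborel :: real measure" ..
  define g where "g = (\<lambda>b::real^'m. f (axis_index b))"
  have g_axis: "g (axis j 1) = f j" for j
    by (simp add: g_def)
  have prod_eq: "(\<Prod>j\<in>UNIV. f j ((\<Sum>b\<in>Basis. h b *\<^sub>R b) $ j)) = (\<Prod>b\<in>Basis. g b (h b))"
    for h :: "real^'m \<Rightarrow> real"
    unfolding sum_axis_nth basis_vec_prod by (simp add: g_axis)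
  have g: "integrable lborel (g b)" for b unfolding g_def by (rule f)
  have mf[measurable]: "f j \<in> borel_measurable borel" for j
    using borel_measurable_integrable[OF f[of j]] by simp
  have m: "(\<lambda>x::real^'m. \<Prod>j\<in>UNIV. f j (x $ j)) \<in> borel_measurable borel"
    by (intro borel_measurable_prod measurable_compose[OF _ mf] borel_measurable_continuous_onI continuous_intros)
  have s: "(\<lambda>h. \<Sum>b\<in>Basis. h b *\<^sub>R b) \<in> measurable (\<Pi>\<^sub>M b\<in>(Basis::(real^'m) set). lborel) borel"
    by (intro borel_measurable_sum borel_measurable_scaleR) auto
  show "integrable lborel (\<lambda>x::real^'m. \<Prod>j\<in>UNIV. f j (x $ j))"
    by (subst lborel_eq, subst integrable_distr_eq[OF s m], unfold prod_eq)
       (rule product_integrable_prod, simp, rule g)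
  have "(LINT x|lborel. (\<Prod>j\<in>UNIV. f j ((x::real^'m) $ j))) = (\<Prod>b\<in>Basis. (LINT t|lborel. g b t))"
    by (subst lborel_eq, subst integral_distr[OF s m], unfold prod_eq)
       (rule product_integral_prod, simp, rule g)
  also have "\<dots> = (\<Prod>j\<in>UNIV. (LINT t|lborel. f j t))"
    unfolding basis_vec_prod by (simp add: g_axis)
  finally show "(LINT x|lborel. (\<Prod>j\<in>UNIV. f j ((x::real^'m) $ j))) = (\<Prod>j\<in>UNIV. (LINT t|lborel. f j t))" .
qed


lemma nn_integral_swap:
  fixes f :: "real^'m \<Rightarrow> ennreal"
  assumes [measurable]: "f \<in> borel_measurable borel"
  shows "(\<integral>\<^sup>+x. f (\<chi> i. x $ Transposition.transpose m n i) \<partial>lborel) = (\<integral>\<^sup>+x. f x \<partial>lborel)"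
proof -
  let ?t = "Transposition.transpose m n"
  let ?h = "\<lambda>x::real^'m. \<chi> i. x $ ?t i"
  have [measurable]: "?h \<in> measurable borel borel"
    by (intro borel_measurable_continuous_onI continuous_intros)
  have "lborel = distr lborel borel ?h"
  proof (rule lborel_eqI)
    fix l u :: "real^'m" assume le: "\<And>b. b \<in> Basis \<Longrightarrow> l \<bullet> b \<le> u \<bullet> b"
    have le': "l $ i \<le> u $ i" for i
      using le[of "axis i 1"] by (simp add: inner_axis)
    have "?h -` box l u = box (?h l) (?h u)"
      by (auto simp: mem_box_cart) (metis transpose_involutory)+
    then have "emeasure (distr lborel borel ?h) (box l u) = emeasure lborel (box (?h l) (?h u))"
      by (simp add: emeasure_distr)
    also have "\<dots> = (\<Prod>b\<in>Basis. (?h u - ?h l) \<bullet> b)"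
      by (rule emeasure_lborel_box) (auto simp: Basis_vec_def inner_axis le')
    also have "(\<Prod>b\<in>Basis. (?h u - ?h l) \<bullet> b) = (\<Prod>i\<in>UNIV. (u - l) $ (?t i))"
      unfolding basis_vec_prod by (simp add: inner_axis)
    also have "\<dots> = (\<Prod>i\<in>UNIV. (u - l) $ i)"
      using prod.permute[OF permutes_swap_id[of m UNIV n], of "\<lambda>i. (u-l) $ i"] by (simp add: o_def)
    also have "\<dots> = (\<Prod>b\<in>Basis. (u - l) \<bullet> b)"
      unfolding basis_vec_prod by (simp add: inner_axis)
    finally show "emeasure (distr lborel borel ?h) (box l u) = (\<Prod>b\<in>Basis. (u - l) \<bullet> b)" .
  qed simp
  then have "(\<integral>\<^sup>+x. f x \<partial>lborel) = (\<integral>\<^sup>+x. f x \<partial>distr lborel borel ?h)" by simp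
  also have "\<dots> = (\<integral>\<^sup>+x. f (?h x) \<partial>lborel)" by (subst nn_integral_distr) auto
  finally show ?thesis ..
qed

lemma nn_integral_diag:
  fixes f :: "real^'m \<Rightarrow> ennreal"
  assumes [measurable]: "f \<in> borel_measurable borel" and c: "\<And>i. c i \<noteq> 0"
  shows "(\<integral>\<^sup>+x. f x \<partial>lborel) = ennreal (\<Prod>i\<in>UNIV. \<bar>c i\<bar>) * (\<integral>\<^sup>+x. f (\<chi> i. c i * x $ i) \<partial>lborel)"
proof -
  let ?c = "\<lambda>b::real^'m. c (axis_index b)"
  let ?T = "\<lambda>x::real^'m. 0 + (\<Sum>j\<in>Basis. (?c j * (x \<bullet> j)) *\<^sub>R j)"
  have T: "?T x = (\<chi> i. c i * x $ i)" for x
    by (simp add: vec_eq_iff sum_axis_nth inner_axis del: sum_component vector_scaleR_component)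
  have [measurable]: "?T \<in> measurable borel borel" by measurable
  have "lborel = density (distr lborel borel ?T) (\<lambda>_. ennreal (\<Prod>j\<in>Basis. \<bar>?c j\<bar>))"
    by (rule lborel_affine_euclidean) (rule c)
  then have "(\<integral>\<^sup>+x. f x \<partial>lborel) = (\<integral>\<^sup>+x. f x \<partial>density (distr lborel borel ?T) (\<lambda>_. ennreal (\<Prod>j\<in>Basis. \<bar>?c j\<bar>)))"
    by simp
  also have "\<dots> = ennreal (\<Prod>j\<in>Basis. \<bar>?c j\<bar>) * (\<integral>\<^sup>+x. f (?T x) \<partial>lborel)"
    by (simp add: nn_integral_density nn_integral_distr nn_integral_cmult)
  also have "(\<Prod>j\<in>Basis. \<bar>?c j\<bar>) = (\<Prod>i\<in>UNIV. \<bar>c i\<bar>)"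
    unfolding basis_vec_prod by simp
  finally show ?thesis unfolding T .
qed

text \<open>For fixed values of the other coordinates the shear translates the coordinate \<open>m\<close>, so the
claim follows by integrating over that coordinate first.\<close>

lemma nn_integral_shear:
  fixes f :: "real^'m \<Rightarrow> ennreal"
  assumes [measurable]: "f \<in> borel_measurable borel" and mn: "m \<noteq> n"
  shows "(\<integral>\<^sup>+x. f (\<chi> i. if i = m then x $ m + x $ n else x $ i) \<partial>lborel) = (\<integral>\<^sup>+x. f x \<partial>lborel)"
proof -
  interpret product_sigma_finite "\<lambda>b::real^'m. lborel :: real measure" ..
  let ?S = "\<lambda>x::real^'m. \<chi> i. if i = m then x $ m + x $ n else x $ i"
  let ?e = "\<lambda>h. \<Sum>b\<in>Basis. h b *\<^sub>R (b::real^'m)"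
  let ?a = "\<lambda>i::'m. axis i (1::real)"
  define I where "I = Basis - {?a m}"
  have I: "finite I" "?a m \<notin> I" and ins: "insert (?a m) I = Basis"
    by (auto simp: I_def)
  have mn': "?a n \<noteq> ?a m" using mn by (simp add: axis_eq_axis)
  have "continuous_on UNIV ?S"
    by (intro continuous_on_vec_lambda, rename_tac i, case_tac "i = m") (auto intro!: continuous_intros)
  then have [measurable]: "?S \<in> measurable borel borel"
    by (intro borel_measurable_continuous_onI)
  have e[measurable]: "?e \<in> measurable (\<Pi>\<^sub>M b\<in>(Basis::(real^'m) set). lborel) borel"
    by (intro borel_measurable_sum borel_measurable_scaleR) auto
  have e': "?e \<in> measurable (Pi\<^sub>M (insert (?a m) I) (\<lambda>_. lborel)) borel"
    using e by (simp add: ins)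
  have one: "(\<integral>\<^sup>+x. g x \<partial>lborel) = (\<integral>\<^sup>+h. (\<integral>\<^sup>+y. g (?e (h(?a m := y))) \<partial>lborel) \<partial>(Pi\<^sub>M I (\<lambda>_. lborel)))"
    if [measurable]: "g \<in> borel_measurable borel" for g
  proof -
    have "(\<integral>\<^sup>+x. g x \<partial>lborel) = (\<integral>\<^sup>+h. g (?e h) \<partial>(Pi\<^sub>M (insert (?a m) I) (\<lambda>_. lborel)))"
      by (subst lborel_eq) (simp add: nn_integral_distr ins)
    also have "\<dots> = (\<integral>\<^sup>+h. (\<integral>\<^sup>+y. g (?e (h(?a m := y))) \<partial>lborel) \<partial>(Pi\<^sub>M I (\<lambda>_. lborel)))"
      using measurable_compose[OF e' that] by (intro product_nn_integral_insert I) auto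
    finally show ?thesis .
  qed
  have sh: "?S (?e (h(?a m := y))) = ?e (h(?a m := h (?a n) + 1 * y))" for h y
    using mn mn' by (subst vec_eq_iff) (auto simp: sum_axis_nth axis_eq_axis simp del: sum_component vector_scaleR_component)
  have inner: "(\<integral>\<^sup>+y. f (?e (h(?a m := h (?a n) + 1 * y))) \<partial>lborel) = (\<integral>\<^sup>+y. f (?e (h(?a m := y))) \<partial>lborel)" for h
  proof -
    have "?e (h(?a m := y)) = y *\<^sub>R ?a m + (\<Sum>b\<in>I. h b *\<^sub>R b)" for y
    proof -
      have "?e (h(?a m := y)) = (h(?a m := y)) (?a m) *\<^sub>R ?a m + (\<Sum>b\<in>I. (h(?a m := y)) b *\<^sub>R b)"
        unfolding ins[symmetric] using I by simp
      also have "(\<Sum>b\<in>I. (h(?a m := y)) b *\<^sub>R b) = (\<Sum>b\<in>I. h b *\<^sub>R b)"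
        using I by (intro sum.cong) auto
      finally show ?thesis by simp
    qed
    then have [measurable]: "(\<lambda>y. f (?e (h(?a m := y)))) \<in> borel_measurable borel" by simp
    show ?thesis
      using nn_integral_real_affine[of "\<lambda>y. f (?e (h(?a m := y)))" 1 "h (?a n)"] by simp
  qed
  have "(\<integral>\<^sup>+x. f (?S x) \<partial>lborel) = (\<integral>\<^sup>+h. (\<integral>\<^sup>+y. f (?S (?e (h(?a m := y)))) \<partial>lborel) \<partial>(Pi\<^sub>M I (\<lambda>_. lborel)))"
    by (rule one) measurable
  also have "\<dots> = (\<integral>\<^sup>+x. f x \<partial>lborel)"
    unfolding sh inner by (rule one[symmetric]) measurable
  finally show ?thesis .
qed

text \<open>Both sides are multiplicative in \<open>A\<close>, and elementary matrices generate all matrices.\<close>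

lemma nn_integral_linear:
  fixes A :: "real^'m^'m" and f :: "real^'m \<Rightarrow> ennreal"
  assumes "f \<in> borel_measurable borel" and "det A \<noteq> 0"
  shows "(\<integral>\<^sup>+y. f y \<partial>lborel) = ennreal \<bar>det A\<bar> * (\<integral>\<^sup>+x. f (A *v x) \<partial>lborel)"
proof -
  define P where "P A \<longleftrightarrow> (det A \<noteq> 0 \<longrightarrow> (\<forall>f::real^'m \<Rightarrow> ennreal. f \<in> borel_measurable borel \<longrightarrow>
     (\<integral>\<^sup>+y. f y \<partial>lborel) = ennreal \<bar>det A\<bar> * (\<integral>\<^sup>+x. f (A *v x) \<partial>lborel)))" for A :: "real^'m^'m"
  have [measurable]: "(\<lambda>x. B *v x) \<in> borel_measurable borel" for B :: "real^'m^'m"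
    by (intro borel_measurable_continuous_onI matrix_vector_mult_linear_continuous_on)
  have "P A"
  proof (rule induct_matrix_elementary_alt[where P=P and A=A])
    fix A B :: "real^'m^'m" assume A: "P A" and B: "P B"
    show "P (A ** B)"
      unfolding P_def
    proof (intro impI allI)
      fix f :: "real^'m \<Rightarrow> ennreal"
      assume d: "det (A ** B) \<noteq> 0" and f[measurable]: "f \<in> borel_measurable borel"
      have dA: "det A \<noteq> 0" and dB: "det B \<noteq> 0" using d by (auto simp: det_mul)
      have "(\<integral>\<^sup>+y. f y \<partial>lborel) = ennreal \<bar>det A\<bar> * (\<integral>\<^sup>+x. f (A *v x) \<partial>lborel)"
        by (rule A[unfolded P_def, rule_format, OF dA f])
      also have "(\<integral>\<^sup>+x. f (A *v x) \<partial>lborel) = ennreal \<bar>det B\<bar> * (\<integral>\<^sup>+x. f (A *v (B *v x)) \<partial>lborel)"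
      proof -
        have "(\<lambda>x. f (A *v x)) \<in> borel_measurable borel" by measurable
        then show ?thesis by (rule B[unfolded P_def, rule_format, OF dB])
      qed
      finally show "(\<integral>\<^sup>+y. f y \<partial>lborel) = ennreal \<bar>det (A ** B)\<bar> * (\<integral>\<^sup>+x. f ((A ** B) *v x) \<partial>lborel)"
        by (simp add: det_mul abs_mult ennreal_mult mult.assoc matrix_vector_mul_assoc)
    qed
  next
    fix A :: "real^'m^'m" and i assume "row i A = 0"
    then show "P A" using det_zero_row(2)[of i A] by (auto simp: P_def)
  next
    fix A :: "real^'m^'m" assume A: "\<And>i j. i \<noteq> j \<Longrightarrow> A $ i $ j = 0"
    have "A *v x = (\<chi> i. A $ i $ i * x $ i)" for x
    proof -
      have "(\<Sum>j\<in>UNIV. A $ i $ j * x $ j) = (\<Sum>j\<in>UNIV. if j = i then A $ i $ i * x $ i else 0)" for i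
        by (intro sum.cong) (auto simp: A)
      then show ?thesis by (simp add: matrix_vector_mult_def)
    qed
    moreover have "det A = (\<Prod>i\<in>UNIV. A $ i $ i)" by (rule det_diagonal) (rule A)
    ultimately show "P A"
      using nn_integral_diag[of _ "\<lambda>i. A $ i $ i"] by (auto simp: abs_prod P_def)
  next
    fix m n :: 'm assume mn: "m \<noteq> n"
    let ?A = "(\<chi> i j. mat 1 $ i $ Transposition.transpose m n j) :: real^'m^'m"
    have "?A *v x = (\<chi> i. x $ Transposition.transpose m n i)" for x
    proof -
      have "(\<Sum>j\<in>UNIV. (if i = Transposition.transpose m n j then 1 else 0) * x $ j)
         = (\<Sum>j\<in>UNIV. if j = Transposition.transpose m n i then x $ j else 0)" for i
        by (intro sum.cong refl) (auto simp: transpose_involutory split: if_splits)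
      then show ?thesis by (simp add: matrix_vector_mult_def mat_def)
    qed
    moreover have "\<bar>det ?A\<bar> = 1"
      by (simp add: det_permute_columns permutes_swap_id sign_swap_id abs_mult)
    ultimately show "P ?A" by (auto simp: P_def intro: nn_integral_swap[symmetric])
  next
    fix m n :: 'm assume mn: "m \<noteq> n"
    let ?A = "(\<chi> i j. of_bool (i = m \<and> j = n \<or> i = j)) :: real^'m^'m"
    have "?A *v x = (\<chi> i. if i = m then x $ m + x $ n else x $ i)" for x
    proof -
      have "(\<Sum>j\<in>UNIV. of_bool (i = m \<and> j = n \<or> i = j) * x $ j)
         = (\<Sum>j\<in>UNIV. (if j = i then x $ j else 0) + (if i = m \<and> j = n then x $ j else 0))" for i
        using mn by (intro sum.cong refl) auto
      also have "\<dots> i = (if i = m then x $ m + x $ n else x $ i)" for i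
        by (cases "i = m") (simp_all add: sum.distrib)
      finally show ?thesis by (simp add: matrix_vector_mult_def)
    qed
    moreover have "det ?A = 1"
    proof -
      have "?A = (\<chi> k. if k = m then row m (mat 1) + 1 *s row n (mat 1) else row k (mat 1))"
        using mn by (auto simp: vec_eq_iff row_def mat_def)
      then show ?thesis using det_row_operation[OF mn, of "mat 1" 1] by (simp add: det_I)
    qed
    ultimately show "P ?A" by (auto simp: P_def intro: nn_integral_shear[OF _ mn, symmetric])
  qed
  then show ?thesis using assms unfolding P_def by blast
qed

section \<open>Factorisation of positive semidefinite matrices\<close>

lemma symmetric_nth:
  fixes B :: "real^'m^'m"
  assumes "transpose B = B"
  shows "B $ j $ k = B $ k $ j"
  using arg_cong[OF assms, of "\<lambda>M. M $ k $ j"] by (simp add: transpose_def)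

lemma matrix_entry_inner: "axis i 1 \<bullet> (B *v axis k 1) = B $ i $ k" for B :: "real^'m^'m"
  by (simp add: inner_vec_def matrix_vector_mult_def axis_def if_distrib if_distribR cong: if_cong)

lemma pos_semidef_Cauchy_Schwarz:
  fixes B :: "real^'m^'m"
  assumes "pos_semidef B"
  shows "(x \<bullet> (B *v y))\<^sup>2 \<le> (x \<bullet> (B *v x)) * (y \<bullet> (B *v y))"
proof -
  have sym: "y \<bullet> (B *v x) = x \<bullet> (B *v y)" for x y
    using assms unfolding pos_semidef_def
    by (metis dot_lmul_matrix inner_commute matrix_vector_mul_component transpose_matrix_vector)
  have nn: "0 \<le> z \<bullet> (B *v z)" for z using assms by (simp add: pos_semidef_def)
  let ?a = "x \<bullet> (B *v x)" and ?b = "x \<bullet> (B *v y)" and ?c = "y \<bullet> (B *v y)"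
  have q: "0 \<le> ?a + 2 * t * ?b + t\<^sup>2 * ?c" for t
    using nn[of "x + t *\<^sub>R y"] sym[of x y]
    by (simp add: algebra_simps matrix_vector_right_distrib inner_add_left inner_add_right power2_eq_square
        matrix_vector_mult_scaleR)
  show ?thesis
  proof (cases "?c = 0")
    case True
    have "?b = 0"
    proof (rule ccontr)
      assume "?b \<noteq> 0"
      then show False using q[of "- (?a + 1) / (2 * ?b)"] True by (simp add: field_simps)
    qed
    then show ?thesis using True by simp
  next
    case False
    then have "?c > 0" using nn[of y] by simp
    then show ?thesis using q[of "- ?b / ?c"]
      by (simp add: field_simps power2_eq_square)
  qed
qed

text \<open>This is the Schur complement of a diagonal entry: the Cauchy--Schwarz inequality for \<open>B\<close>,
applied to \<open>x\<close> and the \<open>i\<close>-th unit vector, says exactly that it is positive semidefinite.\<close>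

lemma psd_minus_row:
  fixes B :: "real^'m^'m"
  assumes B: "pos_semidef B" and bii: "B $ i $ i > 0"
  shows "pos_semidef (\<chi> j k. B $ j $ k - B $ j $ i * B $ k $ i / B $ i $ i)"
proof -
  have symB: "B $ j $ k = B $ k $ j" for j k
    using B by (intro symmetric_nth) (simp add: pos_semidef_def)
  let ?B = "(\<chi> j k. B $ j $ k - B $ j $ i * B $ k $ i / B $ i $ i) :: real^'m^'m"
  have ei: "x \<bullet> (B *v axis i 1) = (\<Sum>j\<in>UNIV. x $ j * B $ j $ i)" for x
    by (simp add: inner_vec_def matrix_vector_mult_def axis_def if_distrib cong: if_cong)
  have "x \<bullet> (?B *v x) = x \<bullet> (B *v x) - (x \<bullet> (B *v axis i 1))\<^sup>2 / B $ i $ i" for x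
  proof -
    have "x \<bullet> (?B *v x) = (\<Sum>j\<in>UNIV. \<Sum>k\<in>UNIV. x $ j * B $ j $ k * x $ k
        - (x $ j * B $ j $ i) * (x $ k * B $ k $ i) / B $ i $ i)"
      by (simp add: inner_vec_def matrix_vector_mult_def sum_distrib_left algebra_simps)
    also have "\<dots> = x \<bullet> (B *v x) - (x \<bullet> (B *v axis i 1))\<^sup>2 / B $ i $ i"
      unfolding ei power2_eq_square sum_product
      by (simp add: inner_vec_def matrix_vector_mult_def sum_distrib_left sum_subtractf sum_divide_distrib
           mult.assoc)
    finally show ?thesis .
  qed
  moreover have "(x \<bullet> (B *v axis i 1))\<^sup>2 / B $ i $ i \<le> x \<bullet> (B *v x)" for x
    using pos_semidef_Cauchy_Schwarz[OF B, of x "axis i 1"] bii by (simp add: matrix_entry_inner divide_le_eq)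
  moreover have "transpose ?B = ?B"
    by (simp add: vec_eq_iff transpose_def symB mult.commute)
  ultimately show ?thesis by (simp add: pos_semidef_def)
qed

lemma pos_semidef_zero_diag:
  fixes B :: "real^'m^'m"
  assumes B: "pos_semidef B" and bii: "B $ i $ i = 0"
  shows "B $ i $ k = 0"
  using pos_semidef_Cauchy_Schwarz[OF B, of "axis i 1" "axis k 1"] bii
  by (simp add: matrix_entry_inner)

text \<open>A Cholesky decomposition over an unordered index type. The set \<open>T\<close> collects the coordinates
already eliminated: the rest \<open>S - A A\<^sup>T\<close> stays positive semidefinite and has zero rows on \<open>T\<close>, while
the columns of \<open>A\<close> outside \<open>T\<close> are still empty and hence free to receive the next pivot column.\<close>

lemma pos_semidef_factor:
  fixes S :: "real^'m^'m"
  assumes S: "pos_semidef S"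
  obtains A :: "real^'m^'m" where "S = A ** transpose A"
proof -
  have "\<exists>A :: real^'m^'m. pos_semidef (S - A ** transpose A) \<and>
      (\<forall>i\<in>T. \<forall>k. (S - A ** transpose A) $ i $ k = 0) \<and> (\<forall>k. \<forall>i. i \<notin> T \<longrightarrow> A $ k $ i = 0)"
    if "finite T" for T :: "'m set"
    using that
  proof (induction T rule: finite_induct)
    case empty
    have "S - 0 ** transpose 0 = S"
      by (simp add: vec_eq_iff matrix_matrix_mult_def)
    then show ?case using S by (intro exI[of _ 0]) simp
  next
    case (insert i T)
    then obtain A :: "real^'m^'m" where A: "pos_semidef (S - A ** transpose A)"
      and z: "\<And>j k. j \<in> T \<Longrightarrow> (S - A ** transpose A) $ j $ k = 0"
      and c: "\<And>j k. j \<notin> T \<Longrightarrow> A $ k $ j = 0" by blast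
    let ?B = "S - A ** transpose A"
    have symB: "?B $ j $ k = ?B $ k $ j" for j k
      using A by (intro symmetric_nth) (simp add: pos_semidef_def)
    have di: "?B $ i $ i \<ge> 0"
      using A matrix_entry_inner[of i ?B i] unfolding pos_semidef_def by (metis (no_types))
    show ?case
    proof (cases "?B $ i $ i = 0")
      case True
      have zi: "?B $ i $ k = 0" for k by (rule pos_semidef_zero_diag[OF A True])
      show ?thesis
      proof (intro exI[of _ A] conjI ballI allI impI)
        show "pos_semidef ?B" by (rule A)
        show "?B $ j $ k = 0" if "j \<in> insert i T" for j k using that zi z by blast
        show "A $ k $ j = 0" if "j \<notin> insert i T" for k j using that c by blast
      qed
    next
      case False
      then have bii: "?B $ i $ i > 0" using di by simp
      \<comment> \<open>the new column is chosen so that its outer product is the rank-one matrix in the Schur complement\<close>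
      let ?A = "(\<chi> k j. if j = i then ?B $ k $ i / sqrt (?B $ i $ i) else A $ k $ j) :: real^'m^'m"
      have "S - ?A ** transpose ?A = (\<chi> j k. ?B $ j $ k - ?B $ j $ i * ?B $ k $ i / ?B $ i $ i)"
      proof (simp only: vec_eq_iff, intro allI)
        fix j k
        have "(?A ** transpose ?A) $ j $ k = (\<Sum>l\<in>UNIV. ?A $ j $ l * ?A $ k $ l)"
          by (simp add: matrix_matrix_mult_def transpose_def)
        also have "\<dots> = (\<Sum>l\<in>UNIV. A $ j $ l * A $ k $ l + (if l = i then ?B $ j $ i * ?B $ k $ i / ?B $ i $ i else 0))"
          using c[OF insert.hyps(2)] bii by (intro sum.cong refl) (auto simp: field_simps)
        also have "\<dots> = (A ** transpose A) $ j $ k + ?B $ j $ i * ?B $ k $ i / ?B $ i $ i"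
          by (simp add: sum.distrib matrix_matrix_mult_def transpose_def)
        finally show "(S - ?A ** transpose ?A) $ j $ k = (\<chi> j k. ?B $ j $ k - ?B $ j $ i * ?B $ k $ i / ?B $ i $ i) $ j $ k"
          by simp
      qed
      note eq = this
      have "pos_semidef (S - ?A ** transpose ?A)"
        unfolding eq by (rule psd_minus_row[OF A bii])
      moreover have "(S - ?A ** transpose ?A) $ j $ k = 0" if "j \<in> insert i T" for j k
        unfolding eq using that bii z[of j] symB[of i k] by (auto simp del: vector_minus_component)
      moreover have "?A $ k $ j = 0" if "j \<notin> insert i T" for j k using that c by auto
      ultimately show ?thesis by (intro exI[of _ ?A] conjI ballI allI impI)
    qed
  qed
  from this[of UNIV] obtain A :: "real^'m^'m" where "\<forall>i k. (S - A ** transpose A) $ i $ k = 0" by auto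
  then have "S = A ** transpose A" by (simp add: vec_eq_iff)
  then show ?thesis using that by blast
qed

lemma quadratic_form_factor:
  fixes A :: "real^'m^'m"
  shows "x \<bullet> ((A ** transpose A) *v x) = (norm (transpose A *v x))\<^sup>2"
proof -
  have "(A ** transpose A) *v x = A *v (transpose A *v x)" by (simp only: matrix_vector_mul_assoc)
  then have "x \<bullet> ((A ** transpose A) *v x) = (transpose A *v x) \<bullet> (transpose A *v x)"
    by (simp only: dot_lmul_matrix[symmetric] transpose_matrix_vector)
  then show ?thesis by (simp only: power2_norm_eq_inner)
qed

lemma pos_semidef_invertible_imp_pos_def:
  fixes S :: "real^'m^'m"
  assumes S: "pos_semidef S" and inv: "invertible S"
  shows "pos_def S"
proof -
  obtain A :: "real^'m^'m" where A: "S = A ** transpose A" by (rule pos_semidef_factor[OF S])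
  have q: "x \<bullet> (S *v x) = (norm (transpose A *v x))\<^sup>2" for x
    unfolding A by (rule quadratic_form_factor)
  have "0 < x \<bullet> (S *v x)" if "x \<noteq> 0" for x
  proof -
    have "inj ((*v) S)" using inv by (simp add: inj_matrix_vector_mult)
    then have "S *v x \<noteq> 0" using that by (metis injD matrix_vector_mult_0_right)
    then have "transpose A *v x \<noteq> 0" unfolding A by (metis matrix_vector_mul_assoc matrix_vector_mult_0_right)
    then show ?thesis unfolding q by simp
  qed
  then show ?thesis using S unfolding pos_def_def pos_semidef_def by blast
qed

section \<open>Centred normal distributions\<close>

text \<open>Shifting the variable by \<open>Re s\<close> completes the square and leaves the characteristic function of
the standard normal distribution at \<open>Im s\<close>.\<close>

lemma
  fixes s :: complex
  shows integrable_exp_gauss: "integrable lborel (\<lambda>t::real. exp (s * complex_of_real t - (complex_of_real t)\<^sup>2 / 2))"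
    and integral_exp_gauss: "(CLINT t|lborel. exp (s * complex_of_real t - (complex_of_real t)\<^sup>2 / 2)) = sqrt (2 * pi) * exp (s\<^sup>2 / 2)"
proof -
  let ?a = "Re s" and ?b = "Im s"
  let ?g = "\<lambda>t::real. std_normal_density t *\<^sub>R iexp (?b * t)"
  have ig: "integrable lborel ?g"
    by (rule Bochner_Integration.integrable_bound[of lborel std_normal_density]) auto
  have "char std_normal_distribution ?b = exp (- (?b\<^sup>2) / 2)"
    by (simp add: char_std_normal_distribution)
  then have vg: "(CLINT t|lborel. ?g t) = exp (- (?b\<^sup>2) / 2)"
    unfolding char_def by (subst (asm) integral_density) auto
  let ?f = "\<lambda>t::real. exp (s * t - (complex_of_real t)\<^sup>2 / 2)"
  have eq: "?f (?a + 1 * t) = (sqrt (2 * pi) * exp (?a\<^sup>2 / 2 + \<i> * ?a * ?b)) * ?g t" for t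
  proof -
    have "?g t = complex_of_real (1 / sqrt (2 * pi)) * exp (- (complex_of_real t)\<^sup>2 / 2) * exp (\<i> * (?b * t))"
      by (simp add: normal_density_def scaleR_conv_of_real exp_of_real[symmetric] del: exp_of_real)
    moreover have "s * (?a + t) - (complex_of_real (?a + t))\<^sup>2 / 2
        = (?a\<^sup>2 / 2 + \<i> * ?a * ?b) + (- (complex_of_real t)\<^sup>2 / 2) + \<i> * (?b * t)"
      by (subst complex_eq[of s]) (simp add: power2_eq_square field_simps)
    ultimately show ?thesis
      by (simp only: mult_1 exp_add) (simp add: mult_ac)
  qed
  have 1: "integrable lborel (\<lambda>t. ?f (?a + 1 * t))"
    unfolding eq using ig by (intro integrable_mult_right)
  then show "integrable lborel (\<lambda>t::real. exp (s * complex_of_real t - (complex_of_real t)\<^sup>2 / 2))"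
    using lborel_integrable_real_affine_iff[of 1 ?f ?a] by simp
  have "(CLINT t|lborel. ?f t) = (CLINT t|lborel. ?f (?a + 1 * t))"
    using lborel_integral_real_affine[of 1 ?f ?a] by simp
  also have "\<dots> = (sqrt (2 * pi) * exp (?a\<^sup>2 / 2 + \<i> * ?a * ?b)) * exp (- (?b\<^sup>2) / 2)"
    unfolding eq by (simp only: integral_mult_right_zero vg)
  also have "\<dots> = sqrt (2 * pi) * exp (?a\<^sup>2 / 2 + \<i> * ?a * ?b + (- (complex_of_real ?b)\<^sup>2 / 2))"
    by (simp only: exp_add) (simp add: exp_of_real[symmetric] mult.assoc del: exp_of_real)
  also have "?a\<^sup>2 / 2 + \<i> * ?a * ?b + (- (complex_of_real ?b)\<^sup>2 / 2) = s\<^sup>2 / 2"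
    by (subst (3) complex_eq[of s]) (simp add: power2_eq_square field_simps)
  finally show "(CLINT t|lborel. ?f t) = sqrt (2 * pi) * exp (s\<^sup>2 / 2)" .
qed

definition std_gauss :: "(real^'m) measure" where
  "std_gauss = density lborel (\<lambda>z. ennreal ((2 * pi) powr (- (real CARD('m) / 2)) * exp (- (norm z)\<^sup>2 / 2)))"

lemma sets_std_gauss[simp, measurable_cong]: "sets std_gauss = sets borel"
  by (simp add: std_gauss_def)

lemma space_std_gauss[simp]: "space std_gauss = UNIV"
  by (simp add: std_gauss_def)

lemma
  fixes s :: "complex^'m"
  shows integrable_std_gauss: "integrable std_gauss (\<lambda>z. exp (bilin z s))"
    and integral_std_gauss: "(CLINT z|std_gauss. exp (bilin z s)) = exp ((\<Sum>j\<in>UNIV. (s $ j)\<^sup>2) / 2)"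
proof -
  let ?c = "(2 * pi) powr (- (real CARD('m) / 2))"
  let ?h = "\<lambda>j t. exp (s $ j * complex_of_real t - (complex_of_real t)\<^sup>2 / 2)"
  have eq: "(?c * exp (- (norm z)\<^sup>2 / 2)) *\<^sub>R exp (bilin z s) = ?c * (\<Prod>j\<in>UNIV. ?h j (z $ j))" for z :: "real^'m"
  proof -
    have "(norm z)\<^sup>2 = (\<Sum>j\<in>UNIV. (z $ j)\<^sup>2)"
      by (simp only: power2_norm_eq_inner inner_vec_def) (simp add: power2_eq_square)
    then have "complex_of_real (exp (- (norm z)\<^sup>2 / 2)) = exp (- (\<Sum>j\<in>UNIV. (complex_of_real (z $ j))\<^sup>2) / 2)"
      by (simp add: exp_of_real[symmetric] del: exp_of_real)
    then have "complex_of_real (exp (- (norm z)\<^sup>2 / 2)) * exp (bilin z s) = (\<Prod>j\<in>UNIV. ?h j (z $ j))"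
      by (simp add: exp_add[symmetric] exp_sum[symmetric] bilin_def sum_subtractf sum_divide_distrib mult.commute)
    then show ?thesis by (simp add: scaleR_conv_of_real mult.assoc)
  qed
  have [measurable]: "(\<lambda>z::real^'m. exp (bilin z s)) \<in> borel_measurable borel"
    unfolding bilin_def by (intro borel_measurable_continuous_onI continuous_intros)
  have int: "integrable lborel (?h j)" for j by (rule integrable_exp_gauss)
  have "integrable lborel (\<lambda>z::real^'m. (?c * exp (- (norm z)\<^sup>2 / 2)) *\<^sub>R exp (bilin z s))"
    unfolding eq by (intro integrable_mult_right integrable_prod_vec int)
  then show "integrable std_gauss (\<lambda>z. exp (bilin z s))"
    unfolding std_gauss_def by (subst integrable_density) auto
  have "(CLINT z|std_gauss. exp (bilin z s)) = (CLINT z|lborel. (?c * exp (- (norm z)\<^sup>2 / 2)) *\<^sub>R exp (bilin z s))"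
    unfolding std_gauss_def by (subst integral_density) auto
  also have "\<dots> = ?c * (\<Prod>j\<in>UNIV. (CLINT t|lborel. ?h j t))"
    unfolding eq by (simp only: integral_mult_right_zero integral_prod_vec[of ?h, OF int])
  also have "\<dots> = (?c * sqrt (2 * pi) ^ CARD('m)) * exp ((\<Sum>j\<in>UNIV. (s $ j)\<^sup>2) / 2)"
    by (simp add: integral_exp_gauss prod.distrib exp_sum sum_divide_distrib)
  also have "?c * sqrt (2 * pi) ^ CARD('m) = 1"
    by (simp add: powr_minus powr_half_sqrt[symmetric] powr_realpow[symmetric] powr_powr field_simps)
  finally show "(CLINT z|std_gauss. exp (bilin z s)) = exp ((\<Sum>j\<in>UNIV. (s $ j)\<^sup>2) / 2)" by simp
qed

lemma prob_space_std_gauss: "prob_space (std_gauss :: (real^'m) measure)"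
proof -
  have "integrable (std_gauss :: (real^'m) measure) (indicat_real UNIV)"
    using integrable_norm[OF integrable_std_gauss[of "0::complex^'m"]] by (simp add: bilin_def)
  then interpret finite_measure "std_gauss :: (real^'m) measure"
    unfolding integrable_indicator_iff by (intro finite_measureI) simp
  have "measure (std_gauss :: (real^'m) measure) UNIV = 1"
    using integral_std_gauss[of "0::complex^'m"] by (simp add: bilin_def scaleR_conv_of_real)
  then show ?thesis by (intro prob_spaceI) (simp add: emeasure_eq_measure)
qed

text \<open>The centred normal law with covariance matrix \<open>A A\<^sup>T\<close>. Singular matrices \<open>A\<close> are admitted and give
the degenerate laws.\<close>

definition normal_measure :: "real^'m^'m \<Rightarrow> (real^'m) measure" where
  "normal_measure A = distr std_gauss borel (\<lambda>z. A *v z)"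

lemma measurable_matrix_vector[measurable]: "(\<lambda>z. A *v z) \<in> borel_measurable borel" for A :: "real^'m^'n"
  by (intro borel_measurable_continuous_onI matrix_vector_mult_linear_continuous_on)

lemma measurable_bilin[measurable]: "(\<lambda>z::real^'m. bilin z s) \<in> borel_measurable borel"
  unfolding bilin_def by (intro borel_measurable_continuous_onI continuous_intros)

lemma sets_normal_measure[simp, measurable_cong]: "sets (normal_measure A) = sets borel"
  by (simp add: normal_measure_def)

lemma prob_space_normal_measure: "prob_space (normal_measure A)"
  unfolding normal_measure_def by (intro prob_space.prob_space_distr prob_space_std_gauss) simp

lemma
  fixes A :: "real^'m^'m"
  shows integrable_normal_measure: "integrable (normal_measure A) (\<lambda>y. exp (bilin y s))"
    and mgf_normal_measure: "(CLINT y|normal_measure A. exp (bilin y s)) = exp (qform (map_matrix complex_of_real (A ** transpose A)) s / 2)"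
proof -
  let ?s = "\<chi> j. \<Sum>i\<in>UNIV. complex_of_real (A $ i $ j) * s $ i"
  have b: "bilin (A *v z) s = bilin z ?s" for z
  proof -
    have "bilin (A *v z) s = (\<Sum>i\<in>UNIV. \<Sum>j\<in>UNIV. complex_of_real (A $ i $ j) * complex_of_real (z $ j) * s $ i)"
      by (simp add: bilin_def matrix_vector_mult_def sum_distrib_right)
    also have "\<dots> = (\<Sum>j\<in>UNIV. \<Sum>i\<in>UNIV. complex_of_real (A $ i $ j) * complex_of_real (z $ j) * s $ i)"
      by (rule sum.swap)
    also have "\<dots> = bilin z ?s"
      by (simp add: bilin_def sum_distrib_left mult_ac)
    finally show ?thesis .
  qed
  have q: "(\<Sum>j\<in>UNIV. (?s $ j)\<^sup>2) = qform (map_matrix complex_of_real (A ** transpose A)) s"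
  proof -
    have "(\<Sum>j\<in>UNIV. (?s $ j)\<^sup>2) = (\<Sum>j\<in>UNIV. \<Sum>i\<in>UNIV. \<Sum>k\<in>UNIV. complex_of_real (A $ i $ j * A $ k $ j) * s $ i * s $ k)"
      by (simp add: power2_eq_square sum_product mult_ac)
    also have "\<dots> = (\<Sum>i\<in>UNIV. \<Sum>j\<in>UNIV. \<Sum>k\<in>UNIV. complex_of_real (A $ i $ j * A $ k $ j) * s $ i * s $ k)"
      by (rule sum.swap)
    also have "\<dots> = (\<Sum>i\<in>UNIV. \<Sum>k\<in>UNIV. \<Sum>j\<in>UNIV. complex_of_real (A $ i $ j * A $ k $ j) * s $ i * s $ k)"
      by (intro sum.cong refl sum.swap)
    also have "\<dots> = qform (map_matrix complex_of_real (A ** transpose A)) s"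
      by (simp add: qform_def map_matrix_def matrix_matrix_mult_def transpose_def sum_distrib_right)
    finally show ?thesis .
  qed
  show "integrable (normal_measure A) (\<lambda>y. exp (bilin y s))"
    unfolding normal_measure_def
    by (subst integrable_distr_eq) (auto simp: b integrable_std_gauss)
  show "(CLINT y|normal_measure A. exp (bilin y s)) = exp (qform (map_matrix complex_of_real (A ** transpose A)) s / 2)"
    unfolding normal_measure_def
    by (subst integral_distr) (auto simp: b integral_std_gauss simp flip: q)
qed

text \<open>The function \<open>r \<mapsto> exp (- r^2 / 2)\<close> has a derivative bounded by 1, because
\<open>\<bar>r\<bar> \<le> 1 + r^2 / 2 \<le> exp (r^2 / 2)\<close>.\<close>

lemma gauss_bump_Lipschitz:
  fixes p q :: "'a::real_normed_vector"
  shows "\<bar>exp (- (norm p)\<^sup>2 / 2) - exp (- (norm q)\<^sup>2 / 2)\<bar> \<le> norm (p - q)"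
proof -
  have "\<bar>exp (- x\<^sup>2 / 2) - exp (- y\<^sup>2 / 2)\<bar> \<le> 1 * \<bar>x - y\<bar>" for x y :: real
  proof (rule field_differentiable_bound[of UNIV "\<lambda>x::real. exp (- x\<^sup>2 / 2)" "\<lambda>r. - r * exp (- r\<^sup>2 / 2)" 1, unfolded real_norm_def])
    fix r :: real
    show "((\<lambda>x. exp (- x\<^sup>2 / 2)) has_field_derivative - r * exp (- r\<^sup>2 / 2)) (at r within UNIV)"
      by (auto intro!: derivative_eq_intros)
    have "0 \<le> (\<bar>r\<bar> - 1)\<^sup>2" by simp
    then have "2 * \<bar>r\<bar> \<le> r\<^sup>2 + 1" by (simp add: power2_eq_square algebra_simps)
    then have "\<bar>r\<bar> \<le> 1 + r\<^sup>2 / 2" by simp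
    also have "\<dots> \<le> exp (r\<^sup>2 / 2)" by (rule exp_ge_add_one_self)
    finally show "\<bar>- r * exp (- r\<^sup>2 / 2)\<bar> \<le> 1"
      by (simp add: abs_mult exp_minus field_simps)
  qed auto
  from this[of "norm p" "norm q"] show ?thesis
    using norm_triangle_ineq3[of p q] by simp
qed

lemma
  fixes A :: "'a::semiring_1^'n^'m"
  assumes "invertible A"
  shows matrix_inv_right: "A ** matrix_inv A = mat 1"
    and matrix_inv_left: "matrix_inv A ** A = mat 1"
  using someI_ex[OF assms[unfolded invertible_def]] by (simp_all add: matrix_inv_def)

lemma normal_measure_density:
  fixes A :: "real^'m^'m"
  assumes det: "det A \<noteq> 0"
  shows "normal_measure A = density lborel (\<lambda>y. ennreal ((2 * pi) powr (- (real CARD('m) / 2)) / \<bar>det A\<bar>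
     * exp (- (norm (matrix_inv A *v y))\<^sup>2 / 2)))" (is "_ = density lborel (\<lambda>y. ennreal (?q y))")
proof (rule measure_eqI)
  fix S assume "S \<in> sets (normal_measure A)"
  then have S[measurable]: "S \<in> sets borel" by simp
  let ?g = "\<lambda>z::real^'m. (2 * pi) powr (- (real CARD('m) / 2)) * exp (- (norm z)\<^sup>2 / 2)"
  have inv: "matrix_inv A *v (A *v z) = z" for z
    using det by (simp add: matrix_vector_mul_assoc matrix_inv_left invertible_det_nz)
  have q: "\<bar>det A\<bar> * ?q (A *v z) = ?g z" for z
    using det by (simp add: inv)
  have "emeasure (normal_measure A) S = (\<integral>\<^sup>+z. ennreal (?g z) * indicator S (A *v z) \<partial>lborel)"
    unfolding normal_measure_def std_gauss_def
    by (subst nn_integral_indicator[symmetric], simp, subst nn_integral_distr) (auto simp: nn_integral_density)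
  also have "\<dots> = (\<integral>\<^sup>+z. ennreal \<bar>det A\<bar> * (ennreal (?q (A *v z)) * indicator S (A *v z)) \<partial>lborel)"
    unfolding q[symmetric] by (subst ennreal_mult) (auto simp: mult.assoc)
  also have "\<dots> = ennreal \<bar>det A\<bar> * (\<integral>\<^sup>+z. ennreal (?q (A *v z)) * indicator S (A *v z) \<partial>lborel)"
    by (intro nn_integral_cmult) measurable
  also have "\<dots> = (\<integral>\<^sup>+y. ennreal (?q y) * indicator S y \<partial>lborel)"
    by (rule nn_integral_linear[symmetric, OF _ det]) measurable
  also have "\<dots> = emeasure (density lborel (\<lambda>y. ennreal (?q y))) S"
    by (subst emeasure_density) auto
  finally show "emeasure (normal_measure A) S = emeasure (density lborel (\<lambda>y. ennreal (?q y))) S" .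
qed simp

lemma normal_cdf_normal_measure:
  fixes A :: "real^'m^'m"
  assumes det: "det A \<noteq> 0"
  shows "measure (normal_measure A) {..x} = normal_cdf (A ** transpose A) x"
proof -
  let ?S = "A ** transpose A"
  let ?c = "(2 * pi) powr (- (real CARD('m) / 2)) / \<bar>det A\<bar>"
  have iA: "invertible A" using det by (simp add: invertible_det_nz)
  have iT: "invertible (transpose A)" using det by (simp add: invertible_det_nz)
  have inv: "matrix_inv ?S = transpose (matrix_inv A) ** matrix_inv A"
  proof -
    have "?S ** (transpose (matrix_inv A) ** matrix_inv A) = A ** (transpose A ** transpose (matrix_inv A)) ** matrix_inv A"
      by (simp add: matrix_mul_assoc)
    also have "transpose A ** transpose (matrix_inv A) = mat 1"
      using iA by (simp add: matrix_transpose_mul[symmetric] matrix_inv_left)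
    finally have "?S ** (transpose (matrix_inv A) ** matrix_inv A) = mat 1"
      using iA by (simp add: matrix_inv_right)
    then have "matrix_inv ?S = matrix_inv ?S ** (?S ** (transpose (matrix_inv A) ** matrix_inv A))" by simp
    also have "\<dots> = (matrix_inv ?S ** ?S) ** (transpose (matrix_inv A) ** matrix_inv A)"
      by (simp only: matrix_mul_assoc)
    also have "matrix_inv ?S ** ?S = mat 1"
      by (rule matrix_inv_left) (simp add: invertible_det_nz det_mul det)
    finally show ?thesis by simp
  qed
  have quad: "y \<bullet> (matrix_inv ?S *v y) = (norm (matrix_inv A *v y))\<^sup>2" for y
  proof -
    have "matrix_inv ?S *v y = (matrix_inv A *v y) v* matrix_inv A"
      unfolding inv matrix_vector_mul_assoc[symmetric] transpose_matrix_vector ..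
    then have "y \<bullet> (matrix_inv ?S *v y) = ((matrix_inv A *v y) v* matrix_inv A) \<bullet> y"
      by (simp only: inner_commute)
    then show ?thesis by (simp only: dot_lmul_matrix power2_norm_eq_inner)
  qed
  have dS: "sqrt (det ?S) = \<bar>det A\<bar>" by (simp add: det_mul)
  have m: "{..x} \<in> sets (borel :: (real^'m) measure)"
  proof -
    have "{..x} = {y. \<forall>i. y $ i \<le> x $ i}" by (auto simp: less_eq_vec_def)
    moreover have "closed {y. \<forall>i. y $ i \<le> x $ i}"
      by (intro closed_Collect_all closed_Collect_le continuous_intros)
    ultimately show ?thesis by simp
  qed
  interpret N: prob_space "normal_measure A" by (rule prob_space_normal_measure)
  have "measure (normal_measure A) {..x} = (LINT y|normal_measure A. indicator {..x} y)"
    using m by simp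
  also have "\<dots> = (LINT y|lborel. ?c * (exp (- (norm (matrix_inv A *v y))\<^sup>2 / 2) * indicator {..x} y))"
    unfolding normal_measure_density[OF det] using m by (subst integral_density) (auto simp: mult.assoc)
  also have "\<dots> = ?c * (LINT y|lborel. (exp (- (norm (matrix_inv A *v y))\<^sup>2 / 2) * indicator {..x} y))"
    by simp
  also have "\<dots> = normal_cdf ?S x"
    unfolding normal_cdf_def quad dS set_lebesgue_integral_def
    by (simp add: powr_minus field_simps)
  finally show ?thesis .
qed

text \<open>In the coordinates \<open>A\<^sup>-\<^sup>1 y\<close> an exponential tilt of the Gaussian bump is, up to a constant
factor, a translation of it.\<close>

lemma tilted_normal_density_Lipschitz:
  fixes A :: "real^'m^'m" and b :: "real^'m"
  assumes det: "det A \<noteq> 0"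
  shows "\<exists>L. \<forall>y y'. \<bar>exp (b \<bullet> y) * exp (- (norm (matrix_inv A *v y))\<^sup>2 / 2)
      - exp (b \<bullet> y') * exp (- (norm (matrix_inv A *v y'))\<^sup>2 / 2)\<bar> \<le> L * norm (y - y')"
proof -
  let ?B = "matrix_inv A" and ?d = "transpose A *v b"
  have inv: "A *v (?B *v y) = y" for y
    using det by (simp add: matrix_vector_mul_assoc matrix_inv_right invertible_det_nz)
  have bd: "b \<bullet> y = ?d \<bullet> (?B *v y)" for y
    using inv[of y] by (metis dot_lmul_matrix transpose_matrix_vector inner_commute)
  have eq: "exp (b \<bullet> y) * exp (- (norm (?B *v y))\<^sup>2 / 2)
      = exp ((norm ?d)\<^sup>2 / 2) * exp (- (norm (?B *v y - ?d))\<^sup>2 / 2)" for y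
  proof -
    have "(norm (?B *v y - ?d))\<^sup>2 = (norm (?B *v y))\<^sup>2 - 2 * (?d \<bullet> (?B *v y)) + (norm ?d)\<^sup>2"
      by (simp only: power2_norm_eq_inner inner_diff_left inner_diff_right) (simp add: inner_commute)
    then have "b \<bullet> y + - (norm (?B *v y))\<^sup>2 / 2 = (norm ?d)\<^sup>2 / 2 + - (norm (?B *v y - ?d))\<^sup>2 / 2"
      using bd[of y] by (simp add: field_simps)
    then show ?thesis by (simp only: exp_add[symmetric])
  qed
  have "\<bar>exp (- (norm (?B *v y - ?d))\<^sup>2 / 2) - exp (- (norm (?B *v y' - ?d))\<^sup>2 / 2)\<bar> \<le> onorm ((*v) ?B) * norm (y - y')" for y y'
  proof -
    have "\<bar>exp (- (norm (?B *v y - ?d))\<^sup>2 / 2) - exp (- (norm (?B *v y' - ?d))\<^sup>2 / 2)\<bar> \<le> norm (?B *v (y - y'))"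
      using gauss_bump_Lipschitz[of "?B *v y - ?d" "?B *v y' - ?d"] by (simp add: matrix_vector_mult_diff_distrib)
    also have "\<dots> \<le> onorm ((*v) ?B) * norm (y - y')"
      by (rule onorm) simp
    finally show ?thesis .
  qed
  then have "\<bar>exp ((norm ?d)\<^sup>2 / 2) * exp (- (norm (?B *v y - ?d))\<^sup>2 / 2) - exp ((norm ?d)\<^sup>2 / 2) * exp (- (norm (?B *v y' - ?d))\<^sup>2 / 2)\<bar>
    \<le> (exp ((norm ?d)\<^sup>2 / 2) * onorm ((*v) ?B)) * norm (y - y')" for y y'
    by (simp add: right_diff_distrib[symmetric] abs_mult mult.assoc)
  then show ?thesis unfolding eq by blast
qed

section \<open>A band-limited smoothing kernel\<close>

lemma integrable_inverse_square: "integrable lborel (\<lambda>x::real. inverse (1 + x\<^sup>2))"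
  using integrable_inverse_1_plus_square by (simp add: set_integrable_def)

definition triangle :: "real \<Rightarrow> real" where
  "triangle t = max 0 (1 - \<bar>t\<bar>)"

text \<open>The Fejer kernel. It is nonnegative and decays quadratically, while its Fourier transform, the
triangle function, has compact support.\<close>

definition fejer :: "real \<Rightarrow> real" where
  "fejer y = Re (CLINT t|lborel. triangle t *\<^sub>R iexp (t * y))"

lemma triangle_measurable[measurable]: "triangle \<in> borel_measurable borel"
  unfolding triangle_def[abs_def] by measurable

lemma triangle_nonneg[simp]: "0 \<le> triangle t" by (simp add: triangle_def)
lemma triangle_le_1: "triangle t \<le> 1" by (simp add: triangle_def)
lemma triangle_eq_0: "1 < \<bar>t\<bar> \<Longrightarrow> triangle t = 0" by (simp add: triangle_def)

lemma integrable_triangle: "integrable lborel triangle"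
proof (rule Bochner_Integration.integrable_bound)
  show "integrable lborel (\<lambda>t::real. 2 * inverse (1 + t\<^sup>2))"
    by (intro integrable_mult_right integrable_inverse_square)
  have "triangle t \<le> 2 * inverse (1 + t\<^sup>2)" for t
  proof (cases "\<bar>t\<bar> \<le> 1")
    case True
    then have "1 + t\<^sup>2 \<le> 2" by (simp add: abs_square_le_1)
    moreover have "1 + t\<^sup>2 > 0" by (simp add: add_pos_nonneg)
    ultimately have "1 \<le> 2 * inverse (1 + t\<^sup>2)" by (simp add: field_simps)
    then show ?thesis using triangle_le_1[of t] by simp
  next
    case False then show ?thesis by (simp add: triangle_eq_0)
  qed
  then show "AE t in lborel. norm (triangle t) \<le> norm (2 * inverse (1 + t\<^sup>2))"
    by (intro AE_I2) (smt (verit) real_norm_def triangle_nonneg)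
qed simp

lemma integrable_triangle_iexp: "integrable lborel (\<lambda>t. triangle t *\<^sub>R iexp (t * y))"
  by (rule Bochner_Integration.integrable_bound[OF integrable_triangle]) auto

text \<open>On each of \<open>{-1..0}\<close> and \<open>{0..1}\<close> the integrand is a linear function times an exponential and
has an elementary primitive; the endpoint 0 is counted twice, but it is a null set.\<close>

lemma fejer_eval:
  assumes y: "y \<noteq> 0"
  shows "(CLINT t|lborel. triangle t *\<^sub>R iexp (t * y)) = complex_of_real (2 * (1 - cos y) / y\<^sup>2)"
proof -
  define c where "c = \<i> * complex_of_real y"
  have c0: "c \<noteq> 0" using y by (simp add: c_def)
  have ie: "iexp (t * y) = exp (c * complex_of_real t)" for t by (simp add: c_def mult_ac)
  have d: "((\<lambda>t. exp (c * complex_of_real t)) has_vector_derivative c * exp (c * complex_of_real t)) (at t within S)" for t S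
    by (rule has_vector_derivative_real_field) (auto intro!: derivative_eq_intros)
  let ?g1 = "\<lambda>t. (1 + complex_of_real t) * exp (c * complex_of_real t)"
  let ?g2 = "\<lambda>t. (1 - complex_of_real t) * exp (c * complex_of_real t)"
  let ?F1 = "\<lambda>t. (1 + complex_of_real t) * exp (c * complex_of_real t) / c - exp (c * complex_of_real t) / c\<^sup>2"
  let ?F2 = "\<lambda>t. (1 - complex_of_real t) * exp (c * complex_of_real t) / c + exp (c * complex_of_real t) / c\<^sup>2"
  have D1: "(?F1 has_vector_derivative ?g1 t) (at t within S)" for t S
    by (rule has_vector_derivative_real_field)
       (auto intro!: derivative_eq_intros simp: c0 power2_eq_square field_simps)
  have D2: "(?F2 has_vector_derivative ?g2 t) (at t within S)" for t S
    by (rule has_vector_derivative_real_field)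
       (auto intro!: derivative_eq_intros simp: c0 power2_eq_square field_simps)
  have i1: "(CLINT t|lborel. indicator {-1..0} t *\<^sub>R ?g1 t) = ?F1 0 - ?F1 (-1)"
    by (rule integral_FTC_atLeastAtMost) (auto intro!: D1 continuous_intros)
  have i2: "(CLINT t|lborel. indicator {0..1} t *\<^sub>R ?g2 t) = ?F2 1 - ?F2 0"
    by (rule integral_FTC_atLeastAtMost) (auto intro!: D2 continuous_intros)
  have b1: "integrable lborel (\<lambda>t. indicator {-1..0} t *\<^sub>R ?g1 t)"
    by (rule borel_integrable_compact) (auto intro!: continuous_intros)
  have b2: "integrable lborel (\<lambda>t. indicator {0..1} t *\<^sub>R ?g2 t)"
    by (rule borel_integrable_compact) (auto intro!: continuous_intros)
  have "(CLINT t|lborel. triangle t *\<^sub>R iexp (t * y)) = (CLINT t|lborel. indicator {-1..0} t *\<^sub>R ?g1 t + indicator {0..1} t *\<^sub>R ?g2 t)"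
  proof (rule integral_cong_AE)
    have "AE t in lborel. t \<noteq> (0::real)" by (rule AE_lborel_singleton)
    then show "AE t in lborel. triangle t *\<^sub>R iexp (t * y) = indicator {-1..0} t *\<^sub>R ?g1 t + indicator {0..1} t *\<^sub>R ?g2 t"
    proof eventually_elim
      case (elim t)
      then show ?case unfolding ie by (auto simp: triangle_def indicator_def scaleR_conv_of_real abs_if)
    qed
  qed (use b1 b2 integrable_triangle_iexp[of y] in auto)
  also have "\<dots> = (?F1 0 - ?F1 (-1)) + (?F2 1 - ?F2 0)"
    by (subst Bochner_Integration.integral_add[OF b1 b2]) (simp only: i1 i2)
  also have "\<dots> = (exp c + exp (- c) - 2) / c\<^sup>2"
    using c0 by (simp add: field_simps)
  also have "\<dots> = complex_of_real (2 * (1 - cos y) / y\<^sup>2)"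
  proof -
    have "exp c + exp (- c) = complex_of_real (2 * cos y)"
      by (simp add: c_def cos_exp_eq flip: cos_of_real)
    moreover have "c\<^sup>2 = - complex_of_real (y\<^sup>2)" by (simp add: c_def power_mult_distrib)
    ultimately show ?thesis using y by (simp add: field_simps)
  qed
  finally show ?thesis .
qed

lemma fejer_fourier: "(CLINT t|lborel. triangle t *\<^sub>R iexp (t * y)) = complex_of_real (fejer y)"
proof (cases "y = 0")
  case True
  have "(CLINT t|lborel. triangle t *\<^sub>R iexp (t * y)) = (CLINT t|lborel. complex_of_real (triangle t))"
    using True by (simp add: scaleR_conv_of_real)
  also have "\<dots> = complex_of_real (LINT t|lborel. triangle t)" by simp
  finally show ?thesis by (simp add: fejer_def)
next
  case False then show ?thesis unfolding fejer_def fejer_eval[OF False] by simp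
qed

lemma fejer_eq: "y \<noteq> 0 \<Longrightarrow> fejer y = 2 * (1 - cos y) / y\<^sup>2"
  unfolding fejer_def by (subst fejer_eval) simp_all

lemma fejer_nonneg: "0 \<le> fejer y"
proof (cases "y = 0")
  case True
  have "fejer y = (LINT t|lborel. triangle t)"
    unfolding fejer_def True by (simp add: scaleR_conv_of_real)
  then show ?thesis by simp
next
  case False then show ?thesis by (simp add: fejer_eq)
qed

lemma fejer_measurable[measurable]: "fejer \<in> borel_measurable borel"
proof -
  define c where "c = fejer 0"
  have "fejer = (\<lambda>y. if y = 0 then c else 2 * (1 - cos y) / y\<^sup>2)"
    by (auto simp: fejer_eq c_def)
  moreover have "(\<lambda>y. if y = 0 then c else 2 * (1 - cos y) / y\<^sup>2) \<in> borel_measurable borel"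
    by measurable
  ultimately show ?thesis by simp
qed

lemma fejer_le: "fejer y \<le> (8 + 2 * fejer 0) * inverse (1 + y\<^sup>2)"
proof -
  have pos: "1 + y\<^sup>2 > 0" by (simp add: add_pos_nonneg)
  \<comment> \<open>near 0 the cosine is at least \<open>1 - y^2 / 2\<close>; away from 0 the trivial bound 4 for the numerator suffices\<close>
  consider "y = 0" | "y \<noteq> 0" "\<bar>y\<bar> \<le> 1" | "\<bar>y\<bar> > 1" by linarith
  then show ?thesis
  proof cases
    case 1 then show ?thesis using fejer_nonneg[of 0] by simp
  next
    case 2
    have "(sin (y / 2))\<^sup>2 \<le> (y / 2)\<^sup>2"
      using abs_sin_x_le_abs_x[of "y / 2"] unfolding abs_le_square_iff .
    then have "cos y \<ge> 1 - y\<^sup>2 / 2"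
      using cos_double_sin[of "y / 2"] by (simp add: power_divide)
    then have "fejer y \<le> 1" using 2 by (simp add: fejer_eq field_simps)
    also have "1 \<le> 8 * inverse (1 + y\<^sup>2)"
    proof -
      have "y\<^sup>2 \<le> 1" using 2 by (simp add: abs_square_le_1)
      then show ?thesis using pos by (simp add: field_simps)
    qed
    also have "\<dots> \<le> (8 + 2 * fejer 0) * inverse (1 + y\<^sup>2)" using fejer_nonneg[of 0] pos by (intro mult_right_mono) auto
    finally show ?thesis .
  next
    case 3
    then have y1: "1 < y\<^sup>2" using power_strict_mono[of 1 "\<bar>y\<bar>" 2] by simp
    have "1 - cos y \<le> 1 - (- 1)" by (intro diff_left_mono cos_ge_minus_one)
    then have "2 * (1 - cos y) \<le> 2 * (1 - (- 1))" by (rule mult_left_mono) simp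
    then have "2 * (1 - cos y) / y\<^sup>2 \<le> 2 * (1 - (- 1)) / y\<^sup>2" by (rule divide_right_mono) simp
    then have "fejer y \<le> 4 / y\<^sup>2" using 3 by (subst fejer_eq) auto
    also have "\<dots> \<le> 8 * inverse (1 + y\<^sup>2)" using y1 pos by (simp add: divide_simps)
    also have "\<dots> \<le> (8 + 2 * fejer 0) * inverse (1 + y\<^sup>2)" using fejer_nonneg[of 0] pos by (intro mult_right_mono) auto
    finally show ?thesis .
  qed
qed

lemma integrable_fejer: "integrable lborel fejer"
proof (rule Bochner_Integration.integrable_bound)
  show "integrable lborel (\<lambda>y::real. (8 + 2 * fejer 0) * inverse (1 + y\<^sup>2))"
    by (intro integrable_mult_right integrable_inverse_square)
  show "AE y in lborel. norm (fejer y) \<le> norm ((8 + 2 * fejer 0) * inverse (1 + y\<^sup>2))"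
    using fejer_le fejer_nonneg by (intro AE_I2) (smt (verit) real_norm_def)
qed simp

lemma integral_fejer_pos: "(LINT y|lborel. fejer y) > 0"
proof -
  have "(LINT y|lborel. fejer y) \<noteq> 0"
  proof
    assume "(LINT y|lborel. fejer y) = 0"
    then have "AE y in lborel. fejer y = 0"
      using integrable_fejer by (subst (asm) integral_nonneg_eq_0_iff_AE) (auto simp: fejer_nonneg)
    then have "AE y in lborel. \<not> (0 < y \<and> y < (1::real))"
    proof eventually_elim
      case (elim y)
      show ?case
      proof
        assume y: "0 < y \<and> y < 1"
        then have "cos y < cos 0" using pi_gt3 by (intro cos_monotone_0_pi) auto
        then have "fejer y > 0" using y by (simp add: fejer_eq)
        then show False using elim by simp
      qed
    qed
    then have "AE y in lborel. y \<notin> {0<..<1::real}" by simp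
    moreover have "{x::real. \<not> x \<notin> {0<..<1}} = {0<..<1}" by auto
    ultimately have "emeasure lborel {0<..<1::real} = 0"
      by (subst (asm) AE_iff_measurable[OF _ refl]) simp_all
    then show False by simp
  qed
  moreover have "(LINT y|lborel. fejer y) \<ge> 0" by (simp add: fejer_nonneg)
  ultimately show ?thesis by linarith
qed

text \<open>A product of Fejer kernels, normalised to total mass 1. Concentration of the mass in boxes makes
it an approximate identity after rescaling; the compact support of the transform \<open>k\<close> means that
smoothing at scale \<open>e\<close> only sees frequencies with \<open>\<bar>t $ j\<bar> \<le> 1 / e\<close>.\<close>

lemma smoothing_kernel:
  obtains K k :: "real^'m \<Rightarrow> real" and C where
    "\<And>y. 0 \<le> K y" "integrable lborel K" "(LINT y|lborel. K y) = 1"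
    "\<And>\<eta>. \<eta> > 0 \<Longrightarrow> \<exists>R>0. (LINT y|lborel. K y * indicator {y. \<forall>j. \<bar>y $ j\<bar> \<le> R} y) \<ge> 1 - \<eta>"
    "integrable lborel k" "\<And>t. 0 \<le> k t \<and> k t \<le> C" "\<And>t j. \<bar>t $ j\<bar> > 1 \<Longrightarrow> k t = 0"
    "\<And>y. complex_of_real (K y) = (CLINT t|lborel. k t *\<^sub>R iexp (t \<bullet> y))"
proof -
  define c where "c = (LINT y|lborel. fejer y) ^ CARD('m)"
  have c: "c > 0" using integral_fejer_pos by (simp add: c_def)
  define K where "K y = (\<Prod>j\<in>UNIV. fejer (y $ j)) / c" for y :: "real^'m"
  define k where "k t = (\<Prod>j\<in>UNIV. triangle (t $ j)) / c" for t :: "real^'m"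
  have K0: "0 \<le> K y" for y using c by (simp add: K_def prod_nonneg fejer_nonneg)
  have iK: "integrable lborel K"
    unfolding K_def[abs_def] by (intro integrable_divide_zero integrable_prod_vec impI) (rule integrable_fejer)
  have K1: "(LINT y|lborel. K y) = 1"
    unfolding K_def using c integral_fejer_pos by (simp add: integral_prod_vec[OF integrable_fejer] c_def)
  have ik: "integrable lborel k"
    unfolding k_def[abs_def] by (intro integrable_divide_zero integrable_prod_vec impI) (rule integrable_triangle)
  have k01: "0 \<le> k t \<and> k t \<le> 1 / c" for t
    using c by (auto simp: k_def prod_nonneg triangle_le_1 intro!: divide_right_mono prod_le_1)
  have k0: "k t = 0" if "\<bar>t $ j\<bar> > 1" for t j
  proof -
    have "(\<Prod>j\<in>UNIV. triangle (t $ j)) = 0"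
      using triangle_eq_0[OF that] by (intro prod_zero bexI[of _ j]) auto
    then show ?thesis by (simp add: k_def)
  qed
  have FT: "complex_of_real (K y) = (CLINT t|lborel. k t *\<^sub>R iexp (t \<bullet> y))" for y
  proof -
    have "k t *\<^sub>R iexp (t \<bullet> y) = (\<Prod>j\<in>UNIV. triangle (t $ j) *\<^sub>R iexp (t $ j * y $ j)) / c" for t
      by (simp add: k_def inner_vec_def scaleR_conv_of_real prod.distrib sum_distrib_left exp_sum)
    then have "(CLINT t|lborel. k t *\<^sub>R iexp (t \<bullet> y)) = (CLINT t|lborel. (\<Prod>j\<in>UNIV. triangle (t $ j) *\<^sub>R iexp (t $ j * y $ j)) / c)"
      by simp
    also have "\<dots> = (CLINT t|lborel. (\<Prod>j\<in>UNIV. triangle (t $ j) *\<^sub>R iexp (t $ j * y $ j))) / c"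
      by simp
    also have "\<dots> = (\<Prod>j\<in>UNIV. (CLINT t|lborel. triangle t *\<^sub>R iexp (t * y $ j))) / c"
      by (subst integral_prod_vec[of "\<lambda>j t. triangle t *\<^sub>R iexp (t * y $ j)", OF integrable_triangle_iexp]) simp
    also have "\<dots> = complex_of_real (K y)" unfolding fejer_fourier by (simp add: K_def)
    finally show ?thesis ..
  qed
  let ?B = "\<lambda>n::nat. {y::real^'m. \<forall>j. \<bar>y $ j\<bar> \<le> real n}"
  have cB: "closed (?B n)" for n
    by (intro closed_Collect_all closed_Collect_le continuous_intros)
  have mB: "?B n \<in> sets borel" for n
    by (intro borel_closed cB)
  have lim: "(\<lambda>n. LINT y|lborel. K y * indicator (?B n) y) \<longlonglongrightarrow> (LINT y|lborel. K y)"
  proof (rule integral_dominated_convergence[where w=K])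
    show "AE y in lborel. (\<lambda>n. K y * indicator (?B n) y) \<longlonglongrightarrow> K y"
    proof (intro AE_I2)
      fix y :: "real^'m"
      obtain N where N: "norm y \<le> real N" using real_arch_simple by blast
      have "K y * indicator (?B n) y = K y" if "n \<ge> N" for n
      proof -
        have "\<bar>y $ j\<bar> \<le> real n" for j
          using component_le_norm_cart[of y j] N that by linarith
        then show ?thesis by simp
      qed
      then show "(\<lambda>n. K y * indicator (?B n) y) \<longlonglongrightarrow> K y"
        by (intro tendsto_eventually eventually_sequentiallyI)
    qed
    show "(\<lambda>y. K y * indicator (?B n) y) \<in> borel_measurable lborel" for n
      using iK mB by (intro borel_measurable_times borel_measurable_indicator) auto
    show "AE y in lborel. norm (K y * indicator (?B n) y) \<le> K y" for n
      using K0 by (intro AE_I2) (auto simp: indicator_def)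
  qed (use iK in auto)
  have mass: "\<exists>R>0. (LINT y|lborel. K y * indicator {y. \<forall>j. \<bar>y $ j\<bar> \<le> R} y) \<ge> 1 - \<eta>" if "\<eta> > 0" for \<eta> :: real
  proof -
    have "\<forall>\<^sub>F n in sequentially. 1 - \<eta> < (LINT y|lborel. K y * indicator (?B n) y)"
      using lim K1 that by (intro order_tendstoD(1)) auto
    then have "\<forall>\<^sub>F n in sequentially. n > 0 \<and> 1 - \<eta> < (LINT y|lborel. K y * indicator (?B n) y)"
      using eventually_gt_at_top by (intro eventually_conj)
    then obtain n :: nat where "n > 0" "1 - \<eta> < (LINT y|lborel. K y * indicator (?B n) y)"
      using eventually_happens trivial_limit_sequentially by blast
    then show ?thesis by (intro exI[of _ "real n"]) auto
  qed
  show ?thesis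
    by (rule that[of K k "1 / c", OF K0 iK K1 mass ik k01 k0 FT])
qed

section \<open>Smoothing inequalities\<close>

lemma lborel_affine_integrable:
  fixes f :: "'a::euclidean_space \<Rightarrow> 'b::{banach, second_countable_topology}"
  assumes f: "integrable lborel f" and c: "c \<noteq> 0"
  shows "integrable lborel (\<lambda>x. f (t + c *\<^sub>R x))"
proof -
  have [measurable]: "f \<in> borel_measurable borel" using f by auto
  have "integrable (density (distr lborel borel (\<lambda>x. t + c *\<^sub>R x)) (\<lambda>_. ennreal (\<bar>c\<bar> ^ DIM('a)))) f"
    using f lborel_affine[OF c, of t] by (simp add: ennreal_power)
  then have "integrable (distr lborel borel (\<lambda>x. t + c *\<^sub>R x)) (\<lambda>x. (\<bar>c\<bar> ^ DIM('a)) *\<^sub>R f x)"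
    by (subst (asm) integrable_density) auto
  from integrable_scaleR_right[OF this, of "1 / \<bar>c\<bar> ^ DIM('a)"]
  have "integrable (distr lborel borel (\<lambda>x. t + c *\<^sub>R x)) f"
    using c by simp
  then show ?thesis by (subst (asm) integrable_distr_eq) auto
qed

lemma lborel_affine_integral:
  fixes f :: "'a::euclidean_space \<Rightarrow> 'b::{banach, second_countable_topology}"
  assumes [measurable]: "f \<in> borel_measurable borel" and c: "c \<noteq> 0"
  shows "(LINT x|lborel. f x) = (\<bar>c\<bar> ^ DIM('a)) *\<^sub>R (LINT x|lborel. f (t + c *\<^sub>R x))"
proof -
  have "(LINT x|lborel. f x) = (LINT x|density (distr lborel borel (\<lambda>x. t + c *\<^sub>R x)) (\<lambda>_. ennreal (\<bar>c\<bar> ^ DIM('a))). f x)"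
    using lborel_affine[OF c, of t] by (simp add: ennreal_power)
  also have "\<dots> = (LINT x|distr lborel borel (\<lambda>x. t + c *\<^sub>R x). (\<bar>c\<bar> ^ DIM('a)) *\<^sub>R f x)"
    by (subst integral_density) auto
  also have "\<dots> = (\<bar>c\<bar> ^ DIM('a)) *\<^sub>R (LINT x|lborel. f (t + c *\<^sub>R x))"
    by (subst integral_distr) auto
  finally show ?thesis .
qed

text \<open>The shape in which integrals are interchanged below: \<open>h\<close> is a complex exponential linking the two
variables.\<close>

lemma Fubini_coupled:
  fixes f :: "'a \<Rightarrow> complex" and g :: "'b \<Rightarrow> complex" and h :: "'a \<Rightarrow> 'b \<Rightarrow> complex"
  assumes M: "sigma_finite_measure M" and N: "sigma_finite_measure N"
    and f: "integrable M f" and g: "integrable N g"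
    and h: "case_prod h \<in> borel_measurable (M \<Otimes>\<^sub>M N)" and h1: "\<And>x y. cmod (h x y) \<le> 1"
  shows "(CLINT x|M. (CLINT y|N. f x * g y * h x y)) = (CLINT y|N. (CLINT x|M. f x * g y * h x y))"
proof -
  interpret M: sigma_finite_measure M by fact
  interpret N: sigma_finite_measure N by fact
  interpret pair_sigma_finite M N ..
  have fm[measurable]: "f \<in> borel_measurable M" and gm[measurable]: "g \<in> borel_measurable N" using f g by auto
  note h[measurable]
  have fg: "integrable (M \<Otimes>\<^sub>M N) (\<lambda>(x, y). f x * g y)"
  proof (rule Fubini_integrable)
    show "integrable M (\<lambda>x. LINT y|N. norm (case (x, y) of (x, y) \<Rightarrow> f x * g y))"
      using f by (simp add: norm_mult)
    show "AE x in M. integrable N (\<lambda>y. case (x, y) of (x, y) \<Rightarrow> f x * g y)"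
      using g by simp
  qed measurable
  have *: "integrable (M \<Otimes>\<^sub>M N) (\<lambda>(x, y). f x * g y * h x y)"
  proof (rule Bochner_Integration.integrable_bound[OF fg])
    show "(\<lambda>(x, y). f x * g y * h x y) \<in> borel_measurable (M \<Otimes>\<^sub>M N)"
    proof -
      have "(\<lambda>z. f (fst z) * g (snd z) * case_prod h z) \<in> borel_measurable (M \<Otimes>\<^sub>M N)" by measurable
      then show ?thesis by (simp add: case_prod_beta')
    qed
    show "AE z in M \<Otimes>\<^sub>M N. norm (case z of (x, y) \<Rightarrow> f x * g y * h x y) \<le> norm (case z of (x, y) \<Rightarrow> f x * g y)"
      using h1 by (intro AE_I2) (auto simp: norm_mult intro!: mult_right_le_one_le mult_nonneg_nonneg)
  qed
  show "(CLINT x|M. (CLINT y|N. f x * g y * h x y)) = (CLINT y|N. (CLINT x|M. f x * g y * h x y))"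
    by (rule Fubini_integral[OF *, symmetric])
qed

text \<open>Inserting the Fourier representation of the kernel and substituting \<open>z = x - e y\<close> expresses the
smoothed function through the Fourier transform of \<open>h\<close> cut off by \<open>k\<close>.\<close>

lemma smoothing_Fourier:
  fixes h :: "real^'m \<Rightarrow> real" and K k :: "real^'m \<Rightarrow> real"
  assumes h: "integrable lborel h" and k: "integrable lborel k"
    and K: "\<And>y. complex_of_real (K y) = (CLINT t|lborel. k t *\<^sub>R iexp (t \<bullet> y))"
    and e: "e > 0"
  shows "complex_of_real (LINT y|lborel. h (x - e *\<^sub>R y) * K y) =
    (CLINT t|lborel. k (e *\<^sub>R t) * iexp (t \<bullet> x) * (CLINT z|lborel. h z * iexp (- (t \<bullet> z))))"
proof -
  have [measurable]: "h \<in> borel_measurable borel" "k \<in> borel_measurable borel" using h k by auto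
  have ke: "integrable lborel (\<lambda>t. k (e *\<^sub>R t))"
    using lborel_affine_integrable[OF k, of e 0] e by simp
  have KM: "(\<lambda>y. complex_of_real (K y)) \<in> borel_measurable borel"
    unfolding K by measurable
  then have [measurable]: "K \<in> borel_measurable borel"
    using measurable_compose[OF KM borel_measurable_Re] by simp
  have Ke: "complex_of_real (K ((x - z) /\<^sub>R e)) = e ^ CARD('m) * (CLINT t|lborel. k (e *\<^sub>R t) * iexp (t \<bullet> (x - z)))" for z
  proof -
    have "complex_of_real (K ((x - z) /\<^sub>R e)) = (CLINT t|lborel. k t *\<^sub>R iexp (t \<bullet> ((x - z) /\<^sub>R e)))" by (rule K)
    also have "\<dots> = (\<bar>e\<bar> ^ DIM(real^'m)) *\<^sub>R (CLINT t|lborel. k (0 + e *\<^sub>R t) *\<^sub>R iexp ((0 + e *\<^sub>R t) \<bullet> ((x - z) /\<^sub>R e)))"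
      using e by (intro lborel_affine_integral) auto
    also have "\<dots> = e ^ CARD('m) * (CLINT t|lborel. k (e *\<^sub>R t) * iexp (t \<bullet> (x - z)))"
    proof -
      have eq: "(0 + e *\<^sub>R t) \<bullet> ((x - z) /\<^sub>R e) = t \<bullet> (x - z)" for t
        using e by simp
      show ?thesis unfolding eq using e by (simp add: scaleR_conv_of_real[where 'a=complex])
    qed
    finally show ?thesis .
  qed
  have "(LINT y|lborel. h (x - e *\<^sub>R y) * K y) = (LINT z|lborel. h z * K ((x - z) /\<^sub>R e)) / e ^ CARD('m)"
  proof -
    have "(LINT z|lborel. h z * K ((x - z) /\<^sub>R e)) = (\<bar>- e\<bar> ^ DIM(real^'m)) *\<^sub>R (LINT y|lborel. h (x + (- e) *\<^sub>R y) * K ((x - (x + (- e) *\<^sub>R y)) /\<^sub>R e))"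
      using e by (intro lborel_affine_integral) auto
    then show ?thesis using e by simp
  qed
  then have "complex_of_real (LINT y|lborel. h (x - e *\<^sub>R y) * K y) = (CLINT z|lborel. complex_of_real (h z) * complex_of_real (K ((x - z) /\<^sub>R e))) / e ^ CARD('m)"
    by (simp flip: of_real_mult)
  also have "\<dots> = (CLINT z|lborel. h z * (CLINT t|lborel. k (e *\<^sub>R t) * iexp (t \<bullet> (x - z))))"
  proof -
    have "(CLINT z|lborel. complex_of_real (h z) * complex_of_real (K ((x - z) /\<^sub>R e)))
        = (CLINT z|lborel. e ^ CARD('m) * (h z * (CLINT t|lborel. k (e *\<^sub>R t) * iexp (t \<bullet> (x - z)))))"
      unfolding Ke by (simp only: mult.left_commute)
    also have "\<dots> = e ^ CARD('m) * (CLINT z|lborel. h z * (CLINT t|lborel. k (e *\<^sub>R t) * iexp (t \<bullet> (x - z))))"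
      by (rule integral_mult_right_zero)
    finally show ?thesis using e by simp
  qed
  also have "\<dots> = (CLINT z|lborel. (CLINT t|lborel. complex_of_real (h z) * complex_of_real (k (e *\<^sub>R t)) * iexp (t \<bullet> (x - z))))"
    by (simp only: mult.assoc integral_mult_right_zero)
  also have "\<dots> = (CLINT t|lborel. (CLINT z|lborel. complex_of_real (h z) * complex_of_real (k (e *\<^sub>R t)) * iexp (t \<bullet> (x - z))))"
    using h ke by (intro Fubini_coupled sigma_finite_lborel) (auto intro!: integrable_of_real)
  also have "\<dots> = (CLINT t|lborel. (CLINT z|lborel. (k (e *\<^sub>R t) * iexp (t \<bullet> x)) * (h z * iexp (- (t \<bullet> z)))))"
  proof -
    have eq: "complex_of_real (h z) * complex_of_real (k (e *\<^sub>R t)) * iexp (t \<bullet> (x - z)) = (k (e *\<^sub>R t) * iexp (t \<bullet> x)) * (h z * iexp (- (t \<bullet> z)))" for t z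
      by (simp add: inner_diff_right right_diff_distrib exp_diff exp_minus field_simps)
    show ?thesis unfolding eq ..
  qed
  also have "\<dots> = (CLINT t|lborel. k (e *\<^sub>R t) * iexp (t \<bullet> x) * (CLINT z|lborel. h z * iexp (- (t \<bullet> z))))"
    by (simp only: integral_mult_right_zero)
  finally show ?thesis .
qed

text \<open>The box carries three quarters of the mass of the kernel, and there the integrand is at least
\<open>D\<close>; on the remaining quarter it is at least \<open>- B\<close>.\<close>

lemma smoothing_bound:
  fixes g K :: "real^'m \<Rightarrow> real"
  assumes K0: "\<And>y. 0 \<le> K y" and iK: "integrable lborel K" and K1: "(LINT y|lborel. K y) = 1"
    and R: "(LINT y|lborel. K y * indicator {y. \<forall>j. \<bar>y $ j\<bar> \<le> R} y) \<ge> 3 / 4"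
    and [measurable]: "g \<in> borel_measurable borel" and gb: "\<And>x. \<bar>g x\<bar> \<le> B"
    and box: "\<And>y. (\<forall>j. \<bar>y $ j\<bar> \<le> R) \<Longrightarrow> g (x - e *\<^sub>R y) \<ge> D"
    and sm: "\<bar>LINT y|lborel. g (x - e *\<^sub>R y) * K y\<bar> \<le> \<eta>"
  shows "D \<le> 4 / 3 * \<eta> + B / 3"
proof (cases "D \<le> 0")
  case True
  then show ?thesis using sm gb[of 0] by simp
next
  case False
  let ?S = "{y::real^'m. \<forall>j. \<bar>y $ j\<bar> \<le> R}"
  have "closed ?S" by (intro closed_Collect_all closed_Collect_le continuous_intros)
  then have S[measurable]: "?S \<in> sets borel" by simp
  have [measurable]: "K \<in> borel_measurable borel" using iK by auto
  let ?q = "LINT y|lborel. K y * indicator ?S y"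
  have i1: "integrable lborel (\<lambda>y. K y * indicator ?S y)"
    by (rule Bochner_Integration.integrable_bound[OF iK]) (auto simp: indicator_def)
  have q1: "?q \<le> 1" unfolding K1[symmetric] using K0 by (intro integral_mono i1 iK) (auto simp: indicator_def)
  have "D * ?q - B * (1 - ?q) = (LINT y|lborel. D * (K y * indicator ?S y) - B * (K y - K y * indicator ?S y))"
    using i1 iK K1 by simp
  also have "\<dots> \<le> (LINT y|lborel. g (x - e *\<^sub>R y) * K y)"
  proof (rule integral_mono)
    show "integrable lborel (\<lambda>y. D * (K y * indicator ?S y) - B * (K y - K y * indicator ?S y))"
      using i1 iK by simp
    have "integrable lborel (\<lambda>y. B * K y)" using iK by simp
    then show "integrable lborel (\<lambda>y. g (x - e *\<^sub>R y) * K y)"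
      by (rule Bochner_Integration.integrable_bound)
         (use gb K0 in \<open>auto simp: abs_mult intro!: AE_I2 mult_right_mono order_trans[OF gb abs_ge_self]\<close>)
    fix y
    show "D * (K y * indicator ?S y) - B * (K y - K y * indicator ?S y) \<le> g (x - e *\<^sub>R y) * K y"
    proof (cases "y \<in> ?S")
      case True
      then show ?thesis using box[of y] K0[of y] by (auto intro!: mult_right_mono)
    next
      case False
      have "- B \<le> g (x - e *\<^sub>R y)" using gb[of "x - e *\<^sub>R y"] by linarith
      then show ?thesis using False K0[of y] mult_right_mono[of "- B" "g (x - e *\<^sub>R y)" "K y"] by simp
    qed
  qed
  also have "\<dots> \<le> \<eta>" using sm by linarith
  finally have 1: "D * ?q - B * (1 - ?q) \<le> \<eta>" .
  have "B \<ge> 0" using gb[of 0] by linarith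
  then have "B * (1 - ?q) \<le> B * (1 / 4)" using R by (intro mult_left_mono) auto
  moreover have "D * (3 / 4) \<le> D * ?q" using False R by (intro mult_left_mono) auto
  ultimately show ?thesis using 1 by linarith
qed

text \<open>Esseen's smoothing argument. Since \<open>h\<close> hardly decreases in the direction \<open>\<sigma>\<close>, a large value at \<open>x\<close>
persists on a box with corner \<open>x\<close>, and a very negative value on the opposite box; centring the
kernel in that box, the smoothed function sees it up to a loss of a third of the supremum of
\<open>\<bar>h\<bar>\<close>. Taking the supremum over \<open>x\<close>, that loss is absorbed on the left-hand side.\<close>

lemma smoothing_sup:
  fixes h K :: "real^'m \<Rightarrow> real" and \<sigma> :: "real^'m"
  assumes K: "\<And>y. 0 \<le> K y" "integrable lborel K" "(LINT y|lborel. K y) = 1"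
      "(LINT y|lborel. K y * indicator {y. \<forall>j. \<bar>y $ j\<bar> \<le> R} y) \<ge> 3 / 4"
    and hm[measurable]: "h \<in> borel_measurable borel" and hb: "\<And>x. \<bar>h x\<bar> \<le> B0"
    and \<sigma>: "\<And>j. \<bar>\<sigma> $ j\<bar> = 1" and e: "e > 0" and R: "R > 0"
    and mono: "\<And>x y. (\<And>j. 0 \<le> \<sigma> $ j * y $ j \<and> \<sigma> $ j * y $ j \<le> 2 * e * R) \<Longrightarrow> h (x + y) \<ge> h x - a"
    and sm: "\<And>x. \<bar>LINT y|lborel. h (x - e *\<^sub>R y) * K y\<bar> \<le> \<eta>"
  shows "\<bar>h x\<bar> \<le> 2 * a + 2 * \<eta>"
proof -
  define B where "B = (SUP x. \<bar>h x\<bar>)"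
  have bdd: "bdd_above (range (\<lambda>x. \<bar>h x\<bar>))" using hb by (intro bdd_aboveI) auto
  have B: "\<bar>h x\<bar> \<le> B" for x unfolding B_def by (rule cSUP_upper[OF _ bdd]) simp
  have \<eta>: "\<eta> \<ge> 0" using sm[of 0] by linarith
  have a: "a \<ge> 0" using mono[of 0 0] e R by simp
  have inb: "0 \<le> \<sigma> $ j * (e *\<^sub>R (R *\<^sub>R \<sigma> + s *\<^sub>R y)) $ j \<and> \<sigma> $ j * (e *\<^sub>R (R *\<^sub>R \<sigma> + s *\<^sub>R y)) $ j \<le> 2 * e * R"
    if y: "\<forall>j. \<bar>y $ j\<bar> \<le> R" and s: "\<bar>s\<bar> = 1" for y j and s :: real
  proof -
    have ss: "\<sigma> $ j * \<sigma> $ j = 1" using \<sigma>[of j] by (metis abs_mult_self_eq mult_1)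
    define w where "w = s * \<sigma> $ j * y $ j"
    have eq: "\<sigma> $ j * (e *\<^sub>R (R *\<^sub>R \<sigma> + s *\<^sub>R y)) $ j = e * (R * (\<sigma> $ j * \<sigma> $ j) + w)"
      by (simp add: algebra_simps w_def)
    have "\<bar>w\<bar> \<le> R" using y s \<sigma>[of j] by (simp add: abs_mult w_def)
    then have "0 \<le> R + w" "R + w \<le> 2 * R" by linarith+
    then have "0 \<le> e * (R + w)" "e * (R + w) \<le> e * (2 * R)" using e by simp_all
    then show ?thesis unfolding eq ss by simp
  qed
  \<comment> \<open>the kernel is centred at the midpoint of the box \<open>x + {0..2 e R}\<close> in the direction of \<open>\<sigma>\<close>\<close>
  have up: "h x - a \<le> 4 / 3 * \<eta> + B / 3" for x
  proof (rule smoothing_bound[OF K, where g=h and x="x + e *\<^sub>R R *\<^sub>R \<sigma>" and e=e])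
    fix y :: "real^'m" assume y: "\<forall>j. \<bar>y $ j\<bar> \<le> R"
    have "h (x + e *\<^sub>R (R *\<^sub>R \<sigma> + (- 1) *\<^sub>R y)) \<ge> h x - a" by (rule mono, rule inb[OF y]) simp
    then show "h x - a \<le> h (x + e *\<^sub>R R *\<^sub>R \<sigma> - e *\<^sub>R y)" by (simp add: algebra_simps)
  qed (use B sm in auto)
  \<comment> \<open>and here at the midpoint of the opposite box, all of whose points precede \<open>x\<close>\<close>
  have dn: "- h x - a \<le> 4 / 3 * \<eta> + B / 3" for x
  proof (rule smoothing_bound[OF K, where g="\<lambda>x. - h x" and x="x - e *\<^sub>R R *\<^sub>R \<sigma>" and e=e])
    fix y :: "real^'m" assume y: "\<forall>j. \<bar>y $ j\<bar> \<le> R"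
    let ?v = "e *\<^sub>R (R *\<^sub>R \<sigma> + 1 *\<^sub>R y)"
    have "h ((x - ?v) + ?v) \<ge> h (x - ?v) - a" by (rule mono, rule inb[OF y]) simp
    then show "- h x - a \<le> - h (x - e *\<^sub>R R *\<^sub>R \<sigma> - e *\<^sub>R y)" by (simp add: algebra_simps)
  qed (use B sm in auto)
  have "\<bar>h x\<bar> \<le> a + 4 / 3 * \<eta> + B / 3" for x using up[of x] dn[of x] by linarith
  then have "B \<le> a + 4 / 3 * \<eta> + B / 3" unfolding B_def by (intro cSUP_least) auto
  then have "B \<le> 2 * a + 2 * \<eta>" using a by linarith
  then show ?thesis using B[of x] by linarith
qed

section \<open>Tilted distribution functions of orthants\<close>

text \<open>One relation is weak and the other strict, so that complementing a coordinate turns an orthant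
of one type into an orthant of another.\<close>

definition orthant :: "('m \<Rightarrow> bool) \<Rightarrow> real^'m \<Rightarrow> (real^'m) set" where
  "orthant \<sigma> x = {y. \<forall>j. (\<sigma> j \<longrightarrow> y $ j \<le> x $ j) \<and> (\<not> \<sigma> j \<longrightarrow> x $ j < y $ j)}"

definition sign_vec :: "('m \<Rightarrow> bool) \<Rightarrow> real^'m" where
  "sign_vec \<sigma> = (\<chi> j. if \<sigma> j then 1 else -1)"

text \<open>The exponential damped in the direction in which the orthant at \<open>w\<close> grows. Convolution with it
turns a tilted measure into its tilted distribution function, see \<open>tilted_cdf_eq\<close>.\<close>

definition exp_orthant :: "('m \<Rightarrow> bool) \<Rightarrow> real^'m \<Rightarrow> real" where
  "exp_orthant \<sigma> w = exp (- (sign_vec \<sigma> \<bullet> w)) * indicator (orthant \<sigma> w) 0"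

text \<open>Along the direction in which the orthants exhaust the space the measure tends to 1, so only the
exponential factor makes this function integrable.\<close>

definition tilted_cdf :: "('m \<Rightarrow> bool) \<Rightarrow> (real^'m) measure \<Rightarrow> real^'m \<Rightarrow> real" where
  "tilted_cdf \<sigma> P x = exp (- (sign_vec \<sigma> \<bullet> x)) * measure P (orthant \<sigma> x)"

text \<open>The value of the moment generating function at a point with real part \<open>- sign_vec \<sigma>\<close> and imaginary
part \<open>- t\<close>.\<close>

definition tilted_char :: "(real^'m) measure \<Rightarrow> ('m \<Rightarrow> bool) \<Rightarrow> real^'m \<Rightarrow> complex" where
  "tilted_char P \<sigma> t = (CLINT y|P. exp (- (sign_vec \<sigma> \<bullet> y)) * iexp (- (t \<bullet> y)))"

lemma sets_orthant[measurable]: "orthant \<sigma> x \<in> sets borel"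
proof -
  let ?S = "\<lambda>j. {y. (\<sigma> j \<longrightarrow> y $ j \<le> x $ j) \<and> (\<not> \<sigma> j \<longrightarrow> x $ j < y $ j)}"
  have "?S j \<in> sets borel" for j
  proof (cases "\<sigma> j")
    case True
    have "?S j = {y. y $ j \<le> x $ j}" using True by blast
    moreover have "{y. y $ j \<le> x $ j} \<in> sets borel"
      by (rule borel_closed, rule closed_Collect_le) (intro continuous_on_component continuous_on_id continuous_on_const)+
    ultimately show ?thesis by metis
  next
    case False
    have "?S j = {y. x $ j < y $ j}" using False by blast
    moreover have "{y. x $ j < y $ j} \<in> sets borel"
      by (rule borel_open, rule open_Collect_less) (intro continuous_on_component continuous_on_id continuous_on_const)+
    ultimately show ?thesis by metis
  qed
  then have "(\<Inter>j. ?S j) \<in> sets borel" by (intro sets.finite_INT) auto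
  moreover have "orthant \<sigma> x = (\<Inter>j. ?S j)" unfolding orthant_def by blast
  ultimately show ?thesis by (simp only:)
qed

text \<open>The product form yields integrability and measurability from the one-dimensional factors.\<close>

lemma exp_orthant_prod: "exp_orthant \<sigma> w = (\<Prod>j\<in>UNIV. if \<sigma> j then exp (- (w $ j)) * indicator {0..} (w $ j) else exp (w $ j) * indicator {..<0} (w $ j))"
proof -
  have "exp (- (sign_vec \<sigma> \<bullet> w)) = (\<Prod>j\<in>UNIV. exp (- (sign_vec \<sigma> $ j * w $ j)))"
    by (simp add: inner_vec_def exp_sum[symmetric] sum_negf)
  moreover have "indicator (orthant \<sigma> w) 0 = (\<Prod>j\<in>UNIV. (if \<sigma> j then indicator {0..} (w $ j) else indicator {..<0} (w $ j)) :: real)"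
  proof (cases "0 \<in> orthant \<sigma> w")
    case True
    then have "(if \<sigma> j then indicator {0..} (w $ j) else indicator {..<0} (w $ j)) = (1::real)" for j
      unfolding orthant_def by (cases "\<sigma> j") (auto dest: spec[of _ j])
    then show ?thesis using True by simp
  next
    case False
    then obtain j where "\<not> ((\<sigma> j \<longrightarrow> 0 \<le> w $ j) \<and> (\<not> \<sigma> j \<longrightarrow> w $ j < 0))" by (auto simp: orthant_def)
    then have "(if \<sigma> j then indicator {0..} (w $ j) else indicator {..<0} (w $ j)) = (0::real)" by auto
    then have "(\<Prod>j\<in>UNIV. (if \<sigma> j then indicator {0..} (w $ j) else indicator {..<0} (w $ j)) :: real) = 0"
      by (intro prod_zero bexI[of _ j]) auto
    then show ?thesis using False by simp
  qed
  ultimately show ?thesis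
    unfolding exp_orthant_def by (simp only: prod.distrib[symmetric]) (rule prod.cong, simp_all add: sign_vec_def)
qed

lemma integrable_exp_abs: "integrable lborel (\<lambda>t::real. exp (- \<bar>t\<bar>))"
proof (rule Bochner_Integration.integrable_bound)
  show "integrable lborel (\<lambda>t::real. 2 * inverse (1 + t\<^sup>2))"
    by (intro integrable_mult_right integrable_inverse_square)
  have "exp (- \<bar>t\<bar>) \<le> 2 * inverse (1 + t\<^sup>2)" for t :: real
  proof -
    have "1 + \<bar>t\<bar> + \<bar>t\<bar>\<^sup>2 / 2 \<le> exp \<bar>t\<bar>" by (rule exp_lower_Taylor_quadratic) simp
    then have "(1 + t\<^sup>2) / 2 \<le> exp \<bar>t\<bar>" by simp
    moreover have "1 + t\<^sup>2 > 0" by (simp add: add_pos_nonneg)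
    ultimately show ?thesis by (simp add: exp_minus field_simps)
  qed
  then show "AE t in lborel. norm (exp (- \<bar>t\<bar>)) \<le> norm (2 * inverse (1 + t\<^sup>2) :: real)"
    by (intro AE_I2) (auto intro: order_trans[OF _ abs_ge_self])
qed simp

lemma integrable_exp_orthant: "integrable lborel (exp_orthant \<sigma>)"
proof -
  have "integrable lborel (\<lambda>t::real. if \<sigma> j then exp (- t) * indicator {0..} t else exp t * indicator {..<0} t)" for j
    by (rule Bochner_Integration.integrable_bound[OF integrable_exp_abs]) (auto simp: indicator_def)
  then show ?thesis unfolding exp_orthant_prod[abs_def] by (rule integrable_prod_vec)
qed

lemma exp_orthant_measurable[measurable]: "exp_orthant \<sigma> \<in> borel_measurable borel"
  using integrable_exp_orthant[of \<sigma>] by auto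

lemma exp_orthant_nonneg[simp]: "0 \<le> exp_orthant \<sigma> w" by (simp add: exp_orthant_def)

lemma exp_orthant_shift: "exp_orthant \<sigma> (x - y) * exp (- (sign_vec \<sigma> \<bullet> y)) = exp (- (sign_vec \<sigma> \<bullet> x)) * indicator (orthant \<sigma> x) y"
proof -
  have "0 \<in> orthant \<sigma> (x - y) \<longleftrightarrow> y \<in> orthant \<sigma> x" by (auto simp: orthant_def)
  then have "indicator (orthant \<sigma> (x - y)) (0::real^'a) = (indicator (orthant \<sigma> x) y :: real)" by (simp add: indicator_def)
  moreover have "exp (- (sign_vec \<sigma> \<bullet> (x - y))) * exp (- (sign_vec \<sigma> \<bullet> y)) = exp (- (sign_vec \<sigma> \<bullet> x))"
    by (simp add: inner_diff_right flip: exp_add)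
  ultimately show ?thesis unfolding exp_orthant_def by (metis mult.assoc mult.commute)
qed

lemma tilted_cdf_eq:
  fixes P :: "(real^'m) measure"
  assumes P: "prob_space P" "sets P = sets borel"
  shows "tilted_cdf \<sigma> P x = (LINT y|P. exp_orthant \<sigma> (x - y) * exp (- (sign_vec \<sigma> \<bullet> y)))"
proof -
  interpret prob_space P by fact
  have "orthant \<sigma> x \<in> sets P" using P by simp
  then show ?thesis unfolding exp_orthant_shift tilted_cdf_def by simp
qed

lemma tilted_cdf_bounds:
  fixes P :: "(real^'m) measure"
  assumes P: "prob_space P" "sets P = sets borel" and i: "integrable P (\<lambda>y. exp (- (sign_vec \<sigma> \<bullet> y)))"
  shows "0 \<le> tilted_cdf \<sigma> P x" "tilted_cdf \<sigma> P x \<le> (LINT y|P. exp (- (sign_vec \<sigma> \<bullet> y)))"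
proof -
  interpret prob_space P by fact
  have S: "orthant \<sigma> x \<in> sets P" using P by simp
  show "0 \<le> tilted_cdf \<sigma> P x" by (simp add: tilted_cdf_def)
  have "tilted_cdf \<sigma> P x = (LINT y|P. exp (- (sign_vec \<sigma> \<bullet> x)) * indicator (orthant \<sigma> x) y)"
    using S by (simp add: tilted_cdf_def)
  also have "\<dots> \<le> (LINT y|P. exp (- (sign_vec \<sigma> \<bullet> y)))"
  proof (rule integral_mono[OF _ i])
    show "integrable P (\<lambda>y. exp (- (sign_vec \<sigma> \<bullet> x)) * indicator (orthant \<sigma> x) y)"
      using S by (simp add: integrable_indicator_iff emeasure_eq_measure)
    fix y
    show "exp (- (sign_vec \<sigma> \<bullet> x)) * indicator (orthant \<sigma> x) y \<le> exp (- (sign_vec \<sigma> \<bullet> y))"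
    proof (cases "y \<in> orthant \<sigma> x")
      case True
      then have "sign_vec \<sigma> \<bullet> y \<le> sign_vec \<sigma> \<bullet> x"
        unfolding inner_vec_def orthant_def by (intro sum_mono) (auto simp: sign_vec_def less_imp_le split: if_splits)
      then show ?thesis using True by simp
    qed simp
  qed
  finally show "tilted_cdf \<sigma> P x \<le> (LINT y|P. exp (- (sign_vec \<sigma> \<bullet> y)))" .
qed

text \<open>\<open>tilted_cdf\<close> is a convolution, so its Fourier transform is a product.\<close>

lemma
  fixes P :: "(real^'m) measure"
  assumes P: "prob_space P" "sets P = sets borel" and i: "integrable P (\<lambda>y. exp (- (sign_vec \<sigma> \<bullet> y)))"
  shows integrable_tilted_cdf: "integrable lborel (tilted_cdf \<sigma> P)"
    and tilted_cdf_Fourier: "(CLINT z|lborel. tilted_cdf \<sigma> P z * iexp (- (t \<bullet> z)))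
      = (CLINT w|lborel. exp_orthant \<sigma> w * iexp (- (t \<bullet> w))) * tilted_char P \<sigma> t"
proof -
  interpret prob_space P by fact
  interpret pair_sigma_finite P "lborel :: (real^'m) measure" ..
  note P(2)[measurable_cong]
  let ?f = "\<lambda>y z. exp_orthant \<sigma> (z - y) * exp (- (sign_vec \<sigma> \<bullet> y))"
  have sh: "integrable lborel (\<lambda>z. exp_orthant \<sigma> (z - y))" for y
    using lborel_affine_integrable[OF integrable_exp_orthant[of \<sigma>], where c=1 and t="- y"] by simp
  have shi: "(LINT z|lborel. exp_orthant \<sigma> (z - y)) = (LINT z|lborel. exp_orthant \<sigma> z)" for y
    using lborel_affine_integral[of "exp_orthant \<sigma>" 1, where t="- y"] by simp
  have int: "integrable (P \<Otimes>\<^sub>M lborel) (case_prod ?f)"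
  proof (rule Fubini_integrable)
    show "integrable P (\<lambda>y. LINT z|lborel. norm (case (y, z) of (y, z) \<Rightarrow> ?f y z))"
      using i by (simp add: abs_mult shi)
    show "AE y in P. integrable lborel (\<lambda>z. case (y, z) of (y, z) \<Rightarrow> ?f y z)"
      using sh by simp
  qed measurable
  have "integrable lborel (\<lambda>z. LINT y|P. ?f y z)"
    by (rule integrable_snd[OF int])
  then show "integrable lborel (tilted_cdf \<sigma> P)"
    unfolding tilted_cdf_eq[OF P, abs_def] .
  let ?g = "\<lambda>y z. complex_of_real (?f y z) * iexp (- (t \<bullet> z))"
  have intg: "integrable (P \<Otimes>\<^sub>M lborel) (case_prod ?g)"
    by (rule Bochner_Integration.integrable_bound[OF int]) (auto simp: norm_mult)
  have "(CLINT z|lborel. tilted_cdf \<sigma> P z * iexp (- (t \<bullet> z))) = (CLINT z|lborel. (CLINT y|P. ?g y z))"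
    unfolding tilted_cdf_eq[OF P] by (simp only: integral_mult_left_zero integral_complex_of_real)
  also have "\<dots> = (CLINT y|P. (CLINT z|lborel. ?g y z))"
    by (rule Fubini_integral[OF intg])
  also have "\<dots> = (CLINT y|P. (CLINT w|lborel. exp_orthant \<sigma> w * iexp (- (t \<bullet> w))) * (exp (- (sign_vec \<sigma> \<bullet> y)) * iexp (- (t \<bullet> y))))"
  proof (rule Bochner_Integration.integral_cong[OF refl])
    fix y
    have "(CLINT z|lborel. ?g y z) = (CLINT z|lborel. (exp (- (sign_vec \<sigma> \<bullet> y)) * iexp (- (t \<bullet> y))) * (exp_orthant \<sigma> (z - y) * iexp (- (t \<bullet> (z - y)))))"
    proof -
      have eq: "?g y z = (exp (- (sign_vec \<sigma> \<bullet> y)) * iexp (- (t \<bullet> y))) * (exp_orthant \<sigma> (z - y) * iexp (- (t \<bullet> (z - y))))" for z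
        by (simp add: inner_diff_right right_diff_distrib exp_diff exp_minus field_simps)
      show ?thesis unfolding eq ..
    qed
    also have "\<dots> = (exp (- (sign_vec \<sigma> \<bullet> y)) * iexp (- (t \<bullet> y))) * (CLINT z|lborel. exp_orthant \<sigma> (z - y) * iexp (- (t \<bullet> (z - y))))"
      by (rule integral_mult_right_zero)
    also have "(CLINT z|lborel. exp_orthant \<sigma> (z - y) * iexp (- (t \<bullet> (z - y)))) = (CLINT w|lborel. exp_orthant \<sigma> w * iexp (- (t \<bullet> w)))"
      using lborel_affine_integral[of "\<lambda>w. complex_of_real (exp_orthant \<sigma> w) * iexp (- (t \<bullet> w))" 1, where t="- y"] by simp
    finally show "(CLINT z|lborel. ?g y z) = (CLINT w|lborel. exp_orthant \<sigma> w * iexp (- (t \<bullet> w))) * (exp (- (sign_vec \<sigma> \<bullet> y)) * iexp (- (t \<bullet> y)))"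
      by (simp only: mult.commute)
  qed
  also have "\<dots> = (CLINT w|lborel. exp_orthant \<sigma> w * iexp (- (t \<bullet> w))) * (CLINT y|P. exp (- (sign_vec \<sigma> \<bullet> y)) * iexp (- (t \<bullet> y)))"
    by (rule integral_mult_right_zero)
  finally show "(CLINT z|lborel. tilted_cdf \<sigma> P z * iexp (- (t \<bullet> z)))
      = (CLINT w|lborel. exp_orthant \<sigma> w * iexp (- (t \<bullet> w))) * tilted_char P \<sigma> t"
    unfolding tilted_char_def .
qed

text \<open>The measure of the orthant grows in the direction of \<open>\<sigma>\<close>, and the exponential factor loses at
most a proportion \<open>sign_vec \<sigma> \<bullet> v\<close>. For the law of a random vector, which
may have jumps, this one-sided bound takes the place of a modulus of continuity.\<close>

lemma tilted_cdf_increment: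
  fixes P :: "(real^'m) measure" and d :: real
  assumes P: "prob_space P" "sets P = sets borel" and i: "integrable P (\<lambda>y. exp (- (sign_vec \<sigma> \<bullet> y)))"
    and v: "\<And>j. 0 \<le> sign_vec \<sigma> $ j * v $ j \<and> sign_vec \<sigma> $ j * v $ j \<le> d"
  shows "tilted_cdf \<sigma> P (x + v) \<ge> tilted_cdf \<sigma> P x - CARD('m) * d * (LINT y|P. exp (- (sign_vec \<sigma> \<bullet> y)))"
proof -
  interpret prob_space P by fact
  have sub: "orthant \<sigma> x \<subseteq> orthant \<sigma> (x + v)"
  proof
    fix y assume y: "y \<in> orthant \<sigma> x"
    show "y \<in> orthant \<sigma> (x + v)" unfolding orthant_def
    proof (intro CollectI allI)
      fix j show "(\<sigma> j \<longrightarrow> y $ j \<le> (x + v) $ j) \<and> (\<not> \<sigma> j \<longrightarrow> (x + v) $ j < y $ j)"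
        using y v[of j] unfolding orthant_def sign_vec_def by (cases "\<sigma> j") (auto dest!: spec[of _ j])
    qed
  qed
  have "measure P (orthant \<sigma> x) \<le> measure P (orthant \<sigma> (x + v))"
    using P sub by (intro finite_measure_mono) auto
  then have "tilted_cdf \<sigma> P (x + v) \<ge> exp (- (sign_vec \<sigma> \<bullet> v)) * tilted_cdf \<sigma> P x"
    by (simp add: tilted_cdf_def inner_add_right exp_diff exp_minus field_simps)
  moreover have "sign_vec \<sigma> \<bullet> v \<le> CARD('m) * d"
    unfolding inner_vec_def using v sum_bounded_above[of UNIV "\<lambda>j. sign_vec \<sigma> $ j * v $ j" d] by simp
  moreover have "exp (- (sign_vec \<sigma> \<bullet> v)) \<ge> 1 - sign_vec \<sigma> \<bullet> v" using exp_ge_add_one_self[of "- (sign_vec \<sigma> \<bullet> v)"] by simp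
  moreover note b = tilted_cdf_bounds[OF P i, of x]
  ultimately have "tilted_cdf \<sigma> P (x + v) \<ge> (1 - CARD('m) * d) * tilted_cdf \<sigma> P x"
    by - (rule order_trans[OF mult_right_mono[of "1 - CARD('m) * d" "exp (- (sign_vec \<sigma> \<bullet> v))"]], auto)
  moreover have "CARD('m) * d * tilted_cdf \<sigma> P x \<le> CARD('m) * d * (LINT y|P. exp (- (sign_vec \<sigma> \<bullet> y)))"
    using b v[of undefined] by (intro mult_left_mono) auto
  ultimately show ?thesis by (simp add: algebra_simps)
qed

text \<open>Convolution with the integrable function \<open>exp_orthant \<sigma>\<close> inherits the Lipschitz constant of the
tilted density.\<close>

lemma tilted_cdf_Lipschitz:
  fixes q :: "real^'m \<Rightarrow> real"
  assumes Q: "prob_space Q" "Q = density lborel (\<lambda>y. ennreal (q y))" and q0: "\<And>y. 0 \<le> q y" and [measurable]: "q \<in> borel_measurable borel"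
    and i: "integrable Q (\<lambda>y. exp (- (sign_vec \<sigma> \<bullet> y)))"
    and L: "\<And>y y'. \<bar>exp (- (sign_vec \<sigma> \<bullet> y)) * q y - exp (- (sign_vec \<sigma> \<bullet> y')) * q y'\<bar> \<le> L * norm (y - y')"
  shows "\<bar>tilted_cdf \<sigma> Q (x + v) - tilted_cdf \<sigma> Q x\<bar> \<le> (LINT w|lborel. exp_orthant \<sigma> w) * L * norm v"
proof -
  have sQ: "sets Q = sets borel" by (simp add: Q(2))
  interpret prob_space Q by fact
  let ?q = "\<lambda>y. exp (- (sign_vec \<sigma> \<bullet> y)) * q y"
  have eq: "tilted_cdf \<sigma> Q x = (LINT w|lborel. exp_orthant \<sigma> w * ?q (x - w))"
    and int: "integrable lborel (\<lambda>w. exp_orthant \<sigma> w * ?q (x - w))" for x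
  proof -
    have "integrable Q (\<lambda>y. exp_orthant \<sigma> (x - y) * exp (- (sign_vec \<sigma> \<bullet> y)))"
      unfolding exp_orthant_shift using sQ by (simp add: integrable_indicator_iff emeasure_eq_measure)
    then have 1: "integrable lborel (\<lambda>y. exp_orthant \<sigma> (x - y) * ?q y)"
      unfolding Q(2) by (subst (asm) integrable_density) (auto simp: q0 mult_ac)
    have "tilted_cdf \<sigma> Q x = (LINT y|lborel. exp_orthant \<sigma> (x - y) * ?q y)"
      unfolding tilted_cdf_eq[OF Q(1) sQ] unfolding Q(2) by (subst integral_density) (auto simp: q0 mult_ac)
    also have "\<dots> = (LINT w|lborel. exp_orthant \<sigma> w * ?q (x - w))"
      using lborel_affine_integral[of "\<lambda>y. exp_orthant \<sigma> (x - y) * ?q y" "-1", where t=x] by simp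
    finally show "tilted_cdf \<sigma> Q x = (LINT w|lborel. exp_orthant \<sigma> w * ?q (x - w))" .
    show "integrable lborel (\<lambda>w. exp_orthant \<sigma> w * ?q (x - w))"
      using lborel_affine_integrable[OF 1, where c="-1" and t=x] by simp
  qed
  have "tilted_cdf \<sigma> Q (x + v) - tilted_cdf \<sigma> Q x = (LINT w|lborel. exp_orthant \<sigma> w * ?q (x + v - w) - exp_orthant \<sigma> w * ?q (x - w))"
    unfolding eq by (subst Bochner_Integration.integral_diff[OF int int]) simp
  also have "\<bar>\<dots>\<bar> \<le> (LINT w|lborel. exp_orthant \<sigma> w * (L * norm v))"
    unfolding real_norm_def[symmetric]
  proof (rule Bochner_Integration.integral_norm_bound_integral)
    show "integrable lborel (\<lambda>w. exp_orthant \<sigma> w * ?q (x + v - w) - exp_orthant \<sigma> w * ?q (x - w))"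
      by (intro Bochner_Integration.integrable_diff int)
    show "integrable lborel (\<lambda>w. exp_orthant \<sigma> w * (L * norm v))" by (intro integrable_mult_left integrable_exp_orthant)
    fix w
    have "\<bar>?q (x + v - w) - ?q (x - w)\<bar> \<le> L * norm v" using L[of "x + v - w" "x - w"] by simp
    then show "norm (exp_orthant \<sigma> w * ?q (x + v - w) - exp_orthant \<sigma> w * ?q (x - w)) \<le> exp_orthant \<sigma> w * (L * norm v)"
      unfolding right_diff_distrib[symmetric] by (simp add: abs_mult mult_left_mono)
  qed
  also have "\<dots> = (LINT w|lborel. exp_orthant \<sigma> w) * L * norm v" by simp
  finally show ?thesis .
qed

section \<open>A Berry--Esseen inequality for orthants\<close>

text \<open>Smoothing at scale \<open>1 / T\<close> applied to the difference of the tilted distribution functions: the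
first summand of the bound is the modulus of continuity at that scale, the second one is the
smoothed difference, estimated through the Fourier transforms at the frequencies up to \<open>T\<close>. The
constant does not depend on \<open>P\<close>, which will run through a sequence of laws.\<close>

lemma tilted_Esseen:
  fixes q :: "real^'m \<Rightarrow> real" and G :: "real^'m \<Rightarrow> real"
  assumes Q: "prob_space Q" "Q = density lborel (\<lambda>y. ennreal (q y))" and q0: "\<And>y. 0 \<le> q y" and q[measurable]: "q \<in> borel_measurable borel"
    and iQ: "integrable Q (\<lambda>y. exp (- (sign_vec \<sigma> \<bullet> y)))"
    and L: "\<And>y y'. \<bar>exp (- (sign_vec \<sigma> \<bullet> y)) * q y - exp (- (sign_vec \<sigma> \<bullet> y')) * q y'\<bar> \<le> L * norm (y - y')"
    and G: "integrable lborel G"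
  obtains C where "C \<ge> 0"
    "\<And>P T \<delta> x. prob_space P \<Longrightarrow> sets P = sets borel \<Longrightarrow> integrable P (\<lambda>y. exp (- (sign_vec \<sigma> \<bullet> y))) \<Longrightarrow>
      (LINT y|P. exp (- (sign_vec \<sigma> \<bullet> y))) \<le> M \<Longrightarrow> T > 0 \<Longrightarrow> \<delta> \<ge> 0 \<Longrightarrow>
      (\<And>t. (\<forall>j. \<bar>t $ j\<bar> \<le> T) \<Longrightarrow> cmod (tilted_char P \<sigma> t - tilted_char Q \<sigma> t) \<le> \<delta> * G t) \<Longrightarrow>
      \<bar>tilted_cdf \<sigma> P x - tilted_cdf \<sigma> Q x\<bar> \<le> C * (1 / T + \<delta>)"
proof -
  obtain K k :: "real^'m \<Rightarrow> real" and Ck where K0: "\<And>y. 0 \<le> K y" "integrable lborel K" "(LINT y|lborel. K y) = 1"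
    "\<And>\<eta>. \<eta> > 0 \<Longrightarrow> \<exists>R>0. (LINT y|lborel. K y * indicator {y. \<forall>j. \<bar>y $ j\<bar> \<le> R} y) \<ge> 1 - \<eta>"
    and k: "integrable lborel k" "\<And>t. 0 \<le> k t \<and> k t \<le> Ck" "\<And>t j. \<bar>t $ j\<bar> > 1 \<Longrightarrow> k t = 0"
    and FT: "\<And>y. complex_of_real (K y) = (CLINT t|lborel. k t *\<^sub>R iexp (t \<bullet> y))"
    by (rule smoothing_kernel) blast
  obtain R where R: "R > 0" "(LINT y|lborel. K y * indicator {y. \<forall>j. \<bar>y $ j\<bar> \<le> R} y) \<ge> 3 / 4"
    using K0(4)[of "1 / 4"] by auto
  note K = K0(1-3) R
  have sQ: "sets Q = sets borel" by (simp add: Q(2))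
  define e1 where "e1 = (LINT w|lborel. exp_orthant \<sigma> w)"
  have e1: "e1 \<ge> 0" by (simp add: e1_def)
  have Ck: "Ck \<ge> 0" using k(2)[of 0] by linarith
  have "0 \<le> L * norm (axis undefined (1::real) - 0 :: real^'m)" by (rule order_trans[OF abs_ge_zero L])
  then have L0: "L \<ge> 0" by simp
  let ?n = "real CARD('m)"
  define a where "a = ?n * (2 * R) * \<bar>M\<bar> + e1 * L * (?n * (2 * R))"
  define Cg where "Cg = Ck * e1 * (LINT t|lborel. \<bar>G t\<bar>)"
  define C where "C = 2 * a + 2 * Cg"
  have a0: "a \<ge> 0" using K(4) e1 L0 by (simp add: a_def)
  have Cg0: "Cg \<ge> 0" using Ck e1 by (simp add: Cg_def)
  show ?thesis
  proof (rule that[of C])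
    show "C \<ge> 0" using a0 Cg0 by (simp add: C_def)
    fix P :: "(real^'m) measure" and T \<delta> :: real and x :: "real^'m"
    assume P: "prob_space P" "sets P = sets borel" and iP: "integrable P (\<lambda>y. exp (- (sign_vec \<sigma> \<bullet> y)))"
      and M: "(LINT y|P. exp (- (sign_vec \<sigma> \<bullet> y))) \<le> M" and T: "T > 0" and \<delta>: "\<delta> \<ge> 0"
      and close: "\<And>t. (\<forall>j. \<bar>t $ j\<bar> \<le> T) \<Longrightarrow> cmod (tilted_char P \<sigma> t - tilted_char Q \<sigma> t) \<le> \<delta> * G t"
    define h where "h x = tilted_cdf \<sigma> P x - tilted_cdf \<sigma> Q x" for x
    define e where "e = 1 / T"
    have e: "e > 0" using T by (simp add: e_def)
    have ih: "integrable lborel h"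
      unfolding h_def[abs_def] by (intro Bochner_Integration.integrable_diff integrable_tilted_cdf P Q(1) sQ iP iQ)
    have hm: "h \<in> borel_measurable borel" using ih by auto
    have hb: "\<bar>h x\<bar> \<le> \<bar>M\<bar> + (LINT y|Q. exp (- (sign_vec \<sigma> \<bullet> y)))" for x
      using tilted_cdf_bounds[OF P iP, of x] tilted_cdf_bounds[OF Q(1) sQ iQ, of x] M unfolding h_def by linarith
    have \<sigma>1: "\<bar>sign_vec \<sigma> $ j\<bar> = 1" for j by (simp add: sign_vec_def)
    have mono: "h (x + v) \<ge> h x - a * e"
      if v: "\<And>j. 0 \<le> sign_vec \<sigma> $ j * v $ j \<and> sign_vec \<sigma> $ j * v $ j \<le> 2 * e * R" for x v
    proof -
      have 1: "tilted_cdf \<sigma> P (x + v) \<ge> tilted_cdf \<sigma> P x - ?n * (2 * e * R) * (LINT y|P. exp (- (sign_vec \<sigma> \<bullet> y)))"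
        by (rule tilted_cdf_increment[OF P iP v])
      have 2: "?n * (2 * e * R) * (LINT y|P. exp (- (sign_vec \<sigma> \<bullet> y))) \<le> ?n * (2 * e * R) * \<bar>M\<bar>"
        using M e K(4) by (intro mult_left_mono) auto
      have "\<bar>v $ j\<bar> \<le> 2 * e * R" for j
      proof -
        have "\<bar>v $ j\<bar> = \<bar>sign_vec \<sigma> $ j * v $ j\<bar>" by (simp add: abs_mult \<sigma>1)
        then show ?thesis using v[of j] by simp
      qed
      then have "(\<Sum>j\<in>UNIV. \<bar>v $ j\<bar>) \<le> ?n * (2 * e * R)"
        using sum_bounded_above[of UNIV "\<lambda>j. \<bar>v $ j\<bar>" "2 * e * R"] by simp
      then have nv: "norm v \<le> ?n * (2 * e * R)" using norm_le_l1_cart[of v] by linarith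
      have "\<bar>tilted_cdf \<sigma> Q (x + v) - tilted_cdf \<sigma> Q x\<bar> \<le> e1 * L * norm v"
        unfolding e1_def by (rule tilted_cdf_Lipschitz[OF Q q0 q iQ L])
      also have "\<dots> \<le> e1 * L * (?n * (2 * e * R))" using nv e1 L0 by (intro mult_left_mono) auto
      finally have 3: "\<bar>tilted_cdf \<sigma> Q (x + v) - tilted_cdf \<sigma> Q x\<bar> \<le> e1 * L * (?n * (2 * e * R))" .
      have "a * e = ?n * (2 * e * R) * \<bar>M\<bar> + e1 * L * (?n * (2 * e * R))" by (simp add: a_def algebra_simps)
      then show ?thesis using 1 2 3 unfolding h_def by linarith
    qed
    have sm: "\<bar>LINT y|lborel. h (x - e *\<^sub>R y) * K y\<bar> \<le> Cg * \<delta>" for x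
    proof -
      let ?H = "\<lambda>t. CLINT z|lborel. h z * iexp (- (t \<bullet> z))"
      let ?f = "\<lambda>t. k (e *\<^sub>R t) * iexp (t \<bullet> x) * ?H t"
      have H: "cmod (?H t) \<le> e1 * (\<delta> * \<bar>G t\<bar>)" if t: "\<forall>j. \<bar>t $ j\<bar> \<le> T" for t
      proof -
        let ?E = "CLINT w|lborel. exp_orthant \<sigma> w * iexp (- (t \<bullet> w))"
        let ?c = "\<lambda>P. tilted_char P \<sigma> t"
        have i: "integrable lborel (\<lambda>z. tilted_cdf \<sigma> P z * iexp (- (t \<bullet> z)))" if "integrable lborel (tilted_cdf \<sigma> P)" for P
          using that by (rule Bochner_Integration.integrable_bound) (use that in \<open>auto simp: norm_mult\<close>)
        have "?H t = (CLINT z|lborel. tilted_cdf \<sigma> P z * iexp (- (t \<bullet> z)) - tilted_cdf \<sigma> Q z * iexp (- (t \<bullet> z)))"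
          by (simp add: h_def left_diff_distrib)
        also have "\<dots> = (CLINT z|lborel. tilted_cdf \<sigma> P z * iexp (- (t \<bullet> z))) - (CLINT z|lborel. tilted_cdf \<sigma> Q z * iexp (- (t \<bullet> z)))"
          by (intro Bochner_Integration.integral_diff i integrable_tilted_cdf P Q(1) sQ iP iQ)
        also have "\<dots> = ?E * (?c P - ?c Q)"
          unfolding tilted_cdf_Fourier[OF P iP] tilted_cdf_Fourier[OF Q(1) sQ iQ] by (simp only: right_diff_distrib)
        finally have "cmod (?H t) = cmod ?E * cmod (?c P - ?c Q)" by (simp only: norm_mult)
        also have "\<dots> \<le> e1 * (\<delta> * \<bar>G t\<bar>)"
        proof (rule mult_mono)
          have "cmod ?E \<le> (LINT w|lborel. cmod (exp_orthant \<sigma> w * iexp (- (t \<bullet> w))))" by (rule integral_norm_bound)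
          then show "cmod ?E \<le> e1" by (simp add: norm_mult e1_def)
          have "cmod (?c P - ?c Q) \<le> \<delta> * G t" by (rule close[OF t])
          also have "\<dots> \<le> \<delta> * \<bar>G t\<bar>" using \<delta> by (intro mult_left_mono) auto
          finally show "cmod (?c P - ?c Q) \<le> \<delta> * \<bar>G t\<bar>" .
        qed (use e1 in auto)
        finally show ?thesis .
      qed
      have eq: "complex_of_real (LINT y|lborel. h (x - e *\<^sub>R y) * K y) = (CLINT t|lborel. ?f t)"
        by (rule smoothing_Fourier[OF ih k(1) FT e])
      have "\<bar>LINT y|lborel. h (x - e *\<^sub>R y) * K y\<bar> = cmod (CLINT t|lborel. ?f t)"
        by (rule arg_cong[OF eq, of cmod, unfolded norm_of_real])
      also have "\<dots> \<le> (LINT t|lborel. Ck * (e1 * (\<delta> * \<bar>G t\<bar>)))"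
      proof (cases "integrable lborel ?f")
        case True
        show ?thesis
        proof (rule Bochner_Integration.integral_norm_bound_integral[OF True])
          show "integrable lborel (\<lambda>t. Ck * (e1 * (\<delta> * \<bar>G t\<bar>)))" using G by simp
          fix t
          show "cmod (?f t) \<le> Ck * (e1 * (\<delta> * \<bar>G t\<bar>))"
          proof (cases "\<forall>j. \<bar>t $ j\<bar> \<le> T")
            case True
            have "cmod (?f t) = k (e *\<^sub>R t) * cmod (?H t)" using k(2) by (simp add: norm_mult)
            also have "\<dots> \<le> Ck * (e1 * (\<delta> * \<bar>G t\<bar>))" using k(2) H[OF True] by (intro mult_mono) (auto simp: Ck)
            finally show ?thesis .
          next
            case False
            then obtain j where "\<bar>t $ j\<bar> > T" by (auto simp: not_le)
            then have "\<bar>(e *\<^sub>R t) $ j\<bar> > 1" using T by (simp add: e_def abs_mult field_simps)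
            then have "k (e *\<^sub>R t) = 0" by (rule k(3))
            then show ?thesis using Ck e1 \<delta> by simp
          qed
        qed
      next
        case False
        then have "(CLINT t|lborel. ?f t) = 0" by (rule not_integrable_integral_eq)
        then show ?thesis using Ck e1 \<delta> by (simp only: norm_zero) (auto intro!: Bochner_Integration.integral_nonneg mult_nonneg_nonneg)
      qed
      also have "\<dots> = Cg * \<delta>" by (simp add: Cg_def)
      finally show ?thesis .
    qed
    have "\<bar>h x\<bar> \<le> 2 * (a * e) + 2 * (Cg * \<delta>)"
      by (rule smoothing_sup[OF K(1,2,3,5) hm hb \<sigma>1 e K(4) mono sm])
    also have "\<dots> \<le> C * (1 / T + \<delta>)"
      using a0 Cg0 \<delta> e by (simp add: C_def e_def algebra_simps)
    finally show "\<bar>tilted_cdf \<sigma> P x - tilted_cdf \<sigma> Q x\<bar> \<le> C * (1 / T + \<delta>)" by (simp add: h_def)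
  qed
qed

text \<open>Call a coordinate bad if moving the corner \<open>x\<close> to 0 in this coordinate shrinks the orthant.
The orthants of the types \<open>\<sigma>\<close> and \<open>\<sigma>'\<close>, which differ in the bad coordinate \<open>j\<close> only, partition a
set that does not depend on \<open>x $ j\<close>. Comparing the partitions at \<open>x\<close> and at the corner with
\<open>j\<close>-th coordinate 0 expresses one orthant by three others with fewer bad coordinates.\<close>

lemma orthant_diff_bound:
  fixes P Q :: "(real^'m) measure"
  assumes P: "prob_space P" "sets P = sets borel" and Q: "prob_space Q" "sets Q = sets borel"
    and b: "\<And>\<sigma> x. (\<And>j. sign_vec \<sigma> $ j * x $ j \<le> 0) \<Longrightarrow> \<bar>measure P (orthant \<sigma> x) - measure Q (orthant \<sigma> x)\<bar> \<le> B"
  shows "\<bar>measure P (orthant \<sigma> x) - measure Q (orthant \<sigma> x)\<bar> \<le> 3 ^ card {j. sign_vec \<sigma> $ j * x $ j > 0} * B"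
proof (induction "card {j. sign_vec \<sigma> $ j * x $ j > 0}" arbitrary: \<sigma> x rule: less_induct)
  case less
  let ?bad = "\<lambda>\<sigma> x. {j. sign_vec \<sigma> $ j * x $ j > 0}"
  let ?D = "\<lambda>\<sigma> x. measure P (orthant \<sigma> x) - measure Q (orthant \<sigma> x)"
  interpret P: prob_space P by fact
  interpret Q: prob_space Q by fact
  have B: "B \<ge> 0" using b[of \<sigma> 0] by simp
  show ?case
  proof (cases "?bad \<sigma> x = {}")
    case True
    then have "sign_vec \<sigma> $ j * x $ j \<le> 0" for j by (auto simp: not_less[symmetric])
    then show ?thesis using b[of \<sigma> x] True by simp
  next
    case False
    then obtain j where j: "sign_vec \<sigma> $ j * x $ j > 0" by blast
    define \<sigma>' where "\<sigma>' = \<sigma>(j := \<not> \<sigma> j)"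
    define x' where "x' = (\<chi> i. if i = j then 0 else x $ i)"
    have un: "orthant \<sigma> z \<union> orthant \<sigma>' z = {y. \<forall>i. i \<noteq> j \<longrightarrow> (\<sigma> i \<longrightarrow> y $ i \<le> z $ i) \<and> (\<not> \<sigma> i \<longrightarrow> z $ i < y $ i)}" for z
    proof (intro set_eqI iffI)
      fix y assume y: "y \<in> {y. \<forall>i. i \<noteq> j \<longrightarrow> (\<sigma> i \<longrightarrow> y $ i \<le> z $ i) \<and> (\<not> \<sigma> i \<longrightarrow> z $ i < y $ i)}"
      show "y \<in> orthant \<sigma> z \<union> orthant \<sigma>' z"
      proof (cases "\<sigma> j \<longleftrightarrow> y $ j \<le> z $ j")
        case True
        have "(\<sigma> i \<longrightarrow> y $ i \<le> z $ i) \<and> (\<not> \<sigma> i \<longrightarrow> z $ i < y $ i)" for i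
          using True y by (cases "i = j") auto
        then have "y \<in> orthant \<sigma> z" unfolding orthant_def by blast
        then show ?thesis by blast
      next
        case False
        have "(\<sigma>' i \<longrightarrow> y $ i \<le> z $ i) \<and> (\<not> \<sigma>' i \<longrightarrow> z $ i < y $ i)" for i
          using False y by (cases "i = j") (auto simp: \<sigma>'_def)
        then have "y \<in> orthant \<sigma>' z" unfolding orthant_def by blast
        then show ?thesis by blast
      qed
    qed (auto simp: orthant_def \<sigma>'_def split: if_splits)
    have dis: "orthant \<sigma> z \<inter> orthant \<sigma>' z = {}" for z
    proof -
      have "\<not> (y \<in> orthant \<sigma> z \<and> y \<in> orthant \<sigma>' z)" for y
      proof
        assume "y \<in> orthant \<sigma> z \<and> y \<in> orthant \<sigma>' z"
        then have "(\<sigma> j \<longrightarrow> y $ j \<le> z $ j) \<and> (\<not> \<sigma> j \<longrightarrow> z $ j < y $ j)"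
          "(\<sigma>' j \<longrightarrow> y $ j \<le> z $ j) \<and> (\<not> \<sigma>' j \<longrightarrow> z $ j < y $ j)"
          unfolding orthant_def by blast+
        then show False by (cases "\<sigma> j") (auto simp: \<sigma>'_def)
      qed
      then show ?thesis by blast
    qed
    have add: "?D \<sigma> z + ?D \<sigma>' z = measure P (orthant \<sigma> z \<union> orthant \<sigma>' z) - measure Q (orthant \<sigma> z \<union> orthant \<sigma>' z)" for z
      using P Q by (simp add: P.finite_measure_Union Q.finite_measure_Union dis)
    have "orthant \<sigma> x \<union> orthant \<sigma>' x = orthant \<sigma> x' \<union> orthant \<sigma>' x'"
      unfolding un by (auto simp: x'_def)
    then have eq: "?D \<sigma> x + ?D \<sigma>' x = ?D \<sigma> x' + ?D \<sigma>' x'" unfolding add by simp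
    have sub: "?bad \<sigma> x' \<subseteq> ?bad \<sigma> x - {j}" "?bad \<sigma>' x' \<subseteq> ?bad \<sigma> x - {j}" "?bad \<sigma>' x \<subseteq> ?bad \<sigma> x - {j}"
      using j by (auto simp: x'_def \<sigma>'_def sign_vec_def split: if_splits)
    have fin: "finite (?bad \<sigma> x)" by simp
    have lt: "card A < card (?bad \<sigma> x)" "3 ^ card A * B \<le> 3 ^ (card (?bad \<sigma> x) - 1) * B" if "A \<subseteq> ?bad \<sigma> x - {j}" for A
    proof -
      have "card A \<le> card (?bad \<sigma> x - {j})" using that by (intro card_mono) auto
      then have *: "card A \<le> card (?bad \<sigma> x) - 1" using j by simp
      have "card (?bad \<sigma> x) > 0" using j fin by (auto simp: card_gt_0_iff)
      then show "card A < card (?bad \<sigma> x)" using * by linarith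
      show "3 ^ card A * B \<le> 3 ^ (card (?bad \<sigma> x) - 1) * B" using * B by (intro mult_right_mono power_increasing) auto
    qed
    let ?r = "3 ^ (card (?bad \<sigma> x) - 1) * B"
    have "\<bar>?D \<sigma> x'\<bar> \<le> ?r" "\<bar>?D \<sigma>' x'\<bar> \<le> ?r" "\<bar>?D \<sigma>' x\<bar> \<le> ?r"
      using less[OF lt(1)[OF sub(1)]] lt(2)[OF sub(1)] less[OF lt(1)[OF sub(2)]] lt(2)[OF sub(2)]
        less[OF lt(1)[OF sub(3)]] lt(2)[OF sub(3)] by linarith+
    then have "\<bar>?D \<sigma> x\<bar> \<le> 3 * ?r" using eq by linarith
    also have "3 * ?r = 3 ^ card (?bad \<sigma> x) * B"
    proof -
      have "card (?bad \<sigma> x) > 0" using j fin by (auto simp: card_gt_0_iff)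
      then show ?thesis by (cases "card (?bad \<sigma> x)") auto
    qed
    finally show ?thesis .
  qed
qed

text \<open>The bound for tilted distribution functions is a bound for the measures themselves on orthants
without bad coordinates, since there the tilt factor is at least 1. Reduction to such orthants
costs the factor \<open>3 ^ CARD('m)\<close>.\<close>

theorem multivariate_Berry_Esseen:
  fixes q :: "real^'m \<Rightarrow> real" and G :: "real^'m \<Rightarrow> real"
  assumes Q: "prob_space Q" "Q = density lborel (\<lambda>y. ennreal (q y))" and q0: "\<And>y. 0 \<le> q y" and q[measurable]: "q \<in> borel_measurable borel"
    and iQ: "\<And>\<sigma>. integrable Q (\<lambda>y. exp (- (sign_vec \<sigma> \<bullet> y)))"
    and L: "\<And>b. \<exists>L. \<forall>y y'. \<bar>exp (b \<bullet> y) * q y - exp (b \<bullet> y') * q y'\<bar> \<le> L * norm (y - y')"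
    and G: "integrable lborel G"
  obtains C where "C \<ge> 0"
    "\<And>P T \<delta> x. prob_space P \<Longrightarrow> sets P = sets borel \<Longrightarrow> (\<And>\<sigma>. integrable P (\<lambda>y. exp (- (sign_vec \<sigma> \<bullet> y)))) \<Longrightarrow>
      (\<And>\<sigma>. (LINT y|P. exp (- (sign_vec \<sigma> \<bullet> y))) \<le> M) \<Longrightarrow> T > 0 \<Longrightarrow> \<delta> \<ge> 0 \<Longrightarrow>
      (\<And>\<sigma> t. (\<forall>j. \<bar>t $ j\<bar> \<le> T) \<Longrightarrow> cmod (tilted_char P \<sigma> t - tilted_char Q \<sigma> t) \<le> \<delta> * G t) \<Longrightarrow>
      \<bar>measure P {..x} - measure Q {..x}\<bar> \<le> C * (1 / T + \<delta>)"
proof -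
  define good where "good \<sigma> C \<longleftrightarrow> C \<ge> 0 \<and> (\<forall>P T \<delta> x. prob_space P \<longrightarrow> sets P = sets borel \<longrightarrow> integrable P (\<lambda>y. exp (- (sign_vec \<sigma> \<bullet> y))) \<longrightarrow>
      (LINT y|P. exp (- (sign_vec \<sigma> \<bullet> y))) \<le> M \<longrightarrow> T > 0 \<longrightarrow> \<delta> \<ge> 0 \<longrightarrow>
      (\<forall>t. (\<forall>j. \<bar>t $ j\<bar> \<le> T) \<longrightarrow> cmod (tilted_char P \<sigma> t - tilted_char Q \<sigma> t) \<le> \<delta> * G t) \<longrightarrow>
      \<bar>tilted_cdf \<sigma> P x - tilted_cdf \<sigma> Q x\<bar> \<le> C * (1 / T + \<delta>))" for \<sigma> :: "'m \<Rightarrow> bool" and C :: real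
  have "\<exists>C. good \<sigma> C" for \<sigma>
  proof -
    obtain L where L: "\<And>y y'. \<bar>exp (- (sign_vec \<sigma> \<bullet> y)) * q y - exp (- (sign_vec \<sigma> \<bullet> y')) * q y'\<bar> \<le> L * norm (y - y')"
      using L[of "- sign_vec \<sigma>"] by auto
    show ?thesis
      by (rule tilted_Esseen[OF Q q0 q iQ L G, of M]) (unfold good_def, blast)
  qed
  then obtain C where C: "\<And>\<sigma>. good \<sigma> (C \<sigma>)" by metis
  have C0: "C \<sigma> \<ge> 0" for \<sigma> using C unfolding good_def by blast
  define C' where "C' = (\<Sum>\<sigma>\<in>UNIV. C \<sigma>)"
  have C': "C \<sigma> \<le> C'" for \<sigma> unfolding C'_def by (intro member_le_sum) (auto simp: C0)
  have C'0: "C' \<ge> 0" by (simp add: C'_def sum_nonneg C0)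
  have sQ: "sets Q = sets borel" by (simp add: Q(2))
  show ?thesis
  proof (rule that[of "3 ^ CARD('m) * C'"])
    show "3 ^ CARD('m) * C' \<ge> 0" using C'0 by simp
    fix P :: "(real^'m) measure" and T \<delta> :: real and x :: "real^'m"
    assume P: "prob_space P" "sets P = sets borel" and iP: "\<And>\<sigma>. integrable P (\<lambda>y. exp (- (sign_vec \<sigma> \<bullet> y)))"
      and M: "\<And>\<sigma>. (LINT y|P. exp (- (sign_vec \<sigma> \<bullet> y))) \<le> M" and T: "T > 0" and \<delta>: "\<delta> \<ge> 0"
      and close: "\<And>\<sigma> t. (\<forall>j. \<bar>t $ j\<bar> \<le> T) \<Longrightarrow> cmod (tilted_char P \<sigma> t - tilted_char Q \<sigma> t) \<le> \<delta> * G t"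
    let ?B = "C' * (1 / T + \<delta>)"
    have td: "\<bar>tilted_cdf \<sigma> P x - tilted_cdf \<sigma> Q x\<bar> \<le> ?B" for \<sigma> x
    proof -
      have "\<bar>tilted_cdf \<sigma> P x - tilted_cdf \<sigma> Q x\<bar> \<le> C \<sigma> * (1 / T + \<delta>)"
        using C[of \<sigma>] P iP M T \<delta> close unfolding good_def by blast
      also have "\<dots> \<le> ?B" using C' T \<delta> by (intro mult_right_mono) auto
      finally show ?thesis .
    qed
    have "\<bar>measure P (orthant \<sigma> x) - measure Q (orthant \<sigma> x)\<bar> \<le> ?B" if s: "\<And>j. sign_vec \<sigma> $ j * x $ j \<le> 0" for \<sigma> x
    proof -
      have "sign_vec \<sigma> \<bullet> x \<le> 0" unfolding inner_vec_def using s by (intro sum_nonpos) simp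
      then have "exp (- (sign_vec \<sigma> \<bullet> x)) \<ge> 1" by simp
      then have "1 * \<bar>measure P (orthant \<sigma> x) - measure Q (orthant \<sigma> x)\<bar> \<le> exp (- (sign_vec \<sigma> \<bullet> x)) * \<bar>measure P (orthant \<sigma> x) - measure Q (orthant \<sigma> x)\<bar>"
        by (intro mult_right_mono) auto
      also have "\<dots> = \<bar>tilted_cdf \<sigma> P x - tilted_cdf \<sigma> Q x\<bar>"
        unfolding tilted_cdf_def right_diff_distrib[symmetric] by (simp add: abs_mult)
      finally show ?thesis using td[of \<sigma> x] by simp
    qed
    then have "\<bar>measure P (orthant (\<lambda>_. True) x) - measure Q (orthant (\<lambda>_. True) x)\<bar> \<le> 3 ^ card {j. sign_vec (\<lambda>_. True) $ j * x $ j > 0} * ?B"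
      by (rule orthant_diff_bound[OF P Q(1) sQ])
    also have "\<dots> \<le> 3 ^ CARD('m) * ?B"
      using C'0 T \<delta> by (intro mult_right_mono power_increasing card_mono) auto
    also have "orthant (\<lambda>_. True) x = {..x}" by (auto simp: orthant_def less_eq_vec_def)
    finally show "\<bar>measure P {..x} - measure Q {..x}\<bar> \<le> 3 ^ CARD('m) * C' * (1 / T + \<delta>)" by (simp add: mult.assoc)
  qed
qed

section \<open>Continuity theorem for characteristic functions\<close>

text \<open>A continuous function of compact support is uniformly close to its smoothed version, uniformly
in the underlying measure. The expectation of the smoothed function is an integral of the
characteristic function against a fixed integrable function, so it converges by dominated
convergence.\<close>

lemma Levy_compact_support:
  fixes \<mu> :: "nat \<Rightarrow> (real^'m) measure" and f :: "real^'m \<Rightarrow> real"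
  assumes \<mu>: "\<And>n. prob_space (\<mu> n)" "\<And>n. sets (\<mu> n) = sets borel"
    and N: "prob_space N" "sets N = sets borel"
    and cf: "\<And>t. (\<lambda>n. CLINT y|\<mu> n. iexp (t \<bullet> y)) \<longlonglongrightarrow> (CLINT y|N. iexp (t \<bullet> y))"
    and f: "continuous_on UNIV f" and supp: "\<And>x. norm x > r \<Longrightarrow> f x = 0"
  shows "(\<lambda>n. LINT y|\<mu> n. f y) \<longlonglongrightarrow> (LINT y|N. f y)"
proof (rule LIMSEQ_I)
  fix \<epsilon> :: real assume \<epsilon>: "\<epsilon> > 0"
  have [measurable]: "f \<in> borel_measurable borel" using f by (rule borel_measurable_continuous_onI)
  note \<mu>(2)[measurable_cong] N(2)[measurable_cong]
  obtain B where B: "\<And>x. \<bar>f x\<bar> \<le> B" "B > 0"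
  proof -
    have "compact (f ` cball 0 r)" by (intro compact_continuous_image continuous_on_subset[OF f]) auto
    from compact_imp_bounded[OF this] obtain b where b: "b > 0" "\<forall>y \<in> f ` cball 0 r. norm y \<le> b"
      unfolding bounded_pos by (elim exE conjE)
    have "\<bar>f x\<bar> \<le> b" for x
    proof (cases "norm x > r")
      case True then show ?thesis using supp[OF True] b(1) by simp
    next
      case False
      then have "f x \<in> f ` cball 0 r" by (intro imageI) (simp add: dist_norm)
      then show ?thesis using b(2) by (metis real_norm_def)
    qed
    then show ?thesis using that b(1) by blast
  qed
  have uc: "\<exists>d>0. \<forall>x v. norm v < d \<longrightarrow> \<bar>f (x - v) - f x\<bar> \<le> \<eta>" if e0: "\<eta> > 0" for \<eta>
  proof -
    have "uniformly_continuous_on (cball 0 (r + 1)) f"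
      by (intro compact_uniformly_continuous continuous_on_subset[OF f]) auto
    then obtain d where d: "d > 0" "\<And>x y. x \<in> cball 0 (r + 1) \<Longrightarrow> y \<in> cball 0 (r + 1) \<Longrightarrow> dist y x < d \<Longrightarrow> dist (f y) (f x) < \<eta>"
      using uniformly_continuous_onE[OF _ e0] by blast
    have "\<bar>f (x - v) - f x\<bar> \<le> \<eta>" if v: "norm v < min d 1" for x v
    proof (cases "x \<in> cball 0 (r + 1) \<and> x - v \<in> cball 0 (r + 1)")
      case True
      then show ?thesis using d(2)[of x "x - v"] v by (auto simp: dist_norm)
    next
      case False
      then have "norm x > r \<and> norm (x - v) > r"
        using v norm_triangle_ineq4[of x v] norm_triangle_ineq[of "x - v" v] by auto
      then show ?thesis using supp \<open>\<eta> > 0\<close> by simp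
    qed
    then show ?thesis using d(1) by (intro exI[of _ "min d 1"]) auto
  qed
  have fi: "integrable lborel f"
  proof -
    have "integrable lborel (\<lambda>x. indicator (cball 0 r) x *\<^sub>R f x)"
      by (intro borel_integrable_compact continuous_on_subset[OF f]) auto
    moreover have "(\<lambda>x. indicator (cball 0 r) x *\<^sub>R f x) = f"
      using supp by (auto simp: indicator_def fun_eq_iff dist_norm)
    ultimately show ?thesis by (simp only:)
  qed
  obtain K k :: "real^'m \<Rightarrow> real" and Ck where K: "\<And>y. 0 \<le> K y" "integrable lborel K" "(LINT y|lborel. K y) = 1"
    "\<And>\<eta>. \<eta> > 0 \<Longrightarrow> \<exists>R>0. (LINT y|lborel. K y * indicator {y. \<forall>j. \<bar>y $ j\<bar> \<le> R} y) \<ge> 1 - \<eta>"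
    and k: "integrable lborel k" "\<And>t. 0 \<le> k t \<and> k t \<le> Ck" "\<And>t j. \<bar>t $ j\<bar> > 1 \<Longrightarrow> k t = 0"
    and FT: "\<And>y. complex_of_real (K y) = (CLINT t|lborel. k t *\<^sub>R iexp (t \<bullet> y))"
    by (rule smoothing_kernel) blast
  have [measurable]: "K \<in> borel_measurable borel" using K(2) by auto
  define \<eta> where "\<eta> = \<epsilon> / 4"
  have \<eta>: "\<eta> > 0" using \<epsilon> by (simp add: \<eta>_def)
  obtain R where R: "R > 0" "(LINT y|lborel. K y * indicator {y. \<forall>j. \<bar>y $ j\<bar> \<le> R} y) \<ge> 1 - \<eta> / (4 * B)"
    using K(4)[of "\<eta> / (4 * B)"] \<eta> B(2) by auto
  obtain d where d: "d > 0" "\<And>x v. norm v < d \<Longrightarrow> \<bar>f (x - v) - f x\<bar> \<le> \<eta> / 2"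
    using uc[of "\<eta> / 2"] \<eta> by auto
  \<comment> \<open>on the box \<open>\<bar>y $ j\<bar> \<le> R\<close> the Euclidean norm is at most \<open>CARD('m) * R\<close>, so \<open>e *\<^sub>R y\<close> stays below \<open>d\<close>\<close>
  define e where "e = d / (2 * (CARD('m) * R))"
  have e: "e > 0" using d(1) R(1) by (simp add: e_def)
  define fe where "fe x = (LINT y|lborel. f (x - e *\<^sub>R y) * K y)" for x
  have bound: "integrable lborel (\<lambda>y. f (x - e *\<^sub>R y) * K y)" for x
  proof (rule Bochner_Integration.integrable_bound)
    show "integrable lborel (\<lambda>y. B * K y)" using K(2) by simp
    show "AE y in lborel. norm (f (x - e *\<^sub>R y) * K y) \<le> norm (B * K y)"
      using B K(1) by (intro AE_I2) (auto simp: abs_mult intro!: mult_right_mono)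
  qed measurable
  have close: "\<bar>fe x - f x\<bar> \<le> \<eta>" for x
  proof -
    let ?S = "{y::real^'m. \<forall>j. \<bar>y $ j\<bar> \<le> R}"
    have "closed ?S" by (intro closed_Collect_all closed_Collect_le continuous_intros)
    then have S[measurable]: "?S \<in> sets borel" by simp
    have i1: "integrable lborel (\<lambda>y. K y * indicator ?S y)"
      by (rule Bochner_Integration.integrable_bound[OF K(2)]) (auto simp: indicator_def)
    have "fe x - f x = (LINT y|lborel. f (x - e *\<^sub>R y) * K y - f x * K y)"
      unfolding fe_def by (subst Bochner_Integration.integral_diff[OF bound]) (use K in auto)
    also have "\<bar>\<dots>\<bar> \<le> (LINT y|lborel. \<eta> / 2 * K y + 2 * B * (K y - K y * indicator ?S y))"
    proof (rule Bochner_Integration.integral_norm_bound_integral[where 'b=real, unfolded real_norm_def])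
      show "integrable lborel (\<lambda>y. f (x - e *\<^sub>R y) * K y - f x * K y)" using bound K(2) by simp
      show "integrable lborel (\<lambda>y. \<eta> / 2 * K y + 2 * B * (K y - K y * indicator ?S y))" using i1 K(2) by simp
      fix y
      show "\<bar>f (x - e *\<^sub>R y) * K y - f x * K y\<bar> \<le> \<eta> / 2 * K y + 2 * B * (K y - K y * indicator ?S y)"
      proof (cases "y \<in> ?S")
        case True
        then have "(\<Sum>j\<in>UNIV. \<bar>y $ j\<bar>) \<le> CARD('m) * R"
          using sum_bounded_above[of UNIV "\<lambda>j. \<bar>y $ j\<bar>" R] by simp
        then have "norm y \<le> CARD('m) * R" using norm_le_l1_cart[of y] by linarith
        then have "norm (e *\<^sub>R y) \<le> e * (CARD('m) * R)" using e by simp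
        also have "\<dots> = d / 2" using R(1) by (simp add: e_def)
        also have "\<dots> < d" using d(1) by simp
        finally have "\<bar>f (x - e *\<^sub>R y) - f x\<bar> * K y \<le> \<eta> / 2 * K y" using K(1) by (intro mult_right_mono d(2)) auto
        then show ?thesis using True K(1)[of y] by (simp add: left_diff_distrib[symmetric] abs_mult)
      next
        case False
        have "\<bar>f (x - e *\<^sub>R y) - f x\<bar> \<le> 2 * B" using B(1)[of "x - e *\<^sub>R y"] B(1)[of x] by linarith
        then have "\<bar>f (x - e *\<^sub>R y) - f x\<bar> * K y \<le> 2 * B * K y" using K(1) by (intro mult_right_mono) auto
        moreover have "0 \<le> \<eta> / 2 * K y" using \<eta> K(1)[of y] by simp
        ultimately show ?thesis using False K(1)[of y] by (simp add: left_diff_distrib[symmetric] abs_mult)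
      qed
    qed
    also have "\<dots> = \<eta> / 2 + 2 * B * (1 - (LINT y|lborel. K y * indicator ?S y))"
      using i1 K by simp
    also have "\<dots> \<le> \<eta> / 2 + 2 * B * (\<eta> / (4 * B))"
      using R(2) B(2) by (intro add_left_mono mult_left_mono) auto
    also have "\<dots> = \<eta>" using B(2) by simp
    finally show ?thesis .
  qed
  let ?g = "\<lambda>t. complex_of_real (k (e *\<^sub>R t)) * (CLINT z|lborel. f z * iexp (- (t \<bullet> z)))"
  have km: "k \<in> borel_measurable borel" using k(1) by auto
  have ke: "integrable lborel (\<lambda>t. k (e *\<^sub>R t))" using lborel_affine_integrable[OF k(1), where t=0 and c=e] e by simp
  have gi: "integrable lborel ?g"
  proof (rule Bochner_Integration.integrable_bound)
    show "integrable lborel (\<lambda>t. k (e *\<^sub>R t) * (LINT z|lborel. \<bar>f z\<bar>))" using ke by simp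
    show "?g \<in> borel_measurable lborel" using km by measurable
    have "cmod (CLINT z|lborel. f z * iexp (- (t \<bullet> z))) \<le> (LINT z|lborel. \<bar>f z\<bar>)" for t
      using integral_norm_bound[of lborel "\<lambda>z. f z * iexp (- (t \<bullet> z))"] by (simp add: norm_mult)
    then show "AE t in lborel. cmod (?g t) \<le> norm (k (e *\<^sub>R t) * (LINT z|lborel. \<bar>f z\<bar>))"
      using k(2) by (intro AE_I2) (auto simp: norm_mult abs_mult intro!: mult_left_mono)
  qed
  have fem[measurable]: "fe \<in> borel_measurable borel" unfolding fe_def by measurable
  have fb: "\<bar>fe x\<bar> \<le> B + \<eta>" for x using close[of x] B(1)[of x] by linarith
  have intfe: "complex_of_real (LINT y|M. fe y) = (CLINT t|lborel. ?g t * (CLINT y|M. iexp (t \<bullet> y)))"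
    if M: "prob_space M" "sets M = sets borel" for M
  proof -
    interpret prob_space M by fact
    note M(2)[measurable_cong]
    have "complex_of_real (LINT y|M. fe y) = (CLINT y|M. (CLINT t|lborel. 1 * ?g t * iexp (t \<bullet> y)))"
    proof -
      have "complex_of_real (fe y) = (CLINT t|lborel. 1 * ?g t * iexp (t \<bullet> y))" for y
        unfolding fe_def smoothing_Fourier[OF fi k(1) FT e] by (simp add: mult_ac)
      then show ?thesis by (simp flip: integral_complex_of_real)
    qed
    also have "\<dots> = (CLINT t|lborel. (CLINT y|M. 1 * ?g t * iexp (t \<bullet> y)))"
      by (rule Fubini_coupled[OF _ sigma_finite_lborel _ gi]) (auto intro: sigma_finite_measure_axioms)
    also have "\<dots> = (CLINT t|lborel. ?g t * (CLINT y|M. iexp (t \<bullet> y)))"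
      by (simp only: mult_1 integral_mult_right_zero)
    finally show ?thesis .
  qed
  have "(\<lambda>n. CLINT t|lborel. ?g t * (CLINT y|\<mu> n. iexp (t \<bullet> y))) \<longlonglongrightarrow> (CLINT t|lborel. ?g t * (CLINT y|N. iexp (t \<bullet> y)))"
  proof (rule integral_dominated_convergence[where w="\<lambda>t. cmod (?g t)"])
    interpret N: prob_space N by fact
    have gm[measurable]: "?g \<in> borel_measurable lborel" using gi by auto
    show "(\<lambda>t. ?g t * (CLINT y|N. iexp (t \<bullet> y))) \<in> borel_measurable lborel"
      by (intro borel_measurable_times gm) measurable
    show "(\<lambda>t. ?g t * (CLINT y|\<mu> n. iexp (t \<bullet> y))) \<in> borel_measurable lborel" for n
    proof -
      interpret prob_space "\<mu> n" by (rule \<mu>)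
      show ?thesis by (intro borel_measurable_times gm) measurable
    qed
    show "integrable lborel (\<lambda>t. cmod (?g t))" using gi by (rule integrable_norm)
    show "AE t in lborel. (\<lambda>n. ?g t * (CLINT y|\<mu> n. iexp (t \<bullet> y))) \<longlonglongrightarrow> ?g t * (CLINT y|N. iexp (t \<bullet> y))"
      by (intro AE_I2 tendsto_mult tendsto_const cf)
    show "AE t in lborel. norm (?g t * (CLINT y|\<mu> n. iexp (t \<bullet> y))) \<le> cmod (?g t)" for n
    proof (intro AE_I2)
      fix t :: "real^'m"
      interpret prob_space "\<mu> n" by (rule \<mu>)
      have "cmod (CLINT y|\<mu> n. iexp (t \<bullet> y)) \<le> 1"
        using integral_norm_bound[of "\<mu> n" "\<lambda>y. iexp (t \<bullet> y)"] by (simp add: prob_space)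
      then show "norm (?g t * (CLINT y|\<mu> n. iexp (t \<bullet> y))) \<le> cmod (?g t)"
        unfolding norm_mult[of "?g t"] by (rule mult_right_le_one_le[OF norm_ge_zero norm_ge_zero])
    qed
  qed
  then have "(\<lambda>n. complex_of_real (LINT y|\<mu> n. fe y)) \<longlonglongrightarrow> complex_of_real (LINT y|N. fe y)"
    unfolding intfe[OF \<mu>] intfe[OF N] .
  then have "(\<lambda>n. LINT y|\<mu> n. fe y) \<longlonglongrightarrow> (LINT y|N. fe y)" by (simp only: tendsto_of_real_iff)
  then obtain no where no: "\<And>n. n \<ge> no \<Longrightarrow> norm ((LINT y|\<mu> n. fe y) - (LINT y|N. fe y)) < \<eta>"
    using LIMSEQ_D[OF _ \<eta>] by blast
  have cl: "\<bar>(LINT y|M. f y) - (LINT y|M. fe y)\<bar> \<le> \<eta>" if M: "prob_space M" "sets M = sets borel" for M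
  proof -
    interpret prob_space M by fact
    note M(2)[measurable_cong]
    have i: "integrable M f" by (rule integrable_const_bound[of _ B]) (use B in auto)
    have ie: "integrable M fe" by (rule integrable_const_bound[of _ "B + \<eta>"]) (use fb in auto)
    have "\<bar>(LINT y|M. f y) - (LINT y|M. fe y)\<bar> = \<bar>LINT y|M. f y - fe y\<bar>"
      using i ie by simp
    also have "\<dots> \<le> (LINT y|M. \<eta>)"
      unfolding real_norm_def[symmetric]
    proof (rule Bochner_Integration.integral_norm_bound_integral)
      show "integrable M (\<lambda>y. f y - fe y)" using i ie by simp
      show "norm (f y - fe y) \<le> \<eta>" for y using close[of y] by (simp add: abs_minus_commute)
    qed simp
    finally show ?thesis by (simp add: prob_space)
  qed
  show "\<exists>no. \<forall>n\<ge>no. norm ((LINT y|\<mu> n. f y) - (LINT y|N. f y)) < \<epsilon>"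
  proof (intro exI[of _ no] allI impI)
    fix n assume "n \<ge> no"
    then have "\<bar>(LINT y|\<mu> n. fe y) - (LINT y|N. fe y)\<bar> < \<eta>" using no by simp
    moreover have "4 * \<eta> = \<epsilon>" by (simp add: \<eta>_def)
    ultimately show "norm ((LINT y|\<mu> n. f y) - (LINT y|N. f y)) < \<epsilon>"
      using cl[OF \<mu>, of n] cl[OF N] \<eta> unfolding real_norm_def by linarith
  qed
qed

text \<open>Multiplying with a cut-off function reduces to compact support. Tightness comes for free: the
expectations of the cut-off function itself converge, so the mass lost at infinity along the
sequence is no more than the mass that the limit has there.\<close>

theorem Levy_continuity_vec:
  fixes \<mu> :: "nat \<Rightarrow> (real^'m) measure" and f :: "real^'m \<Rightarrow> real"
  assumes \<mu>: "\<And>n. prob_space (\<mu> n)" "\<And>n. sets (\<mu> n) = sets borel"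
    and N: "prob_space N" "sets N = sets borel"
    and cf: "\<And>t. (\<lambda>n. CLINT y|\<mu> n. iexp (t \<bullet> y)) \<longlonglongrightarrow> (CLINT y|N. iexp (t \<bullet> y))"
    and f: "continuous_on UNIV f" and bd: "\<And>x. \<bar>f x\<bar> \<le> B"
  shows "(\<lambda>n. LINT y|\<mu> n. f y) \<longlonglongrightarrow> (LINT y|N. f y)"
proof (rule LIMSEQ_I)
  fix \<epsilon> :: real assume \<epsilon>: "\<epsilon> > 0"
  \<comment> \<open>equal to 1 on the ball of radius \<open>r\<close> and to 0 outside the ball of radius \<open>r + 1\<close>\<close>
  define bump :: "real \<Rightarrow> real^'m \<Rightarrow> real" where "bump r x = max 0 (min 1 (r + 1 - norm x))" for r x
  have c: "continuous_on UNIV (bump r)" for r unfolding bump_def by (intro continuous_intros)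
  have s: "bump r x = 0" if "norm x > r + 1" for r x using that by (simp add: bump_def)
  have c01: "0 \<le> bump r x" "bump r x \<le> 1" for r x by (auto simp: bump_def)
  have fm[measurable]: "f \<in> borel_measurable borel" using f by (rule borel_measurable_continuous_onI)
  have cm[measurable]: "bump r \<in> borel_measurable borel" for r using c by (rule borel_measurable_continuous_onI)
  have B: "B \<ge> 0" using bd[of 0] by linarith
  define \<eta> where "\<eta> = \<epsilon> / (2 * B + 2)"
  have \<eta>: "\<eta> > 0" using \<epsilon> B by (simp add: \<eta>_def)
  have "(\<lambda>n. LINT y|N. bump (real n) y) \<longlonglongrightarrow> (LINT y|N. 1)"
  proof (rule integral_dominated_convergence[where w="\<lambda>_. 1"])
    interpret prob_space N by fact
    note N(2)[measurable_cong]
    show "AE y in N. (\<lambda>n. bump (real n) y) \<longlonglongrightarrow> 1"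
    proof (intro AE_I2)
      fix y :: "real^'m"
      obtain n0 where "norm y \<le> real n0" using real_arch_simple by blast
      then have "bump (real n) y = 1" if "n \<ge> n0" for n using that by (simp add: bump_def)
      then show "(\<lambda>n. bump (real n) y) \<longlonglongrightarrow> 1" by (intro tendsto_eventually eventually_sequentiallyI)
    qed
    show "integrable N (\<lambda>_. 1 :: real)" by simp
  qed (use c01 N(2) cm in \<open>auto simp: measurable_cong_sets[OF N(2) refl]\<close>)
  moreover have "(LINT y|N. (1::real)) = 1" using N(1) by (simp add: prob_space.prob_space)
  ultimately have "\<forall>\<^sub>F n in sequentially. (LINT y|N. bump (real n) y) > 1 - \<eta> / 4"
    using \<eta> by (intro order_tendstoD(1)) auto
  then obtain r where r: "(LINT y|N. bump r y) > 1 - \<eta> / 4"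
    using eventually_happens trivial_limit_sequentially by blast
  have l1: "(\<lambda>n. LINT y|\<mu> n. bump r y) \<longlonglongrightarrow> (LINT y|N. bump r y)"
    by (rule Levy_compact_support[OF \<mu> N cf c s])
  have l2: "(\<lambda>n. LINT y|\<mu> n. f y * bump r y) \<longlonglongrightarrow> (LINT y|N. f y * bump r y)"
    by (rule Levy_compact_support[OF \<mu> N cf, where r="r + 1"]) (auto intro!: continuous_intros f c simp: s)
  obtain n1 where n1: "\<And>n. n \<ge> n1 \<Longrightarrow> norm ((LINT y|\<mu> n. bump r y) - (LINT y|N. bump r y)) < \<eta> / 4"
    using LIMSEQ_D[OF l1, of "\<eta> / 4"] \<eta> by auto
  obtain n2 where n2: "\<And>n. n \<ge> n2 \<Longrightarrow> norm ((LINT y|\<mu> n. f y * bump r y) - (LINT y|N. f y * bump r y)) < \<eta>"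
    using LIMSEQ_D[OF l2, of "\<eta>"] \<eta> by auto
  have cut: "\<bar>(LINT y|M. f y) - (LINT y|M. f y * bump r y)\<bar> \<le> B * (1 - (LINT y|M. bump r y))"
    if M: "prob_space M" "sets M = sets borel" for M
  proof -
    interpret prob_space M by fact
    note M(2)[measurable_cong]
    have i: "integrable M f" by (rule integrable_const_bound[of _ B]) (use bd in auto)
    have ic: "integrable M (bump r)" by (rule integrable_const_bound[of _ 1]) (use c01 in auto)
    have ifc: "integrable M (\<lambda>y. f y * bump r y)"
    proof (rule integrable_const_bound[of _ B])
      have "\<bar>f y\<bar> * \<bar>bump r y\<bar> \<le> B * 1" for y using bd c01 B by (intro mult_mono) auto
      then show "AE y in M. norm (f y * bump r y) \<le> B" by (intro AE_I2) (simp add: abs_mult)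
    qed measurable
    have "\<bar>(LINT y|M. f y) - (LINT y|M. f y * bump r y)\<bar> = \<bar>LINT y|M. f y - f y * bump r y\<bar>"
      using i ifc by simp
    also have "\<dots> \<le> (LINT y|M. B * (1 - bump r y))"
      unfolding real_norm_def[symmetric]
    proof (rule Bochner_Integration.integral_norm_bound_integral)
      show "integrable M (\<lambda>y. f y - f y * bump r y)" using i ifc by simp
      show "integrable M (\<lambda>y. B * (1 - bump r y))" using ic by simp
      fix y
      have "f y - f y * bump r y = f y * (1 - bump r y)" by (simp add: algebra_simps)
      then show "norm (f y - f y * bump r y) \<le> B * (1 - bump r y)"
        using bd[of y] c01(2)[of r y] by (simp add: abs_mult mult_right_mono)
    qed
    also have "\<dots> = B * (1 - (LINT y|M. bump r y))" using ic by (simp add: prob_space)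
    finally show ?thesis .
  qed
  show "\<exists>no. \<forall>n\<ge>no. norm ((LINT y|\<mu> n. f y) - (LINT y|N. f y)) < \<epsilon>"
  proof (intro exI[of _ "max n1 n2"] allI impI)
    fix n assume n: "n \<ge> max n1 n2"
    have "n \<ge> n1" using n by simp
    from n1[OF this] have "(LINT y|N. bump r y) - (LINT y|\<mu> n. bump r y) < \<eta> / 4"
      unfolding real_norm_def by linarith
    then have a: "(LINT y|\<mu> n. bump r y) > 1 - \<eta> / 2" using r by linarith
    have "B * (1 - (LINT y|\<mu> n. bump r y)) \<le> B * (\<eta> / 2)" using a B by (intro mult_left_mono) auto
    moreover have "B * (1 - (LINT y|N. bump r y)) \<le> B * (\<eta> / 4)" using r B by (intro mult_left_mono) auto
    moreover have "\<bar>(LINT y|\<mu> n. f y * bump r y) - (LINT y|N. f y * bump r y)\<bar> < \<eta>" using n2[of n] n by simp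
    moreover have "(2 * B + 2) * \<eta> = \<epsilon>" using B unfolding \<eta>_def by simp
    then have "\<epsilon> = 2 * (B * \<eta>) + 2 * \<eta>" by (simp only: distrib_right mult.assoc)
    moreover have "B * \<eta> \<ge> 0" using B \<eta> by simp
    ultimately show "norm ((LINT y|\<mu> n. f y) - (LINT y|N. f y)) < \<epsilon>"
      using cut[OF \<mu>, of n] cut[OF N] \<eta> unfolding real_norm_def times_divide_eq_right by linarith
  qed
qed

section \<open>Moment generating functions with quasi-power asymptotics\<close>

definition cvec :: "real^'m \<Rightarrow> complex^'m" where
  "cvec x = (\<chi> j. complex_of_real (x $ j))"

lemma bilin_cvec: "bilin y (cvec x) = complex_of_real (x \<bullet> y)"
  by (simp add: bilin_def cvec_def inner_vec_def mult.commute)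

lemma bilin_smult: "bilin y (c *s s) = c * bilin y s"
  by (simp add: bilin_def sum_distrib_left mult_ac)

lemma lform_smult: "lform L (c *s s) = c * lform L s"
  by (simp add: lform_def sum_distrib_left mult_ac)

lemma qform_smult: "qform H (c *s s) = c\<^sup>2 * qform H s"
  by (simp add: qform_def sum_distrib_left power2_eq_square mult_ac)

lemma lform_bound: "cmod (lform L s) \<le> (\<Sum>j\<in>UNIV. cmod (L $ j)) * max_norm s"
proof -
  have "cmod (lform L s) \<le> (\<Sum>j\<in>UNIV. cmod (L $ j * s $ j))" unfolding lform_def by (rule norm_sum)
  also have "\<dots> \<le> (\<Sum>j\<in>UNIV. cmod (L $ j) * max_norm s)"
    by (intro sum_mono) (simp add: norm_mult mult_left_mono cmod_le_max_norm)
  finally show ?thesis by (simp add: sum_distrib_right)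
qed

lemma qform_bound: "cmod (qform H s) \<le> (\<Sum>j\<in>UNIV. \<Sum>k\<in>UNIV. cmod (H $ j $ k)) * (max_norm s)\<^sup>2"
proof -
  have "cmod (qform H s) \<le> (\<Sum>j\<in>UNIV. \<Sum>k\<in>UNIV. cmod (H $ j $ k * s $ j * s $ k))"
    unfolding qform_def by (rule order_trans[OF norm_sum sum_mono[OF norm_sum]])
  also have "\<dots> \<le> (\<Sum>j\<in>UNIV. \<Sum>k\<in>UNIV. cmod (H $ j $ k) * (max_norm s)\<^sup>2)"
  proof (intro sum_mono)
    fix j k
    have "cmod (s $ j) * cmod (s $ k) \<le> max_norm s * max_norm s" by (intro mult_mono cmod_le_max_norm) auto
    then show "cmod (H $ j $ k * s $ j * s $ k) \<le> cmod (H $ j $ k) * (max_norm s)\<^sup>2"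
      by (simp add: norm_mult mult.assoc power2_eq_square mult_left_mono)
  qed
  finally show ?thesis by (simp add: sum_distrib_right)
qed

text \<open>For each value of \<open>X\<close> the sum of the absolute values is \<open>sign_vec \<sigma> \<bullet> X\<close> for a suitable sign vector, so the
exponential is dominated by the sum over all sign vectors, whose exponential moments exist.\<close>

lemma integrable_exp_l1:
  fixes X :: "'a \<Rightarrow> real^'m"
  assumes X[measurable]: "X \<in> borel_measurable M" and r: "r > 0"
    and int: "\<And>s. max_norm s \<le> r \<Longrightarrow> integrable M (\<lambda>\<omega>. exp (bilin (X \<omega>) s))"
  shows "integrable M (\<lambda>\<omega>. exp (r * (\<Sum>j\<in>UNIV. \<bar>X \<omega> $ j\<bar>)))"
proof (rule Bochner_Integration.integrable_bound)
  have X': "(\<lambda>\<omega>. X \<omega> $ j) \<in> borel_measurable M" for j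
    by (rule measurable_compose[OF X]) (intro borel_measurable_continuous_onI continuous_intros)
  note [measurable] = X'
  show "integrable M (\<lambda>\<omega>. \<Sum>\<sigma>\<in>UNIV. exp (r * (sign_vec \<sigma> \<bullet> X \<omega>)))"
  proof (intro Bochner_Integration.integrable_sum)
    fix \<sigma> :: "'m \<Rightarrow> bool"
    have "max_norm (cvec (r *\<^sub>R sign_vec \<sigma>)) \<le> r" using r by (simp add: max_norm_le_iff cvec_def sign_vec_def)
    then have "integrable M (\<lambda>\<omega>. exp (bilin (X \<omega>) (cvec (r *\<^sub>R sign_vec \<sigma>))))" by (rule int)
    then have "integrable M (\<lambda>\<omega>. Re (exp (bilin (X \<omega>) (cvec (r *\<^sub>R sign_vec \<sigma>)))))" by (rule integrable_Re)
    then show "integrable M (\<lambda>\<omega>. exp (r * (sign_vec \<sigma> \<bullet> X \<omega>)))" by (simp add: bilin_cvec Re_exp)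
  qed
  show "(\<lambda>\<omega>. exp (r * (\<Sum>j\<in>UNIV. \<bar>X \<omega> $ j\<bar>))) \<in> borel_measurable M" by measurable
  show "AE \<omega> in M. norm (exp (r * (\<Sum>j\<in>UNIV. \<bar>X \<omega> $ j\<bar>))) \<le> norm (\<Sum>\<sigma>\<in>UNIV. exp (r * (sign_vec \<sigma> \<bullet> X \<omega>)))"
  proof (intro AE_I2)
    fix \<omega>
    let ?\<sigma> = "\<lambda>j. X \<omega> $ j \<ge> 0"
    have "(\<Sum>j\<in>UNIV. \<bar>X \<omega> $ j\<bar>) = sign_vec ?\<sigma> \<bullet> X \<omega>"
      unfolding inner_vec_def sign_vec_def by (intro sum.cong) auto
    moreover have "exp (r * (sign_vec ?\<sigma> \<bullet> X \<omega>)) \<le> (\<Sum>\<sigma>\<in>UNIV. exp (r * (sign_vec \<sigma> \<bullet> X \<omega>)))"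
      by (rule member_le_sum[where f="\<lambda>\<sigma>. exp (r * (sign_vec \<sigma> \<bullet> X \<omega>))"]) auto
    ultimately show "norm (exp (r * (\<Sum>j\<in>UNIV. \<bar>X \<omega> $ j\<bar>))) \<le> norm (\<Sum>\<sigma>\<in>UNIV. exp (r * (sign_vec \<sigma> \<bullet> X \<omega>)))"
      by (simp add: order_trans[OF _ abs_ge_self])
  qed
qed

text \<open>Expanding the exponential and integrating termwise gives a power series in \<open>l\<close>; the partial sums
are dominated by \<open>exp (r * \<parallel>X\<parallel>)\<close> with the sum norm.\<close>

lemma mgf_line_holomorphic:
  fixes X :: "'a \<Rightarrow> real^'m"
  assumes X[measurable]: "X \<in> borel_measurable M" and r: "r > 0"
    and int: "\<And>s. max_norm s \<le> r \<Longrightarrow> integrable M (\<lambda>\<omega>. exp (bilin (X \<omega>) s))"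
    and z: "max_norm z \<le> 1"
  shows "(\<lambda>l. mgf M X (l *s z)) holomorphic_on ball 0 r"
proof (rule power_series_holomorphic)
  fix w assume "w \<in> ball (0::complex) r"
  then have w: "cmod w < r" by simp
  let ?b = "\<lambda>\<omega>. bilin (X \<omega>) z"
  let ?S = "\<lambda>\<omega>. \<Sum>j\<in>UNIV. \<bar>X \<omega> $ j\<bar>"
  let ?f = "\<lambda>k \<omega>. (w * ?b \<omega>) ^ k /\<^sub>R fact k"
  \<comment> \<open>the expansion is dominated through \<open>\<bar>w * ?b\<bar> \<le> r * ?S\<close>\<close>
  have bm[measurable]: "?b \<in> borel_measurable M" by (rule measurable_compose[OF X measurable_bilin])
  have b: "cmod (?b \<omega>) \<le> ?S \<omega>" for \<omega>
  proof -
    have "cmod (?b \<omega>) \<le> (\<Sum>j\<in>UNIV. cmod (complex_of_real (X \<omega> $ j) * z $ j))" unfolding bilin_def by (rule norm_sum)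
    also have "\<dots> \<le> ?S \<omega>"
      using z by (intro sum_mono) (simp add: norm_mult max_norm_le_iff mult_left_le)
    finally show ?thesis .
  qed
  have E: "integrable M (\<lambda>\<omega>. exp (r * ?S \<omega>))" by (rule integrable_exp_l1[OF X r int])
  have wb: "cmod (w * ?b \<omega>) \<le> r * ?S \<omega>" for \<omega>
    unfolding norm_mult using w r b[of \<omega>] by (intro mult_mono) auto
  have partial_le: "(\<Sum>k<n. norm (?f k \<omega>)) \<le> exp (r * ?S \<omega>)" for n \<omega>
  proof -
    have "(\<Sum>k<n. norm (?f k \<omega>)) \<le> (\<Sum>k<n. (r * ?S \<omega>) ^ k /\<^sub>R fact k)"
      by (intro sum_mono) (auto simp: norm_power intro!: mult_left_mono power_mono wb)
    also have "\<dots> \<le> exp (r * ?S \<omega>)"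
      unfolding exp_def using r by (intro sum_le_suminf summable_exp_generic) (auto intro!: mult_nonneg_nonneg zero_le_power sum_nonneg)
    finally show ?thesis .
  qed
  have nf: "norm (?f k \<omega>) \<le> exp (r * ?S \<omega>)" for k \<omega>
  proof -
    have "norm (?f k \<omega>) \<le> (\<Sum>k<Suc k. norm (?f k \<omega>))" by (rule member_le_sum) auto
    then show ?thesis using partial_le[where n="Suc k" and \<omega>=\<omega>] by linarith
  qed
  have fi: "integrable M (?f k)" for k
    by (rule Bochner_Integration.integrable_bound[OF E]) (use nf in auto)
  have "(\<lambda>k. integral\<^sup>L M (?f k)) sums (CLINT \<omega>|M. (\<Sum>k. ?f k \<omega>))"
  proof (rule sums_integral[OF fi])
    show "AE \<omega> in M. summable (\<lambda>k. norm (?f k \<omega>))"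
      by (intro AE_I2 summableI_nonneg_bounded[OF _ partial_le]) simp
    show "summable (\<lambda>k. LINT \<omega>|M. norm (?f k \<omega>))"
    proof (rule summableI_nonneg_bounded)
      fix n
      have "(\<Sum>k<n. LINT \<omega>|M. norm (?f k \<omega>)) = (LINT \<omega>|M. (\<Sum>k<n. norm (?f k \<omega>)))"
        by (intro Bochner_Integration.integral_sum[symmetric] integrable_norm fi)
      also have "\<dots> \<le> (LINT \<omega>|M. exp (r * ?S \<omega>))"
        by (intro integral_mono Bochner_Integration.integrable_sum integrable_norm fi E partial_le)
      finally show "(\<Sum>k<n. LINT \<omega>|M. norm (?f k \<omega>)) \<le> (LINT \<omega>|M. exp (r * ?S \<omega>))" .
    qed simp
  qed
  moreover have "(CLINT \<omega>|M. (\<Sum>k. ?f k \<omega>)) = mgf M X (w *s z)"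
    unfolding mgf_def bilin_smult exp_def ..
  moreover have "integral\<^sup>L M (?f k) = (CLINT \<omega>|M. ?b \<omega> ^ k /\<^sub>R fact k) * (w - 0) ^ k" for k
  proof -
    have "?f k \<omega> = w ^ k * (?b \<omega> ^ k /\<^sub>R fact k)" for \<omega> by (simp add: power_mult_distrib)
    then show ?thesis by (simp only: integral_mult_right_zero) simp
  qed
  ultimately show "(\<lambda>k. (CLINT \<omega>|M. ?b \<omega> ^ k /\<^sub>R fact k) * (w - 0) ^ k) sums mgf M X (w *s z)" by simp
qed

text \<open>Along the line through \<open>s\<close> the quotient of both sides without \<open>\<zeta>\<close> is holomorphic and oscillates by
less than 2, so Schwarz's lemma bounds its deviation from the value at 0 linearly.\<close>

lemma mgf_Lipschitz_at_0:
  fixes X :: "'a \<Rightarrow> real^'m"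
  assumes M: "prob_space M" and X: "X \<in> borel_measurable M" and r: "r > 0"
    and int: "\<And>s. max_norm s \<le> r \<Longrightarrow> integrable M (\<lambda>\<omega>. exp (bilin (X \<omega>) s))"
    and hol: "\<And>z. max_norm z \<le> 1 \<Longrightarrow> (\<lambda>l. W (l *s z)) holomorphic_on ball 0 r"
    and near: "\<And>s. max_norm s \<le> r \<Longrightarrow> cmod (mgf M X s * exp (- W s) - 1) \<le> 1 / 2"
    and s: "max_norm s < r"
  shows "\<exists>\<zeta>. mgf M X s = exp (W s - W 0) * (1 + \<zeta>) \<and> cmod \<zeta> \<le> 4 / r * max_norm s"
proof (cases "max_norm s = 0")
  case True
  then have "s = 0" using cmod_le_max_norm[of s] by (simp add: vec_eq_iff)
  moreover have "mgf M X 0 = 1" by (simp add: mgf_def bilin_def prob_space.prob_space[OF M])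
  ultimately show ?thesis by (intro exI[of _ 0]) simp
next
  case False
  define a where "a = max_norm s"
  have a: "a > 0" "a < r" using False s max_norm_nonneg[of s] unfolding a_def by linarith+
  define z where "z = complex_of_real (1 / a) *s s"
  have z: "max_norm z \<le> 1"
    using max_norm_smult[of "complex_of_real (1 / a)" s] a by (simp add: z_def a_def norm_divide)
  have sz: "complex_of_real a *s z = s" using a by (simp add: z_def vec_eq_iff)
  define G where "G l = mgf M X (l *s z) * exp (- W (l *s z))" for l
  have lz: "max_norm (l *s z) \<le> r" if "cmod l < r" for l
  proof -
    have "max_norm (l *s z) \<le> cmod l * max_norm z" by (rule max_norm_smult)
    also have "\<dots> \<le> cmod l * 1" using z by (intro mult_left_mono) auto
    finally show ?thesis using that by simp
  qed
  have G1: "cmod (G l - 1) \<le> 1 / 2" if "cmod l < r" for l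
    unfolding G_def by (rule near[OF lz[OF that]])
  have Ghol: "G holomorphic_on ball 0 r"
    unfolding G_def by (intro holomorphic_intros mgf_line_holomorphic[OF X r int z] hol[OF z])
  \<comment> \<open>normalised to map the unit disc into itself and 0 to 0\<close>
  define f where "f w = (G (complex_of_real r * w) - G 0) / 2" for w
  have "cmod (f (complex_of_real (a / r))) \<le> cmod (complex_of_real (a / r))"
  proof (rule Schwarz_Lemma(1))
    have "(\<lambda>w. G (complex_of_real r * w)) holomorphic_on ball 0 1"
    proof (rule holomorphic_on_compose_gen[of "\<lambda>w. complex_of_real r * w" _ G "ball 0 r", unfolded o_def])
      show "(\<lambda>w. complex_of_real r * w) ` ball 0 1 \<subseteq> ball 0 r"
        using r by (auto simp: norm_mult)
    qed (auto intro!: holomorphic_intros Ghol)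
    then show "f holomorphic_on ball 0 1" unfolding f_def[abs_def] by (intro holomorphic_intros) auto
    show "f 0 = 0" by (simp add: f_def)
    show "cmod (f w) < 1" if "cmod w < 1" for w
    proof -
      have "cmod (complex_of_real r * w) < r" using that r by (simp add: norm_mult)
      then have "cmod (G (complex_of_real r * w) - 1) \<le> 1 / 2" "cmod (G 0 - 1) \<le> 1 / 2" using G1 r by auto
      then have "cmod (G (complex_of_real r * w) - G 0) \<le> 1"
        using norm_triangle_ineq4[of "G (complex_of_real r * w) - 1" "G 0 - 1"] by simp
      then show ?thesis by (simp add: f_def norm_divide)
    qed
    show "cmod (complex_of_real (a / r)) < 1" using a r by (simp add: norm_divide)
  qed
  moreover have "complex_of_real r * complex_of_real (a / r) = complex_of_real a" using r by simp
  ultimately have "cmod ((G (complex_of_real a) - G 0) / 2) \<le> cmod (complex_of_real (a / r))" unfolding f_def by simp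
  then have Ga: "cmod (G (complex_of_real a) - G 0) \<le> 2 * a / r" using a r by (simp add: norm_divide mult.commute)
  have z0: "(0::complex) *s z = 0" by (simp add: vec_eq_iff)
  have "mgf M X 0 = 1" by (simp add: mgf_def bilin_def prob_space.prob_space[OF M])
  then have G0: "G 0 = exp (- W 0)" unfolding G_def z0 by simp
  have "cmod (G 0 - 1) \<le> 1 / 2" using G1[of 0] r by simp
  then have G0n: "cmod (G 0) \<ge> 1 / 2" using norm_triangle_ineq2[of 1 "1 - G 0"] by (simp add: norm_minus_commute)
  define \<zeta> where "\<zeta> = (G (complex_of_real a) - G 0) / G 0"
  have "cmod \<zeta> \<le> (2 * a / r) / (1 / 2)"
    unfolding \<zeta>_def norm_divide using Ga G0n a r by (intro frac_le) auto
  then have 1: "cmod \<zeta> \<le> 4 / r * a" by simp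
  have "G (complex_of_real a) = G 0 * (1 + \<zeta>)" unfolding \<zeta>_def using G0 by (simp add: field_simps)
  then have "mgf M X s * exp (- W s) = exp (- W 0) * (1 + \<zeta>)" unfolding G_def[of "complex_of_real a"] sz G0 .
  then have "mgf M X s * exp (- W s) * exp (W s) = exp (- W 0) * (1 + \<zeta>) * exp (W s)" by simp
  then have "mgf M X s = exp (W s - W 0) * (1 + \<zeta>)"
    by (simp add: mult.assoc exp_minus_inverse exp_diff exp_minus field_simps)
  with 1 show ?thesis unfolding a_def by blast
qed

text \<open>Otherwise \<open>exp (t * w)\<close> is negative at \<open>t = pi / \<bar>Im w\<bar>\<close>.\<close>

lemma exp_ray_nonneg_imp_real:
  assumes "\<And>t. t \<ge> 0 \<Longrightarrow> Im (exp (complex_of_real t * w)) = 0 \<and> Re (exp (complex_of_real t * w)) \<ge> 0"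
  shows "Im w = 0"
proof (rule ccontr)
  assume w: "Im w \<noteq> 0"
  define t where "t = pi / \<bar>Im w\<bar>"
  have "t \<ge> 0" by (simp add: t_def)
  then have "Re (exp (complex_of_real t * w)) \<ge> 0" using assms by blast
  moreover have "cos (t * Im w) = -1"
    using w by (cases "Im w > 0") (auto simp: t_def abs_if)
  ultimately show False by (simp add: Re_exp)
qed


text \<open>The expansion of one moment generating function near the origin. Both error terms vanish there.\<close>

definition quasi_power_at :: "'a measure \<Rightarrow> ('a \<Rightarrow> real^'m) \<Rightarrow> real \<Rightarrow> complex^'m \<Rightarrow> complex^'m^'m \<Rightarrow> real \<Rightarrow> real \<Rightarrow> bool" where
  "quasi_power_at M X \<phi> L H r B \<longleftrightarrow> \<phi> \<ge> 1 \<and> (\<forall>z. max_norm z < r \<longrightarrow>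
      integrable M (\<lambda>\<omega>. exp (bilin (X \<omega>) z)) \<and>
      (\<exists>\<rho> \<zeta>. mgf M X z = exp (complex_of_real \<phi> * (lform L z + qform H z / 2) + \<rho>) * (1 + \<zeta>) \<and>
         cmod \<rho> \<le> B * (\<phi> * max_norm z ^ 3 + max_norm z) \<and> cmod \<zeta> \<le> B * max_norm z))"

lemma quasi_power_expansion:
  fixes P :: "nat \<Rightarrow> 'a measure" and \<Omega> :: "nat \<Rightarrow> 'a \<Rightarrow> real^'m"
    and \<phi> \<kappa> :: "nat \<Rightarrow> real"
  assumes prob: "\<And>n. n \<ge> 1 \<Longrightarrow> prob_space (P n)"
    and rv: "\<And>n. n \<ge> 1 \<Longrightarrow> \<Omega> n \<in> borel_measurable (P n)"
    and tau: "\<tau> > 0"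
    and mgf_asymp: "\<exists>C. \<forall>\<^sub>F n in sequentially. \<forall>s. max_norm s \<le> \<tau> \<longrightarrow>
          integrable (P n) (\<lambda>\<omega>. exp (bilin (\<Omega> n \<omega>) s)) \<and>
          (\<exists>\<epsilon>. mgf (P n) (\<Omega> n) s = exp (W n s) * (1 + \<epsilon>) \<and> cmod \<epsilon> \<le> C * \<bar>1 / \<kappa> n\<bar>)"
    and W: "\<And>n s. n \<ge> 1 \<Longrightarrow> max_norm s \<le> \<tau> \<Longrightarrow> W n s = u s * complex_of_real (\<phi> n) + v s"
    and u: "multi_analytic_at u 0" and v: "multi_analytic_at v 0"
    and phi: "filterlim \<phi> at_top sequentially"
    and kappa: "filterlim \<kappa> at_top sequentially"
  obtains r B where "r > 0" "B \<ge> 0" "transpose (hessian u 0) = hessian u 0"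
    "\<forall>\<^sub>F n in sequentially. quasi_power_at (P n) (\<Omega> n) (\<phi> n) (grad u 0) (hessian u 0) r B"
proof -
  obtain ru Bu au Lu Hu where U: "ru > 0" "Bu \<ge> 0" "transpose Hu = Hu"
    "\<And>z. max_norm z \<le> ru \<Longrightarrow> cmod (u z - (au + lform Lu z + qform Hu z / 2)) \<le> Bu * max_norm z ^ 3"
    "\<And>w d. (\<lambda>l. u (w + l *s d)) holomorphic_on {l. max_norm (w + l *s d) < ru}"
    by (rule multi_analytic_Taylor2[OF u]) blast
  obtain rv' Bv av Lv Hv where V: "rv' > 0" "Bv \<ge> 0" "transpose Hv = Hv"
    "\<And>z. max_norm z \<le> rv' \<Longrightarrow> cmod (v z - (av + lform Lv z + qform Hv z / 2)) \<le> Bv * max_norm z ^ 3"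
    "\<And>w d. (\<lambda>l. v (w + l *s d)) holomorphic_on {l. max_norm (w + l *s d) < rv'}"
    by (rule multi_analytic_Taylor2[OF v]) blast
  have gu: "grad u 0 = Lu" by (rule grad_hessian_Taylor2(1)[OF U(1-5)])
  have hu: "hessian u 0 = Hu" by (rule grad_hessian_Taylor2(2)[OF U(1-5)])
  have z0: "lform L 0 = 0" "qform H 0 = 0" for L :: "complex^'m" and H :: "complex^'m^'m" by (simp_all add: lform_def qform_def)
  have u0: "u 0 = au" using U(4)[of 0] U(1) by (simp add: z0)
  have v0: "v 0 = av" using V(4)[of 0] V(1) by (simp add: z0)
  \<comment> \<open>below the radii of both expansions and of the hypothesis; \<open>r \<le> 1\<close> lets higher powers of \<open>max_norm z\<close> be absorbed in the first\<close>
  define r where "r = Min {ru / 2, rv' / 2, \<tau> / 2, 1 / 2}"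
  have r: "r > 0" "r < ru" "r < rv'" "r < \<tau>" "r \<le> 1" using U(1) V(1) tau unfolding r_def by auto
  define Cv where "Cv = (\<Sum>j\<in>UNIV. cmod (Lv $ j)) + (\<Sum>j\<in>UNIV. \<Sum>k\<in>UNIV. cmod (Hv $ j $ k)) + Bv"
  have vb: "cmod (v z - v 0) \<le> Cv * max_norm z" if z: "max_norm z < r" for z
  proof -
    let ?t = "max_norm z"
    have t: "0 \<le> ?t" "?t \<le> 1" using z r by auto
    have t2: "?t\<^sup>2 \<le> ?t" and t3: "?t ^ 3 \<le> ?t"
      using t power_decreasing[of 1 2 ?t] power_decreasing[of 1 3 ?t] by auto
    have S: "(\<Sum>j\<in>UNIV. \<Sum>k\<in>UNIV. cmod (Hv $ j $ k)) \<ge> 0" by (intro sum_nonneg) auto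
    have 1: "cmod (v z - (av + lform Lv z + qform Hv z / 2)) \<le> Bv * ?t"
      using V(4)[of z] z r t3 V(2) by (intro order_trans[OF V(4)] mult_left_mono) auto
    have 2: "cmod (lform Lv z) \<le> (\<Sum>j\<in>UNIV. cmod (Lv $ j)) * ?t" by (rule lform_bound)
    have "cmod (qform Hv z / 2) \<le> cmod (qform Hv z)" by (simp add: norm_divide)
    also have "\<dots> \<le> (\<Sum>j\<in>UNIV. \<Sum>k\<in>UNIV. cmod (Hv $ j $ k)) * ?t\<^sup>2" by (rule qform_bound)
    also have "\<dots> \<le> (\<Sum>j\<in>UNIV. \<Sum>k\<in>UNIV. cmod (Hv $ j $ k)) * ?t" using t2 S by (intro mult_left_mono)
    finally have 3: "cmod (qform Hv z / 2) \<le> (\<Sum>j\<in>UNIV. \<Sum>k\<in>UNIV. cmod (Hv $ j $ k)) * ?t" .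
    have "v z - v 0 = (v z - (av + lform Lv z + qform Hv z / 2)) + lform Lv z + qform Hv z / 2" by (simp add: v0)
    also have "cmod \<dots> \<le> Bv * ?t + (\<Sum>j\<in>UNIV. cmod (Lv $ j)) * ?t + (\<Sum>j\<in>UNIV. \<Sum>k\<in>UNIV. cmod (Hv $ j $ k)) * ?t"
      by (intro order_trans[OF norm_triangle_ineq] add_mono 1 2 3)
    finally show ?thesis by (simp add: Cv_def algebra_simps)
  qed
  define B where "B = Bu + \<bar>Cv\<bar> + 4 / r"
  have B: "B \<ge> 0" "Bu \<le> B" "Cv \<le> B" "4 / r \<le> B"
  proof -
    have "4 / r \<ge> 0" using r by simp
    then show "B \<ge> 0" "Bu \<le> B" "Cv \<le> B" "4 / r \<le> B" using U(2) unfolding B_def by linarith+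
  qed
  have line: "(\<lambda>l. g (l *s z)) holomorphic_on ball 0 r"
    if g: "\<And>w d. (\<lambda>l. g (w + l *s d)) holomorphic_on {l. max_norm (w + l *s d) < rg}" and "r < rg" and z: "max_norm z \<le> 1"
    for g :: "complex^'m \<Rightarrow> complex" and rg z
  proof (rule holomorphic_on_subset)
    show "(\<lambda>l. g (l *s z)) holomorphic_on {l. max_norm (l *s z) < rg}" using g[of 0 z] by simp
    show "ball 0 r \<subseteq> {l. max_norm (l *s z) < rg}"
    proof
      fix l :: complex assume l: "l \<in> ball 0 r"
      have "max_norm (l *s z) \<le> cmod l * max_norm z" by (rule max_norm_smult)
      also have "\<dots> \<le> cmod l * 1" using z by (intro mult_left_mono) auto
      finally show "l \<in> {l. max_norm (l *s z) < rg}" using l \<open>r < rg\<close> by simp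
    qed
  qed
  obtain C where C: "\<forall>\<^sub>F n in sequentially. \<forall>s. max_norm s \<le> \<tau> \<longrightarrow>
          integrable (P n) (\<lambda>\<omega>. exp (bilin (\<Omega> n \<omega>) s)) \<and>
          (\<exists>\<epsilon>. mgf (P n) (\<Omega> n) s = exp (W n s) * (1 + \<epsilon>) \<and> cmod \<epsilon> \<le> C * \<bar>1 / \<kappa> n\<bar>)"
    using mgf_asymp by blast
  have "((\<lambda>n. C * \<bar>1 / \<kappa> n\<bar>) \<longlongrightarrow> C * \<bar>0\<bar>) sequentially"
    by (intro tendsto_intros real_tendsto_divide_at_top[OF tendsto_const kappa])
  then have "\<forall>\<^sub>F n in sequentially. C * \<bar>1 / \<kappa> n\<bar> < 1 / 2"
    by (intro order_tendstoD(2)) auto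
  moreover have "\<forall>\<^sub>F n in sequentially. \<phi> n \<ge> 1"
    using phi by (simp add: filterlim_at_top)
  moreover have "\<forall>\<^sub>F n in sequentially. n \<ge> (1::nat)" by (rule eventually_ge_at_top)
  ultimately have ev: "\<forall>\<^sub>F n in sequentially. quasi_power_at (P n) (\<Omega> n) (\<phi> n) Lu Hu r B"
    using C
  proof eventually_elim
    case (elim n)
    have n: "n \<ge> 1" and \<phi>: "\<phi> n \<ge> 1" and k: "C * \<bar>1 / \<kappa> n\<bar> < 1 / 2" using elim by auto
    define Wn where "Wn s = u s * complex_of_real (\<phi> n) + v s" for s
    have int: "integrable (P n) (\<lambda>\<omega>. exp (bilin (\<Omega> n \<omega>) s))" if "max_norm s \<le> r" for s
      using elim(4) that r by auto
    have near: "cmod (mgf (P n) (\<Omega> n) s * exp (- Wn s) - 1) \<le> 1 / 2" if s: "max_norm s \<le> r" for s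
    proof -
      have st: "max_norm s \<le> \<tau>" using s r by simp
      then obtain \<epsilon> where e: "mgf (P n) (\<Omega> n) s = exp (W n s) * (1 + \<epsilon>)" "cmod \<epsilon> \<le> C * \<bar>1 / \<kappa> n\<bar>"
        using elim(4) by blast
      have "W n s = Wn s" unfolding Wn_def by (rule W[OF n st])
      then have "mgf (P n) (\<Omega> n) s * exp (- Wn s) = 1 + \<epsilon>"
        unfolding e(1) by (simp add: exp_minus)
      then have "mgf (P n) (\<Omega> n) s * exp (- Wn s) - 1 = \<epsilon>" by simp
      moreover have "cmod \<epsilon> \<le> 1 / 2" using e(2) k by linarith
      ultimately show ?thesis by simp
    qed
    have hol: "(\<lambda>l. Wn (l *s z)) holomorphic_on ball 0 r" if "max_norm z \<le> 1" for z
      unfolding Wn_def by (intro holomorphic_intros line[OF U(5) r(2) that] line[OF V(5) r(3) that])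
    have "\<exists>\<rho> \<zeta>. mgf (P n) (\<Omega> n) z = exp (\<phi> n * (lform Lu z + qform Hu z / 2) + \<rho>) * (1 + \<zeta>) \<and>
         cmod \<rho> \<le> B * (\<phi> n * max_norm z ^ 3 + max_norm z) \<and> cmod \<zeta> \<le> B * max_norm z" if z: "max_norm z < r" for z
    proof -
      let ?t = "max_norm z"
      obtain \<zeta> where \<zeta>: "mgf (P n) (\<Omega> n) z = exp (Wn z - Wn 0) * (1 + \<zeta>)" "cmod \<zeta> \<le> 4 / r * ?t"
        using mgf_Lipschitz_at_0[OF prob[OF n] rv[OF n] r(1) int hol near z] by blast
      define \<rho> where "\<rho> = complex_of_real (\<phi> n) * (u z - (au + lform Lu z + qform Hu z / 2)) + (v z - v 0)"
      have "Wn z - Wn 0 = \<phi> n * (lform Lu z + qform Hu z / 2) + \<rho>"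
        by (simp add: Wn_def \<rho>_def u0 algebra_simps)
      moreover have "cmod \<rho> \<le> B * (\<phi> n * ?t ^ 3 + ?t)"
      proof -
        have "cmod \<rho> \<le> \<phi> n * cmod (u z - (au + lform Lu z + qform Hu z / 2)) + cmod (v z - v 0)"
          unfolding \<rho>_def using \<phi> by (intro order_trans[OF norm_triangle_ineq]) (simp add: norm_mult)
        also have "\<dots> \<le> \<phi> n * (Bu * ?t ^ 3) + Cv * ?t"
          using \<phi> z r by (intro add_mono mult_left_mono U(4) vb) auto
        also have "\<dots> \<le> \<phi> n * (B * ?t ^ 3) + B * ?t"
          using \<phi> B by (intro add_mono mult_left_mono mult_right_mono) auto
        finally show ?thesis by (simp add: algebra_simps)
      qed
      moreover have "cmod \<zeta> \<le> B * ?t" using \<zeta>(2) B(4) mult_right_mono[of "4 / r" B ?t] by simp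
      ultimately show ?thesis using \<zeta>(1) by (intro exI[of _ \<rho>] exI[of _ \<zeta>]) simp
    qed
    then show ?case unfolding quasi_power_at_def using \<phi> int by (simp add: less_imp_le)
  qed
  show ?thesis
    by (rule that[OF r(1) B(1)]) (use U(3) ev in \<open>simp_all add: gu hu\<close>)
qed

section \<open>Limits of quasi-powers\<close>

lemma mgf_cvec: "mgf M X (cvec x) = complex_of_real (LINT \<omega>|M. exp (x \<bullet> X \<omega>))"
  unfolding mgf_def bilin_cvec exp_of_real by simp

lemma qform_cvec: "qform (map_matrix complex_of_real S) (cvec x) = complex_of_real (x \<bullet> (S *v x))"
  by (simp add: qform_def cvec_def map_matrix_def inner_vec_def matrix_vector_mult_def sum_distrib_left mult_ac)

lemma lform_cvec: "lform (cvec \<mu>) s = bilin \<mu> s"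
  by (simp add: lform_def cvec_def bilin_def)

text \<open>The arguments \<open>z n\<close> tend to 0 fast enough for both error terms to vanish; \<open>E n\<close> is a centring
term.\<close>

lemma quasi_power_limit:
  assumes ev: "\<forall>\<^sub>F n in sequentially. quasi_power_at (P n) (\<Omega> n) (\<phi> n) L H r B" and r: "r > 0"
    and z: "(\<lambda>n. max_norm (z n)) \<longlonglongrightarrow> 0" and z3: "(\<lambda>n. \<phi> n * max_norm (z n) ^ 3) \<longlonglongrightarrow> 0"
    and w: "(\<lambda>n. complex_of_real (\<phi> n) * (lform L (z n) + qform H (z n) / 2) - E n) \<longlonglongrightarrow> w"
  shows "(\<lambda>n. exp (- E n) * mgf (P n) (\<Omega> n) (z n)) \<longlonglongrightarrow> exp w"
proof -
  have "\<forall>\<^sub>F n in sequentially. max_norm (z n) < r" using z r by (rule order_tendstoD(2))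
  with ev have ev': "\<forall>\<^sub>F n in sequentially. \<exists>\<rho> \<zeta>. mgf (P n) (\<Omega> n) (z n)
      = exp (complex_of_real (\<phi> n) * (lform L (z n) + qform H (z n) / 2) + \<rho>) * (1 + \<zeta>) \<and>
       cmod \<rho> \<le> B * (\<phi> n * max_norm (z n) ^ 3 + max_norm (z n)) \<and> cmod \<zeta> \<le> B * max_norm (z n)"
    by eventually_elim (auto simp: quasi_power_at_def)
  define Q where "Q n \<rho> \<zeta> \<longleftrightarrow> mgf (P n) (\<Omega> n) (z n)
      = exp (complex_of_real (\<phi> n) * (lform L (z n) + qform H (z n) / 2) + \<rho>) * (1 + \<zeta>) \<and>
       cmod \<rho> \<le> B * (\<phi> n * max_norm (z n) ^ 3 + max_norm (z n)) \<and> cmod \<zeta> \<le> B * max_norm (z n)" for n \<rho> \<zeta>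
  \<comment> \<open>a simultaneous choice of the two error terms for all \<open>n\<close>\<close>
  define pr where "pr n = (SOME p. Q n (fst p) (snd p))" for n
  have Q: "\<forall>\<^sub>F n in sequentially. Q n (fst (pr n)) (snd (pr n))"
    using ev'
  proof eventually_elim
    case (elim n)
    then have "\<exists>p. Q n (fst p) (snd p)" unfolding Q_def by simp
    then show ?case unfolding pr_def by (rule someI_ex)
  qed
  have b0: "(\<lambda>n. B * (\<phi> n * max_norm (z n) ^ 3 + max_norm (z n))) \<longlonglongrightarrow> B * (0 + 0)" by (intro tendsto_intros z z3)
  have b1: "(\<lambda>n. B * max_norm (z n)) \<longlonglongrightarrow> B * 0" by (intro tendsto_intros z)
  have \<rho>: "(\<lambda>n. fst (pr n)) \<longlonglongrightarrow> 0"
    by (rule Lim_null_comparison[OF _ b0[simplified]]) (use Q in \<open>eventually_elim, simp add: Q_def\<close>)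
  have \<zeta>: "(\<lambda>n. snd (pr n)) \<longlonglongrightarrow> 0"
    by (rule Lim_null_comparison[OF _ b1[simplified]]) (use Q in \<open>eventually_elim, simp add: Q_def\<close>)
  have "(\<lambda>n. exp ((complex_of_real (\<phi> n) * (lform L (z n) + qform H (z n) / 2) - E n) + fst (pr n)) * (1 + snd (pr n))) \<longlonglongrightarrow> exp (w + 0) * (1 + 0)"
    by (intro tendsto_intros w \<rho> \<zeta>)
  moreover have "\<forall>\<^sub>F n in sequentially. exp ((complex_of_real (\<phi> n) * (lform L (z n) + qform H (z n) / 2) - E n) + fst (pr n)) * (1 + snd (pr n))
      = exp (- E n) * mgf (P n) (\<Omega> n) (z n)"
    using Q
  proof eventually_elim
    case (elim n)
    then have m: "mgf (P n) (\<Omega> n) (z n) = exp (complex_of_real (\<phi> n) * (lform L (z n) + qform H (z n) / 2) + fst (pr n)) * (1 + snd (pr n))"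
      unfolding Q_def by blast
    show ?case unfolding m mult.assoc[symmetric] exp_add[symmetric] by (simp add: algebra_simps)
  qed
  ultimately show ?thesis using Lim_transform_eventually by fastforce
qed

lemma limit_exp_ray_real:
  assumes lim: "\<And>t::real. t \<ge> 0 \<Longrightarrow> (\<lambda>n. complex_of_real (a t n)) \<longlonglongrightarrow> exp (complex_of_real t * w)"
    and nn: "\<And>t n. 0 \<le> a t n"
  shows "Im w = 0"
proof (rule exp_ray_nonneg_imp_real)
  fix t :: real assume t: "t \<ge> 0"
  have "(\<lambda>n. Im (complex_of_real (a t n))) \<longlonglongrightarrow> Im (exp (complex_of_real t * w))" by (intro tendsto_Im lim[OF t])
  then have 1: "Im (exp (complex_of_real t * w)) = 0" by (simp add: LIMSEQ_const_iff)
  have "(\<lambda>n. Re (complex_of_real (a t n))) \<longlonglongrightarrow> Re (exp (complex_of_real t * w))" by (intro tendsto_Re lim[OF t])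
  then have "0 \<le> Re (exp (complex_of_real t * w))" by (rule LIMSEQ_le_const) (simp add: nn)
  with 1 show "Im (exp (complex_of_real t * w)) = 0 \<and> Re (exp (complex_of_real t * w)) \<ge> 0" by simp
qed

lemma cvec_scaleR: "cvec (a *\<^sub>R x) = complex_of_real a *s cvec x"
  by (simp add: cvec_def vec_eq_iff)

text \<open>At the arguments \<open>(t / \<phi> n) x\<close> the quadratic term is negligible and the limit is
\<open>exp (t L x)\<close>. For real \<open>x\<close> it is a limit of nonnegative numbers for every \<open>t \<ge> 0\<close>.\<close>

lemma quasi_power_grad_real:
  assumes ev: "\<forall>\<^sub>F n in sequentially. quasi_power_at (P n) (\<Omega> n) (\<phi> n) L H r B" and r: "r > 0"
    and phi: "filterlim \<phi> at_top sequentially"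
  shows "\<exists>\<mu>. L = cvec \<mu>"
proof -
  have "Im (L $ j) = 0" for j
  proof -
    let ?x = "axis j 1 :: real^'b"
    have lx: "lform L (cvec ?x) = L $ j"
    proof -
      have "cvec ?x = axis j 1" by (simp add: cvec_def axis_def vec_eq_iff)
      then show ?thesis using lform_axis_add[of L j 0 j 1] by (simp add: lform_def axis_def if_distrib cong: if_cong)
    qed
    have p1: "(\<lambda>n. c / \<phi> n) \<longlonglongrightarrow> 0" for c :: real
      by (rule real_tendsto_divide_at_top[OF tendsto_const phi])
    have "Im (lform L (cvec ?x)) = 0"
    proof (rule limit_exp_ray_real)
      fix t :: real assume t: "t \<ge> 0"
      let ?z = "\<lambda>n. complex_of_real (t / \<phi> n) *s cvec ?x"
      have "(\<lambda>n. exp (- 0) * mgf (P n) (\<Omega> n) (?z n)) \<longlonglongrightarrow> exp (complex_of_real t * lform L (cvec ?x))"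
      proof (rule quasi_power_limit[OF ev r])
        let ?m = "max_norm (cvec ?x)"
        have mz: "max_norm (?z n) \<le> \<bar>t / \<phi> n\<bar> * ?m" for n
          using max_norm_smult[of "complex_of_real (t / \<phi> n)" "cvec ?x"] by (simp only: norm_of_real)
        have c: "(\<lambda>n. \<bar>t / \<phi> n\<bar> * ?m) \<longlonglongrightarrow> \<bar>0\<bar> * ?m" by (intro tendsto_intros p1)
        show "(\<lambda>n. max_norm (?z n)) \<longlonglongrightarrow> 0"
          by (rule Lim_null_comparison[OF _ c[simplified abs_zero mult_zero_left]]) (use mz in simp)
        have "(\<lambda>n. \<bar>t\<bar> * ?m * (\<bar>t / \<phi> n\<bar> * ?m)\<^sup>2) \<longlonglongrightarrow> \<bar>t\<bar> * ?m * (\<bar>0\<bar> * ?m)\<^sup>2" by (intro tendsto_intros p1)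
        then have c3: "(\<lambda>n. \<bar>t\<bar> * ?m * (\<bar>t / \<phi> n\<bar> * ?m)\<^sup>2) \<longlonglongrightarrow> 0" by simp
        have "\<forall>\<^sub>F n in sequentially. \<phi> n \<ge> 1" using ev by eventually_elim (simp add: quasi_power_at_def)
        then have "\<forall>\<^sub>F n in sequentially. norm (\<phi> n * max_norm (?z n) ^ 3) \<le> \<bar>t\<bar> * ?m * (\<bar>t / \<phi> n\<bar> * ?m)\<^sup>2"
        proof eventually_elim
          case (elim n)
          have "\<phi> n * max_norm (?z n) ^ 3 \<le> \<phi> n * (\<bar>t / \<phi> n\<bar> * ?m) ^ 3"
            using elim by (intro mult_left_mono power_mono mz) auto
          also have "\<dots> = (\<phi> n * \<bar>t / \<phi> n\<bar>) * ?m * (\<bar>t / \<phi> n\<bar> * ?m)\<^sup>2"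
            by (simp only: power3_eq_cube power2_eq_square mult_ac)
          also have "\<phi> n * \<bar>t / \<phi> n\<bar> = \<bar>t\<bar>" using elim by (simp add: abs_divide)
          finally show ?case using elim by simp
        qed
        then show "(\<lambda>n. \<phi> n * max_norm (?z n) ^ 3) \<longlonglongrightarrow> 0" by (rule Lim_null_comparison[OF _ c3])
        have pc: "(\<lambda>n. complex_of_real (t\<^sup>2 / \<phi> n)) \<longlonglongrightarrow> complex_of_real 0" by (intro tendsto_of_real p1)
        have "(\<lambda>n. complex_of_real t * lform L (cvec ?x) + complex_of_real (t\<^sup>2 / \<phi> n) * (qform H (cvec ?x) / 2) - 0)
           \<longlonglongrightarrow> complex_of_real t * lform L (cvec ?x) + complex_of_real 0 * (qform H (cvec ?x) / 2) - 0"
          by (intro tendsto_intros pc)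
        then have l: "(\<lambda>n. complex_of_real t * lform L (cvec ?x) + complex_of_real (t\<^sup>2 / \<phi> n) * (qform H (cvec ?x) / 2) - 0)
           \<longlonglongrightarrow> complex_of_real t * lform L (cvec ?x)" by simp
        have "\<forall>\<^sub>F n in sequentially. \<phi> n \<ge> 1" using ev by eventually_elim (simp add: quasi_power_at_def)
        then have "\<forall>\<^sub>F n in sequentially. complex_of_real t * lform L (cvec ?x) + complex_of_real (t\<^sup>2 / \<phi> n) * (qform H (cvec ?x) / 2) - 0
            = complex_of_real (\<phi> n) * (lform L (?z n) + qform H (?z n) / 2) - 0"
          by eventually_elim (simp add: lform_smult qform_smult power2_eq_square field_simps)
        with l show "(\<lambda>n. complex_of_real (\<phi> n) * (lform L (?z n) + qform H (?z n) / 2) - 0) \<longlonglongrightarrow> complex_of_real t * lform L (cvec ?x)"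
          by (rule Lim_transform_eventually)
      qed
      then show "(\<lambda>n. complex_of_real (LINT \<omega>|P n. exp (((t / \<phi> n) *\<^sub>R ?x) \<bullet> \<Omega> n \<omega>))) \<longlonglongrightarrow> exp (complex_of_real t * lform L (cvec ?x))"
        unfolding mgf_cvec[symmetric] cvec_scaleR by simp
    qed simp
    then show ?thesis by (simp add: lx)
  qed
  then have "L = cvec (\<chi> j. Re (L $ j))" by (simp add: cvec_def vec_eq_iff complex_eq_iff)
  then show ?thesis by blast
qed

lemma mgf_standardized:
  assumes "\<phi> > 0"
  shows "mgf M (\<lambda>\<omega>. (X \<omega> - \<phi> *\<^sub>R \<mu>) /\<^sub>R sqrt \<phi>) s
    = exp (- (complex_of_real (sqrt \<phi>) * bilin \<mu> s)) * mgf M X (complex_of_real (1 / sqrt \<phi>) *s s)"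
    and "integrable M (\<lambda>\<omega>. exp (bilin (X \<omega>) (complex_of_real (1 / sqrt \<phi>) *s s))) \<Longrightarrow>
      integrable M (\<lambda>\<omega>. exp (bilin ((X \<omega> - \<phi> *\<^sub>R \<mu>) /\<^sub>R sqrt \<phi>) s))"
proof -
  have "\<phi> / sqrt \<phi> = sqrt \<phi>" by (rule real_div_sqrt) (use assms in simp)
  then have sq: "complex_of_real \<phi> * complex_of_real (1 / sqrt \<phi>) = complex_of_real (sqrt \<phi>)"
    by (metis of_real_mult times_divide_eq_right mult_1_right)
  have e: "bilin ((x - \<phi> *\<^sub>R \<mu>) /\<^sub>R sqrt \<phi>) s = - (complex_of_real (sqrt \<phi>) * bilin \<mu> s) + bilin x (complex_of_real (1 / sqrt \<phi>) *s s)" for x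
  proof -
    have "bilin ((x - \<phi> *\<^sub>R \<mu>) /\<^sub>R sqrt \<phi>) s = bilin x (complex_of_real (1 / sqrt \<phi>) *s s) - (complex_of_real \<phi> * complex_of_real (1 / sqrt \<phi>)) * bilin \<mu> s"
      by (simp add: bilin_def sum_distrib_left sum_subtractf[symmetric] field_simps)
    then show ?thesis unfolding sq by simp
  qed
  show "mgf M (\<lambda>\<omega>. (X \<omega> - \<phi> *\<^sub>R \<mu>) /\<^sub>R sqrt \<phi>) s
    = exp (- (complex_of_real (sqrt \<phi>) * bilin \<mu> s)) * mgf M X (complex_of_real (1 / sqrt \<phi>) *s s)"
    unfolding mgf_def e exp_add by (rule integral_mult_right_zero)
  show "integrable M (\<lambda>\<omega>. exp (bilin ((X \<omega> - \<phi> *\<^sub>R \<mu>) /\<^sub>R sqrt \<phi>) s))"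
    if "integrable M (\<lambda>\<omega>. exp (bilin (X \<omega>) (complex_of_real (1 / sqrt \<phi>) *s s)))"
    unfolding e exp_add using that by (rule integrable_mult_right)
qed

text \<open>At the arguments \<open>s / sqrt (\<phi> n)\<close> the quadratic term is \<open>qform H s / 2\<close> for every \<open>n\<close>, and
centring by \<open>\<phi> n *\<^sub>R \<mu>\<close> cancels the linear term.\<close>

lemma quasi_power_mgf_limit:
  assumes ev: "\<forall>\<^sub>F n in sequentially. quasi_power_at (P n) (\<Omega> n) (\<phi> n) (cvec \<mu>) H r B" and r: "r > 0"
    and phi: "filterlim \<phi> at_top sequentially"
  shows "(\<lambda>n. mgf (P n) (\<lambda>\<omega>. (\<Omega> n \<omega> - \<phi> n *\<^sub>R \<mu>) /\<^sub>R sqrt (\<phi> n)) s) \<longlonglongrightarrow> exp (qform H s / 2)"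
proof -
  let ?z = "\<lambda>n. complex_of_real (1 / sqrt (\<phi> n)) *s s"
  let ?E = "\<lambda>n. complex_of_real (sqrt (\<phi> n)) * bilin \<mu> s"
  have ph1: "\<forall>\<^sub>F n in sequentially. \<phi> n \<ge> 1" using ev by eventually_elim (simp add: quasi_power_at_def)
  have sq: "filterlim (\<lambda>n. sqrt (\<phi> n)) at_top sequentially"
    by (rule filterlim_compose[OF sqrt_at_top phi])
  have p1: "(\<lambda>n. c / sqrt (\<phi> n)) \<longlonglongrightarrow> 0" for c :: real
    by (rule real_tendsto_divide_at_top[OF tendsto_const sq])
  have mz: "max_norm (?z n) \<le> \<bar>1 / sqrt (\<phi> n)\<bar> * max_norm s" for n
    using max_norm_smult[of "complex_of_real (1 / sqrt (\<phi> n))" s] by (simp only: norm_of_real)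
  have c: "(\<lambda>n. \<bar>1 / sqrt (\<phi> n)\<bar> * max_norm s) \<longlonglongrightarrow> \<bar>0\<bar> * max_norm s" by (intro tendsto_intros p1)
  have "(\<lambda>n. exp (- ?E n) * mgf (P n) (\<Omega> n) (?z n)) \<longlonglongrightarrow> exp (qform H s / 2)"
  proof (rule quasi_power_limit[OF ev r])
    show "(\<lambda>n. max_norm (?z n)) \<longlonglongrightarrow> 0"
      by (rule Lim_null_comparison[OF _ c[simplified abs_zero mult_zero_left]]) (use mz in simp)
    have "\<forall>\<^sub>F n in sequentially. norm (\<phi> n * max_norm (?z n) ^ 3) \<le> max_norm s ^ 3 / sqrt (\<phi> n)"
      using ph1
    proof eventually_elim
      case (elim n)
      have "\<phi> n * max_norm (?z n) ^ 3 \<le> \<phi> n * (\<bar>1 / sqrt (\<phi> n)\<bar> * max_norm s) ^ 3"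
        using elim by (intro mult_left_mono power_mono mz) auto
      also have "\<dots> = \<phi> n / sqrt (\<phi> n) ^ 2 * (max_norm s ^ 3 / sqrt (\<phi> n))"
        using elim by (simp add: power_mult_distrib power_divide power3_eq_cube power2_eq_square)
      also have "\<phi> n / sqrt (\<phi> n) ^ 2 = 1" using elim by simp
      finally show ?case using elim by simp
    qed
    then show "(\<lambda>n. \<phi> n * max_norm (?z n) ^ 3) \<longlonglongrightarrow> 0" by (rule Lim_null_comparison[OF _ p1])
    have "\<forall>\<^sub>F n in sequentially. qform H s / 2 = complex_of_real (\<phi> n) * (lform (cvec \<mu>) (?z n) + qform H (?z n) / 2) - ?E n"
      using ph1
    proof eventually_elim
      case (elim n)
      have a: "complex_of_real (\<phi> n) = complex_of_real (sqrt (\<phi> n)) * complex_of_real (sqrt (\<phi> n))"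
        using elim by (simp flip: of_real_mult)
      have b: "complex_of_real (sqrt (\<phi> n)) \<noteq> 0" using elim by simp
      show ?case unfolding lform_smult qform_smult lform_cvec a using b by (simp add: power2_eq_square field_simps)
    qed
    then show "(\<lambda>n. complex_of_real (\<phi> n) * (lform (cvec \<mu>) (?z n) + qform H (?z n) / 2) - ?E n) \<longlonglongrightarrow> qform H s / 2"
      by (rule Lim_transform_eventually[OF tendsto_const])
  qed
  moreover have "\<forall>\<^sub>F n in sequentially. exp (- ?E n) * mgf (P n) (\<Omega> n) (?z n) = mgf (P n) (\<lambda>\<omega>. (\<Omega> n \<omega> - \<phi> n *\<^sub>R \<mu>) /\<^sub>R sqrt (\<phi> n)) s"
    using ph1 by eventually_elim (simp add: mgf_standardized)
  ultimately show ?thesis by (rule Lim_transform_eventually)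
qed

text \<open>The limit at \<open>sqrt (2 t) x\<close> is \<open>exp (t (H x))\<close>, which forces real values as for the gradient, and
polarisation passes from the quadratic form to the entries. At \<open>\<i> x\<close> the transforms are bounded
by 1, hence so is the limit \<open>exp (- H x / 2)\<close>.\<close>

lemma quasi_power_hessian_psd:
  assumes ev: "\<forall>\<^sub>F n in sequentially. quasi_power_at (P n) (\<Omega> n) (\<phi> n) (cvec \<mu>) H r B" and r: "r > 0"
    and phi: "filterlim \<phi> at_top sequentially" and H: "transpose H = H"
    and prob: "\<forall>\<^sub>F n in sequentially. prob_space (P n)"
  shows "\<exists>\<Sigma>. H = map_matrix complex_of_real \<Sigma> \<and> pos_semidef \<Sigma>"
proof -
  let ?X = "\<lambda>n \<omega>. (\<Omega> n \<omega> - \<phi> n *\<^sub>R \<mu>) /\<^sub>R sqrt (\<phi> n)"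
  have lim: "(\<lambda>n. mgf (P n) (?X n) s) \<longlonglongrightarrow> exp (qform H s / 2)" for s
    by (rule quasi_power_mgf_limit[OF ev r phi])
  have im: "Im (qform H (cvec x)) = 0" for x
  proof (rule limit_exp_ray_real)
    fix t :: real assume t: "t \<ge> 0"
    have "qform H (cvec (sqrt (2 * t) *\<^sub>R x)) / 2 = complex_of_real t * qform H (cvec x)"
    proof -
      have "(complex_of_real (sqrt (2 * t)))\<^sup>2 = complex_of_real (2 * t)"
        using t by (simp flip: of_real_power)
      then show ?thesis by (simp add: cvec_scaleR qform_smult)
    qed
    then show "(\<lambda>n. complex_of_real (LINT \<omega>|P n. exp ((sqrt (2 * t) *\<^sub>R x) \<bullet> ?X n \<omega>))) \<longlonglongrightarrow> exp (complex_of_real t * qform H (cvec x))"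
      using lim[of "cvec (sqrt (2 * t) *\<^sub>R x)"] unfolding mgf_cvec by simp
  qed simp
  have re: "Re (qform H (cvec x)) \<ge> 0" for x
  proof -
    have "cmod (exp (qform H (\<i> *s cvec x) / 2)) \<le> 1"
    proof (rule LIMSEQ_le_const2[OF tendsto_norm[OF lim]])
      obtain N where N: "\<And>n. n \<ge> N \<Longrightarrow> prob_space (P n)" using prob unfolding eventually_sequentially by blast
      have "cmod (mgf (P n) (?X n) (\<i> *s cvec x)) \<le> 1" if "n \<ge> N" for n
      proof -
        interpret prob_space "P n" by (rule N[OF that])
        have "cmod (mgf (P n) (?X n) (\<i> *s cvec x)) \<le> (LINT \<omega>|P n. cmod (exp (bilin (?X n \<omega>) (\<i> *s cvec x))))"
          unfolding mgf_def by (rule integral_norm_bound)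
        also have "\<dots> = 1" unfolding bilin_smult bilin_cvec by (simp add: prob_space)
        finally show ?thesis .
      qed
      then show "\<exists>N. \<forall>n\<ge>N. cmod (mgf (P n) (?X n) (\<i> *s cvec x)) \<le> 1" by blast
    qed
    then show ?thesis by (simp add: qform_smult)
  qed
  have cax: "cvec (axis j 1) = axis j 1" for j :: 'b by (simp add: cvec_def axis_def vec_eq_iff)
  have cadd: "cvec (x + y) = cvec x + cvec y" for x y :: "real^'b" by (simp add: cvec_def vec_eq_iff)
  have d: "qform H (axis j 1) = H $ j $ j" for j
  proof -
    have ax: "axis j 0 = (0 :: complex^'b)" by (simp add: axis_def vec_eq_iff)
    show ?thesis using qform_axis_add[OF H, of j 1 j 0] by (simp add: ax)
  qed
  have Hjj: "Im (H $ j $ j) = 0" for j using im[of "axis j 1"] unfolding cax d .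
  have "Im (H $ j $ k) = 0" for j k
    using im[of "axis j 1 + axis k 1"] Hjj[of j] Hjj[of k] unfolding cadd cax qform_axis_add[OF H] by simp
  define \<Sigma> where "\<Sigma> = (\<chi> j k. Re (H $ j $ k))"
  have HS: "H = map_matrix complex_of_real \<Sigma>"
    using \<open>\<And>j k. Im (H $ j $ k) = 0\<close> by (simp add: \<Sigma>_def map_matrix_def vec_eq_iff complex_eq_iff)
  have "transpose \<Sigma> = \<Sigma>"
  proof -
    have "H $ k $ j = H $ j $ k" for j k using arg_cong[OF H, of "\<lambda>M. M $ j $ k"] by (simp add: transpose_def)
    then show ?thesis by (simp add: \<Sigma>_def transpose_def vec_eq_iff)
  qed
  moreover have "0 \<le> x \<bullet> (\<Sigma> *v x)" for x using re[of x] unfolding HS qform_cvec by simp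
  ultimately show ?thesis using HS unfolding pos_semidef_def by blast
qed

section \<open>Quantitative comparison with the Gaussian transform\<close>

lemma Re_qform_complex:
  "Re (qform (map_matrix complex_of_real S) (- (cvec a + \<i> *s cvec b))) = a \<bullet> (S *v a) - b \<bullet> (S *v b)"
  by (simp add: qform_def cvec_def map_matrix_def inner_vec_def matrix_vector_mult_def sum_distrib_left
      sum_subtractf[symmetric] algebra_simps)

lemma cmod_exp_minus_1: "cmod (exp z - 1) \<le> cmod z * exp (cmod z)"
  using Taylor_exp_field[of z 0] by (simp add: mult.commute)

lemma cmod_exp_perturb: "cmod (exp \<rho> * (1 + \<zeta>) - 1) \<le> cmod \<rho> * exp (cmod \<rho>) * (1 + cmod \<zeta>) + cmod \<zeta>"
proof -
  have "exp \<rho> * (1 + \<zeta>) - 1 = (exp \<rho> - 1) * (1 + \<zeta>) + \<zeta>" by (simp add: algebra_simps)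
  also have "cmod \<dots> \<le> cmod (exp \<rho> - 1) * cmod (1 + \<zeta>) + cmod \<zeta>"
    by (rule order_trans[OF norm_triangle_ineq]) (simp add: norm_mult)
  also have "\<dots> \<le> (cmod \<rho> * exp (cmod \<rho>)) * (1 + cmod \<zeta>) + cmod \<zeta>"
    using norm_triangle_ineq[of 1 \<zeta>] by (intro add_right_mono mult_mono cmod_exp_minus_1) auto
  finally show ?thesis .
qed

text \<open>Bound the polynomial by \<open>exp (3 a)\<close> and complete the square.\<close>

lemma poly_gauss_le_exp:
  fixes a \<beta> m :: real
  assumes a: "a \<ge> 0" and \<beta>: "\<beta> > 0"
  shows "(1 + a) ^ 3 * exp (- (\<beta> / 2) * a\<^sup>2) \<le> exp ((3 + m)\<^sup>2 / (2 * \<beta>)) * exp (- m * a)"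
proof -
  have "(1 + a) ^ 3 \<le> exp a ^ 3" using a by (intro power_mono) auto
  also have "\<dots> = exp (3 * a)" by (simp add: exp_of_nat_mult[symmetric])
  finally have "(1 + a) ^ 3 * exp (- (\<beta> / 2) * a\<^sup>2) \<le> exp (3 * a) * exp (- (\<beta> / 2) * a\<^sup>2)"
    by (intro mult_right_mono) auto
  also have "\<dots> = exp (3 * a - (\<beta> / 2) * a\<^sup>2)" by (simp add: exp_add[symmetric])
  also have "\<dots> \<le> exp ((3 + m)\<^sup>2 / (2 * \<beta>) - m * a)"
  proof -
    have "0 \<le> (\<beta> * a - (3 + m))\<^sup>2 / (2 * \<beta>)" using \<beta> by simp
    also have "\<dots> = (3 + m)\<^sup>2 / (2 * \<beta>) - m * a - (3 * a - (\<beta> / 2) * a\<^sup>2)"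
      using \<beta> by (simp add: field_simps power2_eq_square)
    finally show ?thesis by simp
  qed
  also have "\<dots> = exp ((3 + m)\<^sup>2 / (2 * \<beta>)) * exp (- m * a)" by (simp add: exp_add[symmetric])
  finally show ?thesis .
qed

text \<open>The error exponent \<open>\<rho>\<close> is estimated twice. Its size is \<open>O ((1 + \<bar>t\<bar>)^3 / sqrt \<phi>)\<close>, which yields the
rate; but as it also appears in an exponential, it has to be dominated by a small multiple of
\<open>\<bar>t\<bar>^2\<close>, so that the Gaussian factor from the positive definite quadratic form survives. The
latter holds as long as \<open>\<bar>t\<bar> \<le> c * sqrt \<phi>\<close> with a small constant \<open>c\<close>. A product of exponentials
replaces the remaining Gaussian, as it is integrable coordinate by coordinate.\<close>

lemma quasi_power_tilted_estimate:
  fixes X :: "'a \<Rightarrow> real^'m" and S :: "real^'m^'m" and \<sigma> :: "'m \<Rightarrow> bool"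
  assumes qp: "quasi_power_at M X \<phi> (cvec \<mu>) (map_matrix complex_of_real S) r B"
    and B: "B \<ge> 0" and \<beta>: "\<beta> > 0" and pd: "\<And>t. t \<bullet> (S *v t) \<ge> 2 * \<beta> * (norm t)\<^sup>2"
    and c: "c > 0" "4 * c \<le> r" "16 * B * c \<le> \<beta>" and \<phi>c: "1 / sqrt \<phi> \<le> c"
    and t: "\<And>j. \<bar>t $ j\<bar> \<le> c * sqrt \<phi>"
  defines "Y \<equiv> \<lambda>\<omega>. (X \<omega> - \<phi> *\<^sub>R \<mu>) /\<^sub>R sqrt \<phi>"
    and "s \<equiv> - (cvec (sign_vec \<sigma>) + \<i> *s cvec t)"
    and "K0 \<equiv> (\<Sum>j\<in>UNIV. \<Sum>k\<in>UNIV. cmod (map_matrix complex_of_real S $ j $ k))"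
  shows "integrable M (\<lambda>\<omega>. exp (bilin (Y \<omega>) s))"
    and "cmod (mgf M Y s - exp (qform (map_matrix complex_of_real S) s / 2))
      \<le> 1 / sqrt \<phi> * (exp (K0 / 2) * (2 * B * exp (\<beta> / 2) * (1 + \<beta>) + B) * exp ((3 + real CARD('m))\<^sup>2 / (2 * \<beta>))
         * (\<Prod>j\<in>UNIV. exp (- \<bar>t $ j\<bar>)))"
proof -
  let ?H = "map_matrix complex_of_real S"
  let ?z = "complex_of_real (1 / sqrt \<phi>) *s s"
  let ?m = "real CARD('m)"
  define a where "a = norm t"
  have a: "a \<ge> 0" by (simp add: a_def)
  have \<phi>: "\<phi> \<ge> 1" using qp by (simp add: quasi_power_at_def)
  define q where "q = sqrt \<phi>"
  have q: "q \<ge> 1" "\<phi> = q * q" using \<phi> by (auto simp: q_def)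
  have qc: "1 / q \<le> c" using \<phi>c by (simp add: q_def)
  have sj: "s $ j = - (complex_of_real (sign_vec \<sigma> $ j) + \<i> * complex_of_real (t $ j))" for j
    by (simp add: s_def cvec_def)
  have sb: "cmod (s $ j) \<le> 1 + \<bar>t $ j\<bar>" for j
  proof -
    have "cmod (s $ j) \<le> cmod (complex_of_real (sign_vec \<sigma> $ j)) + cmod (\<i> * complex_of_real (t $ j))"
      unfolding sj norm_minus_cancel by (rule norm_triangle_ineq)
    also have "\<dots> = 1 + \<bar>t $ j\<bar>" by (simp add: sign_vec_def norm_mult)
    finally show ?thesis .
  qed
  have s1: "max_norm s \<le> 1 + a"
    unfolding max_norm_le_iff a_def by (intro allI order_trans[OF sb] add_left_mono component_le_norm_cart)
  have s2: "max_norm s \<le> 1 + c * q"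
    unfolding max_norm_le_iff q_def by (intro allI order_trans[OF sb] add_left_mono t)
  have zs: "max_norm ?z \<le> max_norm s / q"
  proof -
    have "max_norm ?z \<le> \<bar>1 / sqrt \<phi>\<bar> * max_norm s"
      using max_norm_smult[of "complex_of_real (1 / sqrt \<phi>)" s] by (simp only: norm_of_real)
    also have "\<dots> = max_norm s / q" using q(1) unfolding q_def[symmetric] by simp
    finally show ?thesis .
  qed
  have z1: "max_norm ?z \<le> (1 + a) / q" by (rule order_trans[OF zs divide_right_mono[OF s1]]) (use q(1) in simp)
  have z2: "max_norm ?z \<le> 2 * c"
  proof -
    have "max_norm ?z \<le> (1 + c * q) / q" by (rule order_trans[OF zs divide_right_mono[OF s2]]) (use q(1) in simp)
    also have "\<dots> = 1 / q + c" using q(1) by (simp add: field_simps)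
    finally show ?thesis using qc by linarith
  qed
  have zr: "max_norm ?z < r" using z2 c by linarith
  have qp': "integrable M (\<lambda>\<omega>. exp (bilin (X \<omega>) ?z))"
    "\<exists>\<rho> \<zeta>. mgf M X ?z = exp (complex_of_real \<phi> * (lform (cvec \<mu>) ?z + qform ?H ?z / 2) + \<rho>) * (1 + \<zeta>) \<and>
       cmod \<rho> \<le> B * (\<phi> * max_norm ?z ^ 3 + max_norm ?z) \<and> cmod \<zeta> \<le> B * max_norm ?z"
    using qp zr unfolding quasi_power_at_def by blast+
  have \<phi>0: "\<phi> > 0" using \<phi> by simp
  show "integrable M (\<lambda>\<omega>. exp (bilin (Y \<omega>) s))"
    unfolding Y_def by (rule mgf_standardized(2)[OF \<phi>0 qp'(1)])
  obtain \<rho> \<zeta> where \<rho>\<zeta>: "mgf M X ?z = exp (complex_of_real \<phi> * (lform (cvec \<mu>) ?z + qform ?H ?z / 2) + \<rho>) * (1 + \<zeta>)"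
    "cmod \<rho> \<le> B * (\<phi> * max_norm ?z ^ 3 + max_norm ?z)" "cmod \<zeta> \<le> B * max_norm ?z"
    using qp'(2) by blast
  have mY: "mgf M Y s = exp (qform ?H s / 2) * (exp \<rho> * (1 + \<zeta>))"
  proof -
    have e: "- (complex_of_real (sqrt \<phi>) * bilin \<mu> s) + (complex_of_real \<phi> * (lform (cvec \<mu>) ?z + qform ?H ?z / 2) + \<rho>) = qform ?H s / 2 + \<rho>"
    proof -
      have 1: "complex_of_real \<phi> = complex_of_real q * complex_of_real q" using q(2) by (simp flip: of_real_mult)
      have 2: "complex_of_real q \<noteq> 0" using q by simp
      show ?thesis unfolding lform_smult qform_smult lform_cvec 1 q_def[symmetric]
        using 2 by (simp add: power2_eq_square field_simps)
    qed
    have "mgf M Y s = exp (- (complex_of_real (sqrt \<phi>) * bilin \<mu> s)) * mgf M X ?z"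
      unfolding Y_def by (rule mgf_standardized(1)[OF \<phi>0])
    also have "\<dots> = exp (- (complex_of_real (sqrt \<phi>) * bilin \<mu> s) + (complex_of_real \<phi> * (lform (cvec \<mu>) ?z + qform ?H ?z / 2) + \<rho>)) * (1 + \<zeta>)"
      unfolding \<rho>\<zeta>(1) exp_add by (simp only: mult.assoc)
    also have "\<dots> = exp (qform ?H s / 2) * (exp \<rho> * (1 + \<zeta>))"
      unfolding e exp_add by (simp only: mult.assoc)
    finally show ?thesis .
  qed
  let ?Z = "max_norm ?z" and ?y = "1 + a"
  have y1: "?y \<ge> 1" using a by simp
  have q3: "\<phi> * ?Z ^ 3 \<le> ?y ^ 3 / q"
  proof -
    have "\<phi> * ?Z ^ 3 \<le> \<phi> * (?y / q) ^ 3" using z1 \<phi> by (intro mult_left_mono power_mono) auto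
    also have "\<dots> = ?y ^ 3 / q" using q by (simp add: power_divide power3_eq_cube)
    finally show ?thesis .
  qed
  have y3: "?y \<le> ?y ^ 3" "?y\<^sup>2 \<ge> 1" using y1 by (auto intro: self_le_power one_le_power)
  have "cmod \<rho> \<le> B * (?y ^ 3 / q + ?y / q)"
    by (intro order_trans[OF \<rho>\<zeta>(2)] mult_left_mono add_mono q3 z1 B)
  also have "\<dots> \<le> B * (?y ^ 3 / q + ?y ^ 3 / q)" using B q y3 by (intro mult_left_mono add_left_mono divide_right_mono) auto
  also have "\<dots> = 2 * B * ?y ^ 3 / q" using q(1) by (simp add: field_simps)
  finally have \<rho>1: "cmod \<rho> \<le> 2 * B * ?y ^ 3 / q" .
  have "\<phi> * ?Z ^ 3 = (q * ?Z)\<^sup>2 * ?Z" by (simp add: q(2) power2_eq_square power3_eq_cube)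
  also have "\<dots> \<le> ?y\<^sup>2 * (2 * c)"
  proof (intro mult_mono z2 power_mono)
    show "q * ?Z \<le> ?y" using z1 q by (simp add: field_simps)
  qed (use q in auto)
  finally have q4: "\<phi> * ?Z ^ 3 \<le> ?y\<^sup>2 * (2 * c)" .
  have "cmod \<rho> \<le> B * (?y\<^sup>2 * (2 * c) + 2 * c)"
    by (intro order_trans[OF \<rho>\<zeta>(2)] mult_left_mono add_mono q4 z2 B)
  also have "\<dots> \<le> B * (?y\<^sup>2 * (2 * c) + ?y\<^sup>2 * (2 * c))" using B c(1) y3 by (intro mult_left_mono add_left_mono) auto
  also have "\<dots> = 4 * B * c * ?y\<^sup>2" by (simp add: algebra_simps)
  also have "\<dots> \<le> 4 * B * c * (2 * (1 + a\<^sup>2))"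
  proof -
    have "0 \<le> (1 - a)\<^sup>2" by simp
    then have "?y\<^sup>2 \<le> 2 * (1 + a\<^sup>2)" by (simp add: power2_eq_square algebra_simps)
    then show ?thesis using B c(1) by (intro mult_left_mono) auto
  qed
  also have "\<dots> = (16 * B * c) / 2 * (1 + a\<^sup>2)" by simp
  also have "\<dots> \<le> \<beta> / 2 * (1 + a\<^sup>2)" using c(3) by (intro mult_right_mono) auto
  finally have \<rho>2: "cmod \<rho> \<le> \<beta> / 2 * (1 + a\<^sup>2)" .
  have \<zeta>1: "cmod \<zeta> \<le> B * ?y ^ 3 / q"
  proof -
    have "cmod \<zeta> \<le> B * (?y / q)" by (intro order_trans[OF \<rho>\<zeta>(3)] mult_left_mono z1 B)
    also have "\<dots> \<le> B * (?y ^ 3 / q)" using B q y3 by (intro mult_left_mono divide_right_mono) auto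
    finally show ?thesis by simp
  qed
  have \<zeta>2: "cmod \<zeta> \<le> \<beta>"
  proof -
    have "cmod \<zeta> \<le> B * (2 * c)" by (intro order_trans[OF \<rho>\<zeta>(3)] mult_left_mono z2 B)
    also have "\<dots> \<le> 16 * B * c" using B c(1) by simp
    finally show ?thesis using c(3) by linarith
  qed
  have "cmod (exp \<rho> * (1 + \<zeta>) - 1) \<le> cmod \<rho> * exp (cmod \<rho>) * (1 + cmod \<zeta>) + cmod \<zeta>" by (rule cmod_exp_perturb)
  also have "\<dots> \<le> (2 * B * ?y ^ 3 / q) * exp (\<beta> / 2 * (1 + a\<^sup>2)) * (1 + \<beta>) + B * ?y ^ 3 / q"
    using \<rho>1 \<rho>2 \<zeta>1 \<zeta>2 B q y1 by (intro add_mono mult_mono) auto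
  also have "\<dots> \<le> (2 * B * ?y ^ 3 / q) * exp (\<beta> / 2 * (1 + a\<^sup>2)) * (1 + \<beta>) + B * ?y ^ 3 / q * exp (\<beta> / 2 * a\<^sup>2)"
  proof -
    have "1 \<le> exp (\<beta> / 2 * a\<^sup>2)" using \<beta> by simp
    then have "B * ?y ^ 3 / q * 1 \<le> B * ?y ^ 3 / q * exp (\<beta> / 2 * a\<^sup>2)"
      using B q y1 by (intro mult_left_mono) auto
    then show ?thesis by simp
  qed
  also have "\<dots> = 1 / q * (2 * B * exp (\<beta> / 2) * (1 + \<beta>) + B) * (?y ^ 3 * exp (\<beta> / 2 * a\<^sup>2))"
  proof -
    have ee: "exp (\<beta> / 2 * (1 + a\<^sup>2)) = exp (\<beta> / 2) * exp (\<beta> / 2 * a\<^sup>2)"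
      by (simp add: exp_add[symmetric] distrib_left)
    have alg: "(2 * B * Y / q) * (e1 * e2) * (1 + \<beta>) + B * Y / q * e2 = 1 / q * (2 * B * e1 * (1 + \<beta>) + B) * (Y * e2)" for Y e1 e2
      using q(1) by (simp add: field_simps)
    show ?thesis unfolding ee by (rule alg)
  qed
  finally have D: "cmod (exp \<rho> * (1 + \<zeta>) - 1) \<le> 1 / q * (2 * B * exp (\<beta> / 2) * (1 + \<beta>) + B) * (?y ^ 3 * exp (\<beta> / 2 * a\<^sup>2))" .
  let ?A = "2 * B * exp (\<beta> / 2) * (1 + \<beta>) + B"
  have A: "?A \<ge> 0" using B \<beta> by simp
  have K0: "sign_vec \<sigma> \<bullet> (S *v sign_vec \<sigma>) \<le> K0"
  proof -
    have "sign_vec \<sigma> \<bullet> (S *v sign_vec \<sigma>) \<le> cmod (qform ?H (cvec (sign_vec \<sigma>)))" unfolding qform_cvec by simp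
    also have "\<dots> \<le> K0 * (max_norm (cvec (sign_vec \<sigma>)))\<^sup>2" unfolding K0_def by (rule qform_bound)
    also have "\<dots> \<le> K0 * 1\<^sup>2"
    proof (intro mult_left_mono power_mono)
      show "max_norm (cvec (sign_vec \<sigma>)) \<le> 1" by (simp add: max_norm_le_iff cvec_def sign_vec_def)
      show "K0 \<ge> 0" unfolding K0_def by (intro sum_nonneg) auto
    qed auto
    finally show ?thesis by simp
  qed
  have E: "cmod (exp (qform ?H s / 2)) \<le> exp (K0 / 2) * exp (- \<beta> * a\<^sup>2)"
  proof -
    have "Re (qform ?H s) = sign_vec \<sigma> \<bullet> (S *v sign_vec \<sigma>) - t \<bullet> (S *v t)" unfolding s_def by (rule Re_qform_complex)
    then have "Re (qform ?H s / 2) \<le> K0 / 2 - \<beta> * a\<^sup>2" using K0 pd[of t] by (simp add: a_def)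
    then have "exp (Re (qform ?H s / 2)) \<le> exp (K0 / 2 - \<beta> * a\<^sup>2)" by simp
    then show ?thesis by (simp only: norm_exp_eq_Re) (simp add: exp_add[symmetric])
  qed
  have "cmod (mgf M Y s - exp (qform ?H s / 2)) = cmod (exp (qform ?H s / 2)) * cmod (exp \<rho> * (1 + \<zeta>) - 1)"
    unfolding mY norm_mult[symmetric] by (simp add: algebra_simps)
  also have "\<dots> \<le> (exp (K0 / 2) * exp (- \<beta> * a\<^sup>2)) * (1 / q * ?A * (?y ^ 3 * exp (\<beta> / 2 * a\<^sup>2)))"
    by (intro mult_mono E D) auto
  also have "\<dots> = 1 / q * exp (K0 / 2) * ?A * (?y ^ 3 * (exp (- \<beta> * a\<^sup>2) * exp (\<beta> / 2 * a\<^sup>2)))"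
    by (simp only: mult_ac)
  also have "exp (- \<beta> * a\<^sup>2) * exp (\<beta> / 2 * a\<^sup>2) = exp (- (\<beta> / 2) * a\<^sup>2)"
    by (simp add: exp_add[symmetric])
  also have "1 / q * exp (K0 / 2) * ?A * (?y ^ 3 * exp (- (\<beta> / 2) * a\<^sup>2))
     \<le> 1 / q * exp (K0 / 2) * ?A * (exp ((3 + ?m)\<^sup>2 / (2 * \<beta>)) * exp (- ?m * a))"
    using A q by (intro mult_left_mono poly_gauss_le_exp a \<beta>) auto
  also have "\<dots> \<le> 1 / q * exp (K0 / 2) * ?A * (exp ((3 + ?m)\<^sup>2 / (2 * \<beta>)) * (\<Prod>j\<in>UNIV. exp (- \<bar>t $ j\<bar>)))"
  proof -
    have "(\<Sum>j\<in>UNIV. \<bar>t $ j\<bar>) \<le> ?m * a"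
      using sum_bounded_above[of UNIV "\<lambda>j. \<bar>t $ j\<bar>" a] component_le_norm_cart[of t] by (simp add: a_def)
    then have "exp (- ?m * a) \<le> exp (- (\<Sum>j\<in>UNIV. \<bar>t $ j\<bar>))" by simp
    also have "\<dots> = (\<Prod>j\<in>UNIV. exp (- \<bar>t $ j\<bar>))" by (simp add: exp_sum[symmetric] sum_negf)
    finally show ?thesis using A q by (intro mult_left_mono) auto
  qed
  finally show "cmod (mgf M Y s - exp (qform ?H s / 2))
      \<le> 1 / sqrt \<phi> * (exp (K0 / 2) * ?A * exp ((3 + ?m)\<^sup>2 / (2 * \<beta>)) * (\<Prod>j\<in>UNIV. exp (- \<bar>t $ j\<bar>)))"
    by (simp only: q_def mult.assoc)
qed

section \<open>The quasi-power theorem\<close>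

lemma exp_bilin_tilt:
  "exp (bilin y (- (cvec a + \<i> *s cvec t))) = complex_of_real (exp (- (a \<bullet> y))) * iexp (- (t \<bullet> y))"
proof -
  have "bilin y (- (cvec a + \<i> *s cvec t)) = - bilin y (cvec a) + \<i> * (- bilin y (cvec t))"
    by (simp add: bilin_def sum_distrib_left sum_negf[symmetric] sum.distrib[symmetric] algebra_simps)
  then have "bilin y (- (cvec a + \<i> *s cvec t)) = complex_of_real (- (a \<bullet> y)) + \<i> * complex_of_real (- (t \<bullet> y))"
    by (simp add: bilin_cvec)
  then show ?thesis by (simp only: exp_add exp_of_real)
qed

text \<open>Both the cut-off frequency and the reciprocal of the distance of the transforms are of order
\<open>sqrt (\<phi> n)\<close>.\<close>

lemma quasi_power_Berry_Esseen:
  fixes P :: "nat \<Rightarrow> 'a measure" and \<Omega> :: "nat \<Rightarrow> 'a \<Rightarrow> real^'m" and S :: "real^'m^'m"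
  assumes ev: "\<forall>\<^sub>F n in sequentially. quasi_power_at (P n) (\<Omega> n) (\<phi> n) (cvec \<mu>) (map_matrix complex_of_real S) r B"
    and r: "r > 0" and B: "B \<ge> 0" and phi: "filterlim \<phi> at_top sequentially"
    and S: "pos_semidef S" and inv: "invertible S"
    and prob: "\<And>n. n \<ge> 1 \<Longrightarrow> prob_space (P n)" and rv: "\<And>n. n \<ge> 1 \<Longrightarrow> \<Omega> n \<in> borel_measurable (P n)"
  shows "(\<lambda>n. SUP x. \<bar>\<P>(\<omega> in P n. (\<Omega> n \<omega> - \<phi> n *\<^sub>R \<mu>) /\<^sub>R sqrt (\<phi> n) \<le> x) - normal_cdf S x\<bar>)
        \<in> O(\<lambda>n. 1 / sqrt (\<phi> n))"
proof -
  let ?H = "map_matrix complex_of_real S"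
  let ?Y = "\<lambda>n \<omega>. (\<Omega> n \<omega> - \<phi> n *\<^sub>R \<mu>) /\<^sub>R sqrt (\<phi> n)"
  obtain A :: "real^'m^'m" where A: "S = A ** transpose A" by (rule pos_semidef_factor[OF S])
  have dA: "det A \<noteq> 0" using inv by (simp add: A invertible_det_nz det_mul)
  have "inj ((*v) (transpose A))"
    using dA by (simp add: inj_matrix_vector_mult invertible_det_nz)
  then obtain b where b: "b > 0" "\<And>t. norm (transpose A *v t) \<ge> b * norm t"
    using linear_inj_bounded_below_pos[OF matrix_vector_mul_linear] by blast
  define \<beta> where "\<beta> = b\<^sup>2 / 2"
  have \<beta>: "\<beta> > 0" using b by (simp add: \<beta>_def)
  have pd: "t \<bullet> (S *v t) \<ge> 2 * \<beta> * (norm t)\<^sup>2" for t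
  proof -
    have "(b * norm t)\<^sup>2 \<le> (norm (transpose A *v t))\<^sup>2" using b by (intro power_mono) auto
    then show ?thesis by (simp add: A quadratic_form_factor \<beta>_def power_mult_distrib)
  qed
  \<comment> \<open>the denominator has \<open>B + 1\<close> in place of \<open>B\<close>, as \<open>B\<close> may vanish\<close>
  define c where "c = min (r / 4) (\<beta> / (16 * (B + 1)))"
  have c: "c > 0" "4 * c \<le> r" "16 * B * c \<le> \<beta>"
  proof -
    show "c > 0" using r \<beta> B by (simp add: c_def)
    show "4 * c \<le> r" by (simp add: c_def)
    have "16 * B * c \<le> 16 * (B + 1) * c" using \<open>c > 0\<close> by simp
    also have "\<dots> \<le> 16 * (B + 1) * (\<beta> / (16 * (B + 1)))" using B by (intro mult_left_mono) (auto simp: c_def)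
    also have "\<dots> = \<beta>" using B by simp
    finally show "16 * B * c \<le> \<beta>" .
  qed
  let ?Q = "normal_measure A"
  define q where "q y = (2 * pi) powr (- (real CARD('m) / 2)) / \<bar>det A\<bar> * exp (- (norm (matrix_inv A *v y))\<^sup>2 / 2)" for y :: "real^'m"
  have Qd: "?Q = density lborel (\<lambda>y. ennreal (q y))" unfolding q_def by (rule normal_measure_density[OF dA])
  have q0: "0 \<le> q y" for y by (simp add: q_def)
  have qm: "q \<in> borel_measurable borel" unfolding q_def by measurable
  have Lq: "\<exists>L. \<forall>y y'. \<bar>exp (v \<bullet> y) * q y - exp (v \<bullet> y') * q y'\<bar> \<le> L * norm (y - y')" for v
  proof -
    let ?k = "(2 * pi) powr (- (real CARD('m) / 2)) / \<bar>det A\<bar>"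
    obtain L where L: "\<And>y y'. \<bar>exp (v \<bullet> y) * exp (- (norm (matrix_inv A *v y))\<^sup>2 / 2)
      - exp (v \<bullet> y') * exp (- (norm (matrix_inv A *v y'))\<^sup>2 / 2)\<bar> \<le> L * norm (y - y')"
      using tilted_normal_density_Lipschitz[OF dA, of v] by blast
    have "\<bar>exp (v \<bullet> y) * q y - exp (v \<bullet> y') * q y'\<bar> \<le> (?k * L) * norm (y - y')" for y y'
    proof -
      have k: "?k \<ge> 0" by simp
      have "exp (v \<bullet> y) * q y - exp (v \<bullet> y') * q y' = ?k * (exp (v \<bullet> y) * exp (- (norm (matrix_inv A *v y))\<^sup>2 / 2)
          - exp (v \<bullet> y') * exp (- (norm (matrix_inv A *v y'))\<^sup>2 / 2))"
        unfolding q_def right_diff_distrib by (simp only: mult_ac)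
      also have "\<bar>\<dots>\<bar> \<le> ?k * (L * norm (y - y'))"
        unfolding abs_mult abs_of_nonneg[OF k] by (rule mult_left_mono[OF L k])
      finally show ?thesis by (simp only: mult.assoc)
    qed
    then show ?thesis by blast
  qed
  let ?s = "\<lambda>\<sigma> t. - (cvec (sign_vec \<sigma>) + \<i> *s cvec t) :: complex^'m"
  have iQ: "integrable ?Q (\<lambda>y. exp (- (sign_vec \<sigma> \<bullet> y)))" for \<sigma>
  proof -
    have "integrable ?Q (\<lambda>y. Re (exp (bilin y (?s \<sigma> 0))))" by (intro integrable_Re integrable_normal_measure)
    then show ?thesis unfolding exp_bilin_tilt by simp
  qed
  define K0 where "K0 = (\<Sum>j\<in>UNIV. \<Sum>k\<in>UNIV. cmod (?H $ j $ k))"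
  define K3 where "K3 = exp (K0 / 2) * (2 * B * exp (\<beta> / 2) * (1 + \<beta>) + B) * exp ((3 + real CARD('m))\<^sup>2 / (2 * \<beta>))"
  have K3: "K3 \<ge> 0" using B \<beta> by (simp add: K3_def)
  define G where "G t = K3 * (\<Prod>j\<in>UNIV. exp (- \<bar>t $ j\<bar>))" for t :: "real^'m"
  have iG: "integrable lborel G"
    unfolding G_def[abs_def] by (intro integrable_mult_right integrable_prod_vec integrable_exp_abs)
  \<comment> \<open>a common bound for the tilted masses: the Gaussian ones plus the error of the approximation at \<open>t = 0\<close>\<close>
  define M where "M = (\<Sum>\<sigma>\<in>UNIV. cmod (exp (qform ?H (?s \<sigma> 0) / 2))) + K3"
  obtain C where C: "C \<ge> 0"
    "\<And>P T \<delta> x. prob_space P \<Longrightarrow> sets P = sets borel \<Longrightarrow> (\<And>\<sigma>. integrable P (\<lambda>y. exp (- (sign_vec \<sigma> \<bullet> y)))) \<Longrightarrow>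
      (\<And>\<sigma>. (LINT y|P. exp (- (sign_vec \<sigma> \<bullet> y))) \<le> M) \<Longrightarrow> T > 0 \<Longrightarrow> \<delta> \<ge> 0 \<Longrightarrow>
      (\<And>\<sigma> t. (\<forall>j. \<bar>t $ j\<bar> \<le> T) \<Longrightarrow> cmod (tilted_char P \<sigma> t - tilted_char ?Q \<sigma> t) \<le> \<delta> * G t) \<Longrightarrow>
      \<bar>measure P {..x} - measure ?Q {..x}\<bar> \<le> C * (1 / T + \<delta>)"
    by (rule multivariate_Berry_Esseen[OF prob_space_normal_measure Qd q0 qm iQ Lq iG]) blast
  have "filterlim (\<lambda>n. sqrt (\<phi> n)) at_top sequentially"
    by (rule filterlim_compose[OF sqrt_at_top phi])
  then have "\<forall>\<^sub>F n in sequentially. sqrt (\<phi> n) \<ge> 1 / c" by (simp add: filterlim_at_top)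
  moreover have "\<forall>\<^sub>F n in sequentially. n \<ge> (1::nat)" by (rule eventually_ge_at_top)
  ultimately have "\<forall>\<^sub>F n in sequentially. norm (SUP x. \<bar>\<P>(\<omega> in P n. ?Y n \<omega> \<le> x) - normal_cdf S x\<bar>) \<le> C * (1 / c + 1) * norm (1 / sqrt (\<phi> n))"
    using ev
  proof eventually_elim
    case (elim n)
    have n: "n \<ge> 1" and qp: "quasi_power_at (P n) (\<Omega> n) (\<phi> n) (cvec \<mu>) ?H r B" using elim by auto
    interpret prob_space "P n" by (rule prob[OF n])
    have \<phi>: "\<phi> n \<ge> 1" using qp by (simp add: quasi_power_at_def)
    have sq: "sqrt (\<phi> n) \<ge> 1" using \<phi> by simp
    have \<phi>c: "1 / sqrt (\<phi> n) \<le> c" using elim(1) sq c(1) by (simp add: field_simps)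
    note rv[OF n, measurable]
    have Ym[measurable]: "?Y n \<in> measurable (P n) borel" by measurable
    define P' where "P' = distr (P n) borel (?Y n)"
    have P': "prob_space P'" "sets P' = sets borel" unfolding P'_def by (auto intro: prob_space_distr)
    have est: "integrable (P n) (\<lambda>\<omega>. exp (bilin (?Y n \<omega>) (?s \<sigma> t)))"
      "cmod (mgf (P n) (?Y n) (?s \<sigma> t) - exp (qform ?H (?s \<sigma> t) / 2)) \<le> 1 / sqrt (\<phi> n) * G t"
      if "\<And>j. \<bar>t $ j\<bar> \<le> c * sqrt (\<phi> n)" for \<sigma> t
      using quasi_power_tilted_estimate[OF qp B \<beta> pd c \<phi>c that, of \<sigma>] unfolding G_def K3_def K0_def by simp_all
    have t0: "\<bar>(0::real^'m) $ j\<bar> \<le> c * sqrt (\<phi> n)" for j using c(1) sq by simp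
    have mP: "tilted_char P' \<sigma> t = mgf (P n) (?Y n) (?s \<sigma> t)" for \<sigma> t
      unfolding P'_def mgf_def exp_bilin_tilt tilted_char_def by (rule integral_distr[OF Ym]) measurable
    have mQ: "tilted_char ?Q \<sigma> t = exp (qform ?H (?s \<sigma> t) / 2)" for \<sigma> t
      using mgf_normal_measure[of A "?s \<sigma> t"] unfolding exp_bilin_tilt tilted_char_def A[symmetric] .
    have iP: "integrable P' (\<lambda>y. exp (- (sign_vec \<sigma> \<bullet> y)))" for \<sigma>
    proof -
      have "integrable (P n) (\<lambda>\<omega>. Re (exp (bilin (?Y n \<omega>) (?s \<sigma> 0))))" by (intro integrable_Re est t0)
      then have "integrable (P n) (\<lambda>\<omega>. exp (- (sign_vec \<sigma> \<bullet> ?Y n \<omega>)))" unfolding exp_bilin_tilt by simp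
      then show ?thesis unfolding P'_def by (subst integrable_distr_eq[OF Ym]) measurable
    qed
    have MP: "(LINT y|P'. exp (- (sign_vec \<sigma> \<bullet> y))) \<le> M" for \<sigma>
    proof -
      have "complex_of_real (LINT y|P'. exp (- (sign_vec \<sigma> \<bullet> y))) = mgf (P n) (?Y n) (?s \<sigma> 0)"
        using mP[of \<sigma> 0] by (simp add: tilted_char_def)
      then have "\<bar>LINT y|P'. exp (- (sign_vec \<sigma> \<bullet> y))\<bar> = cmod (mgf (P n) (?Y n) (?s \<sigma> 0))"
        by (simp only: norm_of_real flip: \<open>complex_of_real (LINT y|P'. exp (- (sign_vec \<sigma> \<bullet> y))) = mgf (P n) (?Y n) (?s \<sigma> 0)\<close>)
      also have "\<dots> \<le> cmod (exp (qform ?H (?s \<sigma> 0) / 2)) + cmod (mgf (P n) (?Y n) (?s \<sigma> 0) - exp (qform ?H (?s \<sigma> 0) / 2))"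
        by (rule norm_triangle_sub)
      also have "\<dots> \<le> (\<Sum>\<sigma>\<in>UNIV. cmod (exp (qform ?H (?s \<sigma> 0) / 2))) + K3"
      proof (rule add_mono)
        show "cmod (exp (qform ?H (?s \<sigma> 0) / 2)) \<le> (\<Sum>\<sigma>\<in>UNIV. cmod (exp (qform ?H (?s \<sigma> 0) / 2)))"
          by (rule member_le_sum[where f="\<lambda>\<sigma>. cmod (exp (qform ?H (?s \<sigma> 0) / 2))"]) auto
        have "cmod (mgf (P n) (?Y n) (?s \<sigma> 0) - exp (qform ?H (?s \<sigma> 0) / 2)) \<le> 1 / sqrt (\<phi> n) * G 0" by (rule est(2)[OF t0])
        also have "\<dots> \<le> 1 * K3" using sq K3 by (intro mult_mono) (auto simp: G_def)
        finally show "cmod (mgf (P n) (?Y n) (?s \<sigma> 0) - exp (qform ?H (?s \<sigma> 0) / 2)) \<le> K3" by simp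
      qed
      finally show ?thesis unfolding M_def by linarith
    qed
    have bound: "\<bar>\<P>(\<omega> in P n. ?Y n \<omega> \<le> x) - normal_cdf S x\<bar> \<le> C * (1 / c + 1) * (1 / sqrt (\<phi> n))" for x
    proof -
      have T: "c * sqrt (\<phi> n) > 0" using c(1) sq by simp
      have close: "cmod (tilted_char P' \<sigma> t - tilted_char ?Q \<sigma> t) \<le> 1 / sqrt (\<phi> n) * G t"
        if "\<forall>j. \<bar>t $ j\<bar> \<le> c * sqrt (\<phi> n)" for \<sigma> t
        unfolding mP mQ using that by (intro est(2)) blast
      have d0: "1 / sqrt (\<phi> n) \<ge> 0" using sq by simp
      have "\<bar>measure P' {..x} - measure ?Q {..x}\<bar> \<le> C * (1 / (c * sqrt (\<phi> n)) + 1 / sqrt (\<phi> n))"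
        by (rule C(2)[OF P' iP MP T d0 close])
      moreover have "measure P' {..x} = \<P>(\<omega> in P n. ?Y n \<omega> \<le> x)"
      proof -
        have "{..x} = orthant (\<lambda>_. True) x" by (auto simp: orthant_def less_eq_vec_def)
        then have "{..x} \<in> sets borel" using sets_orthant by metis
        then have "measure P' {..x} = measure (P n) (?Y n -` {..x} \<inter> space (P n))" unfolding P'_def by (intro measure_distr Ym)
        also have "?Y n -` {..x} \<inter> space (P n) = {\<omega> \<in> space (P n). ?Y n \<omega> \<le> x}" by auto
        finally show ?thesis .
      qed
      moreover have "measure ?Q {..x} = normal_cdf S x" unfolding A by (rule normal_cdf_normal_measure[OF dA])
      moreover have "1 / (c * sqrt (\<phi> n)) + 1 / sqrt (\<phi> n) = (1 / c + 1) * (1 / sqrt (\<phi> n))"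
        using c(1) sq by (simp add: field_simps)
      ultimately show ?thesis by (simp only: mult.assoc)
    qed
    have "0 \<le> (SUP x. \<bar>\<P>(\<omega> in P n. ?Y n \<omega> \<le> x) - normal_cdf S x\<bar>)"
      using bound by (intro order_trans[OF _ cSUP_upper[of 0]] bdd_aboveI) auto
    moreover have "(SUP x. \<bar>\<P>(\<omega> in P n. ?Y n \<omega> \<le> x) - normal_cdf S x\<bar>) \<le> C * (1 / c + 1) * (1 / sqrt (\<phi> n))"
      using bound by (intro cSUP_least) auto
    moreover have "norm (1 / sqrt (\<phi> n)) = 1 / sqrt (\<phi> n)" using sq by simp
    ultimately show ?case by (simp only: real_norm_def abs_of_nonneg)
  qed
  then show ?thesis by (rule bigoI)
qed

text \<open>The factorisation of \<open>S\<close> exhibits a law with the limiting transform, and the transforms converge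
in particular at imaginary arguments.\<close>

lemma quasi_power_degenerate:
  fixes P :: "nat \<Rightarrow> 'a measure" and \<Omega> :: "nat \<Rightarrow> 'a \<Rightarrow> real^'m" and S :: "real^'m^'m"
  assumes ev: "\<forall>\<^sub>F n in sequentially. quasi_power_at (P n) (\<Omega> n) (\<phi> n) (cvec \<mu>) (map_matrix complex_of_real S) r B"
    and r: "r > 0" and phi: "filterlim \<phi> at_top sequentially"
    and S: "pos_semidef S" and inv: "\<not> invertible S"
    and prob: "\<And>n. n \<ge> 1 \<Longrightarrow> prob_space (P n)" and rv: "\<And>n. n \<ge> 1 \<Longrightarrow> \<Omega> n \<in> borel_measurable (P n)"
  shows "\<exists>N. degenerate_normal S N \<and>
        conv_in_distribution P (\<lambda>n \<omega>. (\<Omega> n \<omega> - \<phi> n *\<^sub>R \<mu>) /\<^sub>R sqrt (\<phi> n)) N"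
proof -
  let ?H = "map_matrix complex_of_real S"
  let ?Y = "\<lambda>n \<omega>. (\<Omega> n \<omega> - \<phi> n *\<^sub>R \<mu>) /\<^sub>R sqrt (\<phi> n)"
  obtain A :: "real^'m^'m" where A: "S = A ** transpose A" by (rule pos_semidef_factor[OF S])
  let ?N = "normal_measure A"
  have ib: "exp (bilin y (\<i> *s cvec t)) = iexp (t \<bullet> y)" for y t :: "real^'m" by (simp add: bilin_smult bilin_cvec)
  have cfN: "(CLINT y|?N. iexp (t \<bullet> y)) = exp (qform ?H (\<i> *s cvec t) / 2)" for t
    using mgf_normal_measure[of A "\<i> *s cvec t"] unfolding ib A[symmetric] .
  have q: "exp (qform ?H (\<i> *s cvec t) / 2) = complex_of_real (exp (- (1 / 2) * (t \<bullet> (S *v t))))" for t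
    by (simp add: qform_smult qform_cvec exp_of_real[symmetric] del: exp_of_real)
  have "degenerate_normal S ?N"
    unfolding degenerate_normal_def using S inv prob_space_normal_measure by (auto simp: cfN q)
  moreover have "conv_in_distribution P ?Y ?N"
    unfolding conv_in_distribution_def
  proof (intro allI impI)
    fix f :: "real^'m \<Rightarrow> real" assume f: "continuous_on UNIV f \<and> bounded (range f)"
    then obtain b where b: "\<And>x. \<bar>f x\<bar> \<le> b" unfolding bounded_iff by auto
    \<comment> \<open>the hypotheses say nothing about \<open>P 0\<close>\<close>
    define \<nu> where "\<nu> n = (if n \<ge> 1 then distr (P n) borel (?Y n) else ?N)" for n
    have Ym: "?Y n \<in> measurable (P n) borel" if "n \<ge> 1" for n
      using rv[OF that] by measurable
    have "(\<lambda>n. LINT y|\<nu> n. f y) \<longlonglongrightarrow> (LINT y|?N. f y)"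
    proof (rule Levy_continuity_vec[OF _ _ prob_space_normal_measure sets_normal_measure _ _ b])
      show "prob_space (\<nu> n)" for n
        using prob_space.prob_space_distr[OF prob Ym] prob_space_normal_measure[of A]
        unfolding \<nu>_def by (cases "n \<ge> 1") auto
      show "sets (\<nu> n) = sets borel" for n by (simp add: \<nu>_def)
      show "continuous_on UNIV f" using f by simp
      fix t :: "real^'m"
      have "(\<lambda>n. mgf (P n) (?Y n) (\<i> *s cvec t)) \<longlonglongrightarrow> exp (qform ?H (\<i> *s cvec t) / 2)"
        by (rule quasi_power_mgf_limit[OF ev r phi])
      moreover have "\<forall>\<^sub>F n in sequentially. mgf (P n) (?Y n) (\<i> *s cvec t) = (CLINT y|\<nu> n. iexp (t \<bullet> y))"
        using eventually_ge_at_top[of 1]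
      proof eventually_elim
        case (elim n)
        have "(CLINT y|distr (P n) borel (?Y n). iexp (t \<bullet> y)) = (CLINT \<omega>|P n. iexp (t \<bullet> ?Y n \<omega>))"
          by (rule integral_distr[OF Ym[OF elim]]) measurable
        then show ?case using elim unfolding mgf_def ib \<nu>_def by simp
      qed
      ultimately show "(\<lambda>n. CLINT y|\<nu> n. iexp (t \<bullet> y)) \<longlonglongrightarrow> (CLINT y|?N. iexp (t \<bullet> y))"
        unfolding cfN by (rule Lim_transform_eventually)
    qed
    moreover have "\<forall>\<^sub>F n in sequentially. (LINT y|\<nu> n. f y) = (LINT \<omega>|P n. f (?Y n \<omega>))"
      using eventually_ge_at_top[of 1]
    proof eventually_elim
      case (elim n)
      have "f \<in> borel_measurable borel" using f by (intro borel_measurable_continuous_onI) simp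
      then show ?case using elim unfolding \<nu>_def by (simp add: integral_distr[OF Ym[OF elim]])
    qed
    ultimately show "(\<lambda>n. LINT \<omega>|P n. f (?Y n \<omega>)) \<longlonglongrightarrow> (LINT y|?N. f y)"
      by (rule Lim_transform_eventually)
  qed
  ultimately show ?thesis by blast
qed

lemma invertible_of_real_matrix:
  fixes S :: "real^'m^'m"
  shows "invertible (map_matrix complex_of_real S) \<longleftrightarrow> invertible S"
proof -
  have "det (map_matrix complex_of_real S) = complex_of_real (det S)"
    by (simp add: det_def map_matrix_def)
  then show ?thesis by (simp add: invertible_det_nz)
qed

theorem theorem1:
  fixes P :: "nat \<Rightarrow> 'a measure"
    and \<Omega> :: "nat \<Rightarrow> 'a \<Rightarrow> real^'m"
    and \<tau> :: real
    and W :: "nat \<Rightarrow> complex^'m \<Rightarrow> complex"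
    and u v :: "complex^'m \<Rightarrow> complex"
    and \<phi> \<kappa> :: "nat \<Rightarrow> real"
  assumes prob: "\<And>n. n \<ge> 1 \<Longrightarrow> prob_space (P n)"
    and rv: "\<And>n. n \<ge> 1 \<Longrightarrow> \<Omega> n \<in> borel_measurable (P n)"
    and tau: "\<tau> > 0"
    and mgf_asymp: "\<exists>C. \<forall>\<^sub>F n in sequentially. \<forall>s. max_norm s \<le> \<tau> \<longrightarrow>
          integrable (P n) (\<lambda>\<omega>. exp (bilin (\<Omega> n \<omega>) s)) \<and>
          (\<exists>\<epsilon>. mgf (P n) (\<Omega> n) s = exp (W n s) * (1 + \<epsilon>) \<and> cmod \<epsilon> \<le> C * \<bar>1 / \<kappa> n\<bar>)"
    and W: "\<And>n s. n \<ge> 1 \<Longrightarrow> max_norm s \<le> \<tau> \<Longrightarrow> W n s = u s * complex_of_real (\<phi> n) + v s"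
    and u: "multi_analytic_on u {s. max_norm s \<le> \<tau>}"
    and v: "multi_analytic_on v {s. max_norm s \<le> \<tau>}"
    and phi: "filterlim \<phi> at_top sequentially"
    and kappa: "filterlim \<kappa> at_top sequentially"
  shows "\<exists>(\<mu> :: real^'m) (\<Sigma> :: real^'m^'m).
    grad u 0 = (\<chi> j. complex_of_real (\<mu> $ j)) \<and>
    hessian u 0 = map_matrix complex_of_real \<Sigma> \<and>
    (invertible (hessian u 0) \<longrightarrow>
      pos_def \<Sigma> \<and>
      (\<lambda>n. SUP x. \<bar>\<P>(\<omega> in P n. (\<Omega> n \<omega> - \<phi> n *\<^sub>R \<mu>) /\<^sub>R sqrt (\<phi> n) \<le> x) - normal_cdf \<Sigma> x\<bar>)
        \<in> O(\<lambda>n. 1 / sqrt (\<phi> n))) \<and>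
    (\<not> invertible (hessian u 0) \<longrightarrow>
      (\<exists>N. degenerate_normal \<Sigma> N \<and>
        conv_in_distribution P (\<lambda>n \<omega>. (\<Omega> n \<omega> - \<phi> n *\<^sub>R \<mu>) /\<^sub>R sqrt (\<phi> n)) N))"
proof -
  have u0: "multi_analytic_at u 0" and v0: "multi_analytic_at v 0"
    using u v tau unfolding multi_analytic_on_def by auto
  obtain r B where r: "r > 0" and B: "B \<ge> 0" and H: "transpose (hessian u 0) = hessian u 0"
    and ev: "\<forall>\<^sub>F n in sequentially. quasi_power_at (P n) (\<Omega> n) (\<phi> n) (grad u 0) (hessian u 0) r B"
    by (rule quasi_power_expansion[OF prob rv tau mgf_asymp W u0 v0 phi kappa]) blast
  obtain \<mu> where \<mu>: "grad u 0 = cvec \<mu>" using quasi_power_grad_real[OF ev r phi] by blast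
  note ev1 = ev[unfolded \<mu>]
  have "\<forall>\<^sub>F n in sequentially. prob_space (P n)"
    using eventually_ge_at_top[of 1] by eventually_elim (rule prob)
  then obtain \<Sigma> where \<Sigma>: "hessian u 0 = map_matrix complex_of_real \<Sigma>" and psd: "pos_semidef \<Sigma>"
    using quasi_power_hessian_psd[OF ev1 r phi H] by blast
  note ev2 = ev1[unfolded \<Sigma>]
  show ?thesis
  proof (intro exI[of _ \<mu>] exI[of _ \<Sigma>] conjI impI)
    show "grad u 0 = (\<chi> j. complex_of_real (\<mu> $ j))" using \<mu> by (simp add: cvec_def)
    show "hessian u 0 = map_matrix complex_of_real \<Sigma>" by (rule \<Sigma>)
    assume "invertible (hessian u 0)"
    then have inv: "invertible \<Sigma>" unfolding \<Sigma> invertible_of_real_matrix .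
    show "pos_def \<Sigma>" by (rule pos_semidef_invertible_imp_pos_def[OF psd inv])
    show "(\<lambda>n. SUP x. \<bar>\<P>(\<omega> in P n. (\<Omega> n \<omega> - \<phi> n *\<^sub>R \<mu>) /\<^sub>R sqrt (\<phi> n) \<le> x) - normal_cdf \<Sigma> x\<bar>)
        \<in> O(\<lambda>n. 1 / sqrt (\<phi> n))"
      by (rule quasi_power_Berry_Esseen[OF ev2 r B phi psd inv prob rv])
  next
    assume "\<not> invertible (hessian u 0)"
    then have inv: "\<not> invertible \<Sigma>" unfolding \<Sigma> invertible_of_real_matrix .
    show "\<exists>N. degenerate_normal \<Sigma> N \<and>
        conv_in_distribution P (\<lambda>n \<omega>. (\<Omega> n \<omega> - \<phi> n *\<^sub>R \<mu>) /\<^sub>R sqrt (\<phi> n)) N"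
      by (rule quasi_power_degenerate[OF ev2 r phi psd inv prob rv])
  qed
qed

end
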